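(* The doubling map $\psi\mapsto 2\psi$ establishes an isomorphism between the real moduli space $\mathcal M$ and the space $\mathcal C$ of conjugacy classes in $PSO(6)$, transforming the scaling foliation on $\mathcal M$ into (the foliation by orbits of) the gradient flow, for the Killing metric, of the character of the signature representation of $SO(6)$, i.e. of the super-trace of the action of $SO(6)$ on $\wedge^3\mathbb C^6=\wedge^3_+\mathbb C^6\oplus\wedge^3_-\mathbb C^6$, where $\wedge^3_\pm\mathbb C^6=\{\omega\in\wedge^3\mathbb C^6\mid *\omega=\pm i\,\omega\}$.
   Context: Moduli space. Let $\mathcal S=\{\Lambda\in M_4(\mathbb C)\mid\Lambda=\Lambda^t,\ \Lambda^*=\Lambda^{-1}\}$. The real moduli space $\mathcal M$ is the quotient of $\mathcal S$ by $\Lambda\mapsto e^{-2i\varphi}\Lambda$ ($\varphi\in\mathbb R$) and $\Lambda\mapsto S\Lambda S^t$ ($S\in SO(4)$). Every class is represented by a diagonal matrix $\mathrm{diag}(1,e^{-2i\varphi_1},e^{-2i\varphi_2},e^{-2i\varphi_3})$ with $\varphi_k\in\mathbb R/\pi\mathbb Z$. Coordinates $\psi$. Set $2\psi_1=\varphi_2+\varphi_3-\varphi_1$, $2\psi_2=\varphi_3+\varphi_1-\varphi_2$, $2\psi_3=\varphi_1+\varphi_2-\varphi_3$. This identifies $\mathcal M$ with $T_D/W$. Here $T_D=\mathbb R^3/\Gamma_D$ with $\Gamma_D=\{\psi\mid \psi_i\pm\psi_j\in\pi\mathbb Z \text{ for } i\neq j\}$, and $W$ is the group of transformations $(\psi_1,\psi_2,\psi_3)\mapsto(\varepsilon_1\psi_{s(1)},\varepsilon_2\psi_{s(2)},\varepsilon_3\psi_{s(3)})$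 with $s\in\mathfrak S_3$, $\varepsilon_k=\pm1$, $\varepsilon_1\varepsilon_2\varepsilon_3=1$. The Killing metric in these coordinates is $d\psi_1^2+d\psi_2^2+d\psi_3^2$. Conjugacy classes. The vector $\psi\in\mathbb R^3$ corresponds to the block-diagonal element of $\mathfrak{so}(6)$ with three blocks $\begin{pmatrix}0&\psi_k\\-\psi_k&0\end{pmatrix}$ (an element of the maximal abelian subalgebra), and its exponential defines a conjugacy class in $PSO(6)=SO(6)/\{\pm1\}$. Scaling foliation. It is the foliation of $\mathcal M$ by the orbits of the vector field $$Z=\sum_{k=1}^3\sin(2\varphi_k)\sin(\varphi_\ell+\varphi_m-\varphi_k)\frac{\partial}{\partial\varphi_k},$$ where $(k,\ell,m)$ is the cyclic permutation of $(1,2,3)$ starting with $k$. *)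

theory Defs
  imports "HOL-Analysis.Analysis" "HOL-Algebra.Group_Action"
begin

section \<open>Quotient topologies, orbits of vector fields, gradients\<close>

definition quotient_topology :: "'a topology \<Rightarrow> ('a \<Rightarrow> 'b) \<Rightarrow> 'b topology" where
  "quotient_topology X q =
     topology (\<lambda>U. U \<subseteq> q ` topspace X \<and> openin X {x \<in> topspace X. q x \<in> U})"

lemma openin_quotient_topology:
  "openin (quotient_topology X q) U \<longleftrightarrow>
     U \<subseteq> q ` topspace X \<and> openin X {x \<in> topspace X. q x \<in> U}"
proof -
  have "istopology (\<lambda>U. U \<subseteq> q ` topspace X \<and> openin X {x \<in> topspace X. q x \<in> U})"
  proof -
    have 1: "{x \<in> topspace X. q x \<in> S \<inter> T} =
        {x \<in> topspace X. q x \<in> S} \<inter> {x \<in> topspace X. q x \<in> T}" for S T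
      by auto
    have 2: "{x \<in> topspace X. q x \<in> \<Union>\<K>} = (\<Union>S\<in>\<K>. {x \<in> topspace X. q x \<in> S})" for \<K>
      by auto
    show ?thesis
      unfolding istopology_def 1 2 by blast
  qed
  then show ?thesis
    unfolding quotient_topology_def by (simp add: topology_inverse')
qed

lemma topspace_quotient_topology: "topspace (quotient_topology X q) = q ` topspace X"
proof -
  have "{x \<in> topspace X. q x \<in> q ` topspace X} = topspace X"
    by auto
  then have "openin (quotient_topology X q) (q ` topspace X)"
    by (simp add: openin_quotient_topology)
  then show ?thesis
    using openin_subset openin_topspace openin_quotient_topology by (metis subset_antisym)
qed

lemma quotient_map_quotient_topology: "quotient_map X (quotient_topology X q) q"
  by (simp add: quotient_map_def topspace_quotient_topology openin_quotient_topology)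

text \<open>The set of points that can be joined to \<open>x\<close> by an integral curve. By uniqueness of
  solutions this is the trace of the maximal integral curve when \<open>X\<close> is locally Lipschitz.\<close>

definition vf_orbit :: "('a::real_normed_vector \<Rightarrow> 'a) \<Rightarrow> 'a \<Rightarrow> 'a set" where
  "vf_orbit X x =
     {\<gamma> t | \<gamma> T t. open T \<and> is_interval T \<and> (0::real) \<in> T \<and> t \<in> T \<and> \<gamma> 0 = x \<and>
        (\<forall>s\<in>T. (\<gamma> has_vector_derivative X (\<gamma> s)) (at s))}"

definition gradient :: "('a::real_inner \<Rightarrow> real) \<Rightarrow> 'a \<Rightarrow> 'a" where
  "gradient f x = (THE D. GDERIV f x :> D)"

section \<open>The real moduli space and its scaling foliation\<close>

definition sym_unitary :: "(complex^4^4) set" where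
  "sym_unitary =
     {\<Lambda>. \<Lambda> = transpose \<Lambda> \<and> invertible \<Lambda> \<and> map_matrix cnj (transpose \<Lambda>) = matrix_inv \<Lambda>}"

definition moduli_class :: "complex^4^4 \<Rightarrow> (complex^4^4) set" where
  "moduli_class \<Lambda> =
     {map_matrix ((*) (exp (- 2 * \<i> * complex_of_real \<phi>)))
        (map_matrix complex_of_real S ** \<Lambda> ** transpose (map_matrix complex_of_real S)) | \<phi> S.
        rotation_matrix S}"

definition moduli_topology :: "(complex^4^4) set topology" where
  "moduli_topology = quotient_topology (top_of_set sym_unitary) moduli_class"

text \<open>Numeral index types are cyclic: in type \<open>4\<close> the indices are \<open>1, 2, 3\<close> and \<open>4 = 0\<close>, and in
  type \<open>3\<close> the triple \<open>(k, k + 1, k + 2)\<close> is the cyclic permutation of \<open>(1, 2, 3)\<close> starting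
  with \<open>k\<close>.\<close>

definition diag_phase :: "real^3 \<Rightarrow> complex^4^4" where
  "diag_phase \<phi> = (\<chi> i j. if i \<noteq> j then 0
     else if i = 1 then 1
     else if i = 2 then exp (- 2 * \<i> * complex_of_real (\<phi> $ 1))
     else if i = 3 then exp (- 2 * \<i> * complex_of_real (\<phi> $ 2))
     else exp (- 2 * \<i> * complex_of_real (\<phi> $ 3)))"

definition psi_coord :: "real^3 \<Rightarrow> real^3" where
  "psi_coord \<phi> = (\<chi> k. (\<phi> $ (k + 1) + \<phi> $ (k + 2) - \<phi> $ k) / 2)"

definition scaling_field :: "real^3 \<Rightarrow> real^3" where
  "scaling_field \<phi> = (\<chi> k. sin (2 * \<phi> $ k) * sin (\<phi> $ (k + 1) + \<phi> $ (k + 2) - \<phi> $ k))"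

text \<open>The field is invariant under the lattice \<open>(\<pi>\<int>)\<^sup>3\<close> only up to sign, but its orbits, as
  unparametrised sets, descend to the moduli space.\<close>

definition scaling_foliation :: "(complex^4^4) set set set" where
  "scaling_foliation =
     {(\<lambda>\<phi>. moduli_class (diag_phase \<phi>)) ` vf_orbit scaling_field \<phi>\<^sub>0 | \<phi>\<^sub>0. True}"

section \<open>Conjugacy classes in \<open>PSO(6)\<close>\<close>

definition SO6 :: "(real^6^6) monoid" where
  "SO6 = \<lparr>carrier = {A. rotation_matrix A}, mult = (**), one = mat 1\<rparr>"

definition PSO6 :: "(real^6^6) set monoid" where
  "PSO6 = SO6 Mod {mat 1, - mat 1}"

definition PSO6_class :: "real^6^6 \<Rightarrow> (real^6^6) set" where
  "PSO6_class A = {mat 1, - mat 1} #>\<^bsub>SO6\<^esub> A"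

definition PSO6_conj_class :: "(real^6^6) set \<Rightarrow> (real^6^6) set set" where
  "PSO6_conj_class = orbit PSO6 (\<lambda>g x. g \<otimes>\<^bsub>PSO6\<^esub> x \<otimes>\<^bsub>PSO6\<^esub> inv\<^bsub>PSO6\<^esub> g)"

definition conj_topology :: "(real^6^6) set set topology" where
  "conj_topology =
     quotient_topology (quotient_topology (top_of_set (carrier SO6)) PSO6_class) PSO6_conj_class"

lemma SO6_group: "group SO6"
proof (rule groupI)
  fix A assume A: "A \<in> carrier SO6"
  then have "transpose A \<in> carrier SO6"
    by (auto simp: SO6_def rotation_matrix_def orthogonal_matrix_transpose)
  moreover have "transpose A \<otimes>\<^bsub>SO6\<^esub> A = \<one>\<^bsub>SO6\<^esub>"
    using A by (auto simp: SO6_def rotation_matrix_def orthogonal_matrix)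
  ultimately show "\<exists>B\<in>carrier SO6. B \<otimes>\<^bsub>SO6\<^esub> A = \<one>\<^bsub>SO6\<^esub>"
    by blast
qed (auto simp: SO6_def rotation_matrix_def orthogonal_matrix_mul orthogonal_matrix_id
      det_mul matrix_mul_assoc)

lemma minus_one_matrix_mult:
  fixes A :: "real^6^6"
  shows "- mat 1 ** A = - A" "A ** - mat 1 = - A"
proof -
  have "- mat 1 ** A = - (mat 1 ** A)" "A ** - mat 1 = - (A ** mat 1)"
    by (simp_all add: vec_eq_iff matrix_matrix_mult_def sum_negf)
  then show "- mat 1 ** A = - A" "A ** - mat 1 = - A"
    by simp_all
qed

lemma minus_one_in_SO6: "(- mat 1 :: real^6^6) \<in> carrier SO6"
proof -
  have "det (- mat 1 :: real^6^6) = 1"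
    by (subst det_diagonal) (auto simp: mat_def)
  moreover have "transpose (- mat 1 :: real^6^6) = - mat 1"
    by (simp add: vec_eq_iff transpose_def mat_def)
  ultimately show ?thesis
    by (simp add: SO6_def rotation_matrix_def orthogonal_matrix minus_one_matrix_mult)
qed

lemma PSO6_group: "group PSO6"
proof -
  interpret group SO6 by (rule SO6_group)
  have sub: "subgroup {mat 1, - mat 1} SO6"
  proof (rule subgroupI)
    show "{mat 1, - mat 1} \<subseteq> carrier SO6"
      using minus_one_in_SO6 one_closed by (simp add: SO6_def)
    fix a assume a: "a \<in> {mat 1, - mat 1 :: real^6^6}"
    have "inv\<^bsub>SO6\<^esub> a = a"
    proof (rule inv_equality)
      show "a \<otimes>\<^bsub>SO6\<^esub> a = \<one>\<^bsub>SO6\<^esub>"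
        using a by (auto simp: SO6_def minus_one_matrix_mult)
      show "a \<in> carrier SO6" "a \<in> carrier SO6"
        using a minus_one_in_SO6 one_closed by (auto simp: SO6_def)
    qed
    then show "inv\<^bsub>SO6\<^esub> a \<in> {mat 1, - mat 1}"
      using a by simp
    fix b assume "b \<in> {mat 1, - mat 1 :: real^6^6}"
    with a show "a \<otimes>\<^bsub>SO6\<^esub> b \<in> {mat 1, - mat 1}"
      by (auto simp: SO6_def minus_one_matrix_mult)
  qed simp
  have "{mat 1, - mat 1} \<lhd> SO6"
  proof (rule normalI[OF sub], rule ballI)
    fix x assume "x \<in> carrier SO6"
    show "{mat 1, - mat 1} #>\<^bsub>SO6\<^esub> x = x <#\<^bsub>SO6\<^esub> {mat 1, - mat 1}"
      by (auto simp: r_coset_def l_coset_def SO6_def minus_one_matrix_mult)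
  qed
  then show ?thesis
    unfolding PSO6_def by (rule normal.factorgroup_is_group)
qed

definition matrix_exp :: "real^'n^'n \<Rightarrow> real^'n^'n" where
  "matrix_exp A = (\<Sum>n. (1 / fact n) *\<^sub>R (((**) A ^^ n) (mat 1)))"

definition block_so6 :: "real^3 \<Rightarrow> real^6^6" where
  "block_so6 \<psi> = (\<chi> i j.
     if i = 1 \<and> j = 2 then \<psi> $ 1 else if i = 2 \<and> j = 1 then - \<psi> $ 1
     else if i = 3 \<and> j = 4 then \<psi> $ 2 else if i = 4 \<and> j = 3 then - \<psi> $ 2
     else if i = 5 \<and> j = 6 then \<psi> $ 3 else if i = 6 \<and> j = 5 then - \<psi> $ 3
     else 0)"

definition torus_conj_class :: "real^3 \<Rightarrow> (real^6^6) set set" where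
  "torus_conj_class \<psi> = PSO6_conj_class (PSO6_class (matrix_exp (block_so6 \<psi>)))"

section \<open>The character of the signature representation\<close>

text \<open>\<open>\<wedge>\<^sup>3 \<complex>\<^sup>6\<close> is realised as the space of alternating tensors \<open>\<omega>\<^sub>i\<^sub>j\<^sub>k\<close>.\<close>

definition Lambda3 :: "(complex^(6 \<times> 6 \<times> 6)) set" where
  "Lambda3 = {\<omega>. \<forall>i j k. \<omega> $ (j, i, k) = - \<omega> $ (i, j, k) \<and> \<omega> $ (i, k, j) = - \<omega> $ (i, j, k)}"

definition Lambda3_act :: "real^6^6 \<Rightarrow> complex^(6 \<times> 6 \<times> 6) \<Rightarrow> complex^(6 \<times> 6 \<times> 6)" where
  "Lambda3_act A \<omega> = vec_lambda (\<lambda>(i, j, k). \<Sum>a\<in>UNIV. \<Sum>b\<in>UNIV. \<Sum>c\<in>UNIV.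
     complex_of_real (A $ i $ a * A $ j $ b * A $ k $ c) * \<omega> $ (a, b, c))"

text \<open>The complex-linear Hodge star for the standard metric and the orientation
  \<open>e\<^sub>1 \<and> \<dots> \<and> e\<^sub>6\<close>: \<open>(\<star>\<omega>)\<^sub>l\<^sub>m\<^sub>n = (1/3!) \<Sum>\<^sub>i\<^sub>j\<^sub>k \<epsilon>\<^sub>i\<^sub>j\<^sub>k\<^sub>l\<^sub>m\<^sub>n \<omega>\<^sub>i\<^sub>j\<^sub>k\<close>, the sum over \<open>i j k\<close> being written as a
  sum over permutations.\<close>

definition hodge_star :: "complex^(6 \<times> 6 \<times> 6) \<Rightarrow> complex^(6 \<times> 6 \<times> 6)" where
  "hodge_star \<omega> = vec_lambda (\<lambda>(l, m, n).
     (\<Sum>p | p permutes (UNIV :: 6 set) \<and> p 4 = l \<and> p 5 = m \<and> p 6 = n.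
        of_int (sign p) * \<omega> $ (p 1, p 2, p 3)) / fact 3)"

definition Lambda3_plus :: "(complex^(6 \<times> 6 \<times> 6)) set" where
  "Lambda3_plus = {\<omega> \<in> Lambda3. hodge_star \<omega> = \<i> *s \<omega>}"

definition Lambda3_minus :: "(complex^(6 \<times> 6 \<times> 6)) set" where
  "Lambda3_minus = {\<omega> \<in> Lambda3. hodge_star \<omega> = (- \<i>) *s \<omega>}"

definition trace_on :: "('a::field^'n) set \<Rightarrow> ('a^'n \<Rightarrow> 'a^'n) \<Rightarrow> 'a" where
  "trace_on V f =
     (let B = (SOME B. vec.independent B \<and> vec.span B = V)
      in \<Sum>b\<in>B. vec.representation B (f b) b)"

text \<open>The trace does not depend on the basis chosen.\<close>

lemma trace_on_basis:
  fixes f :: "'a::field^'n \<Rightarrow> 'a^'n"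
  assumes B: "vec.independent B" "vec.span B = V"
    and lin: "Vector_Spaces.linear (*s) (*s) f" and fV: "f ` V \<subseteq> V"
  shows "trace_on V f = (\<Sum>b\<in>B. vec.representation B (f b) b)"
proof -
  interpret f: Vector_Spaces.linear "(*s)" "(*s)" f by (rule lin)
  define B' where "B' = (SOME B. vec.independent B \<and> vec.span B = V)"
  have B': "vec.independent B'" "vec.span B' = V"
    unfolding B'_def using someI[of "\<lambda>B. vec.independent B \<and> vec.span B = V" B] B by auto
  have fin: "finite B" "finite B'"
    using B B' by (auto intro: vec.finiteI_independent)
  have sub: "B \<subseteq> V" "B' \<subseteq> V"
    using B B' vec.span_superset by auto
  have *: "vec.representation B (f b) b =
      (\<Sum>c\<in>B'. vec.representation B' (f b) c * vec.representation B c b)" if "b \<in> B" for b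
  proof -
    have "f b = (\<Sum>c\<in>B'. vec.representation B' (f b) c *s c)"
      using that fV sub B' fin by (subst vec.sum_representation_eq) auto
    then have "vec.representation B (f b) =
        vec.representation B (\<Sum>c\<in>B'. vec.representation B' (f b) c *s c)"
      by simp
    also have "\<dots> = (\<lambda>v. \<Sum>c\<in>B'. vec.representation B (vec.representation B' (f b) c *s c) v)"
      using B sub by (intro vec.representation_sum) (auto intro!: vec.span_scale)
    also have "\<dots> = (\<lambda>v. \<Sum>c\<in>B'. vec.representation B' (f b) c * vec.representation B c v)"
      using B sub by (intro ext sum.cong refl) (subst vec.representation_scale; force)
    finally show ?thesis
      by simp
  qed
  have **: "vec.representation B' (f c) c =
      (\<Sum>b\<in>B. vec.representation B' (f b) c * vec.representation B c b)" if "c \<in> B'" for c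
  proof -
    have "c = (\<Sum>b\<in>B. vec.representation B c b *s b)"
      using that sub B fin by (subst vec.sum_representation_eq) auto
    then have "f c = f (\<Sum>b\<in>B. vec.representation B c b *s b)"
      by simp
    also have "\<dots> = (\<Sum>b\<in>B. vec.representation B c b *s f b)"
      by (simp add: f.sum f.scale)
    finally have "vec.representation B' (f c) =
        vec.representation B' (\<Sum>b\<in>B. vec.representation B c b *s f b)"
      by simp
    also have "\<dots> = (\<lambda>v. \<Sum>b\<in>B. vec.representation B' (vec.representation B c b *s f b) v)"
      using B' sub fV by (intro vec.representation_sum) (auto intro!: vec.span_scale)
    also have "\<dots> = (\<lambda>v. \<Sum>b\<in>B. vec.representation B c b * vec.representation B' (f b) v)"
      using B' sub fV by (intro ext sum.cong refl) (subst vec.representation_scale; force)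
    finally show ?thesis
      by (simp add: mult.commute)
  qed
  have "(\<Sum>b\<in>B. vec.representation B (f b) b) =
      (\<Sum>b\<in>B. \<Sum>c\<in>B'. vec.representation B' (f b) c * vec.representation B c b)"
    by (simp add: *)
  also have "\<dots> = (\<Sum>c\<in>B'. vec.representation B' (f c) c)"
    by (subst sum.swap) (simp add: **)
  finally show ?thesis
    by (simp add: trace_on_def Let_def B'_def)
qed

definition cnj_vec :: "complex^'n \<Rightarrow> complex^'n" where
  "cnj_vec v = (\<chi> i. cnj (v $ i))"

lemma cnj_vec_simps:
  "cnj_vec v $ i = cnj (v $ i)" "cnj_vec (cnj_vec v) = v"
  "cnj_vec (v + w) = cnj_vec v + cnj_vec w" "cnj_vec (c *s v) = cnj c *s cnj_vec v"
  "cnj_vec (- v) = - cnj_vec v" "cnj_vec 0 = 0"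
  by (simp_all add: cnj_vec_def vec_eq_iff)

lemma cnj_vec_sum: "cnj_vec (\<Sum>i\<in>I. f i) = (\<Sum>i\<in>I. cnj_vec (f i))"
  by (induction I rule: infinite_finite_induct) (auto simp: cnj_vec_simps)

lemma inj_cnj_vec: "inj cnj_vec"
  by (metis cnj_vec_simps(2) injI)

lemma independent_cnj_vec:
  assumes "vec.independent B"
  shows "vec.independent (cnj_vec ` B)"
proof -
  have fin: "finite B"
    using assms by (rule vec.finiteI_independent)
  have "\<forall>v\<in>B. u (cnj_vec v) = 0" if u: "(\<Sum>v\<in>cnj_vec ` B. u v *s v) = 0" for u
  proof -
    have "0 = cnj_vec (\<Sum>v\<in>cnj_vec ` B. u v *s v)"
      using u by (simp add: cnj_vec_simps)
    also have "\<dots> = (\<Sum>v\<in>B. cnj (u (cnj_vec v)) *s v)"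
      by (subst sum.reindex)
        (auto simp: cnj_vec_sum cnj_vec_simps intro: inj_on_subset[OF inj_cnj_vec])
    finally have "(\<Sum>v\<in>B. cnj (u (cnj_vec v)) *s v) = 0"
      by simp
    then have "\<forall>v\<in>B. cnj (u (cnj_vec v)) = 0"
      using assms fin vec.independentD[of B B "\<lambda>v. cnj (u (cnj_vec v))"] by blast
    then show ?thesis
      by simp
  qed
  then show ?thesis
    using fin by (subst vec.dependent_finite) auto
qed

lemma span_cnj_vec: "vec.span (cnj_vec ` B) = cnj_vec ` vec.span B"
proof -
  have sub: "vec.subspace (cnj_vec ` V)" if "vec.subspace V" for V :: "(complex^'n) set"
  proof -
    have eq: "cnj_vec ` V = {w. cnj_vec w \<in> V}"
      by (auto simp: cnj_vec_simps image_iff) (metis cnj_vec_simps(2))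
    show ?thesis
      using that unfolding eq vec.subspace_def by (simp add: cnj_vec_simps)
  qed
  have le: "vec.span (cnj_vec ` B) \<subseteq> cnj_vec ` vec.span B" for B :: "(complex^'n) set"
    by (rule vec.span_minimal) (auto intro: sub vec.span_base)
  have "cnj_vec ` vec.span (cnj_vec ` (cnj_vec ` B)) \<subseteq> cnj_vec ` (cnj_vec ` vec.span (cnj_vec ` B))"
    by (rule image_mono[OF le])
  then have "cnj_vec ` vec.span B \<subseteq> vec.span (cnj_vec ` B)"
    by (simp add: image_image cnj_vec_simps)
  with le show ?thesis
    by blast
qed

lemma trace_on_cnj_vec:
  fixes f :: "complex^'n \<Rightarrow> complex^'n"
  assumes V: "vec.subspace V" and lin: "Vector_Spaces.linear (*s) (*s) f" and fV: "f ` V \<subseteq> V"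
    and comm: "\<And>v. f (cnj_vec v) = cnj_vec (f v)"
  shows "trace_on (cnj_vec ` V) f = cnj (trace_on V f)"
proof -
  obtain B where B: "vec.independent B" "vec.span B = V" "B \<subseteq> V"
    using vec.basis_exists[of V] V by (metis vec.span_subspace)
  have fin: "finite B"
    using B by (auto intro: vec.finiteI_independent)
  have B': "vec.independent (cnj_vec ` B)" "vec.span (cnj_vec ` B) = cnj_vec ` V"
    using B by (auto simp: independent_cnj_vec span_cnj_vec)
  have rep: "vec.representation (cnj_vec ` B) (cnj_vec v) (cnj_vec b) =
      cnj (vec.representation B v b)" if v: "v \<in> V" and b: "b \<in> B" for v b
  proof -
    define r where "r = (\<lambda>w. cnj (vec.representation B v (cnj_vec w)))"
    have "cnj_vec v = cnj_vec (\<Sum>b\<in>B. vec.representation B v b *s b)"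
      using B v fin by (subst vec.sum_representation_eq) auto
    also have "\<dots> = (\<Sum>w\<in>cnj_vec ` B. r w *s w)"
      by (subst sum.reindex)
        (auto simp: r_def cnj_vec_sum cnj_vec_simps intro: inj_on_subset[OF inj_cnj_vec])
    finally have eq: "(\<Sum>w\<in>cnj_vec ` B. r w *s w) = cnj_vec v"
      by simp
    have nz: "w \<in> cnj_vec ` B" if "r w \<noteq> 0" for w
    proof -
      have "cnj_vec w \<in> B"
        using that by (auto simp: r_def dest: vec.representation_ne_zero)
      then show ?thesis
        by (metis cnj_vec_simps(2) imageI)
    qed
    have "vec.representation (cnj_vec ` B) (cnj_vec v) = r"
    proof (rule vec.representation_eqI[OF B'(1)])
      show "cnj_vec v \<in> vec.span (cnj_vec ` B)"
        using v B' by auto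
      show "finite {w. r w \<noteq> 0}"
        by (rule finite_subset[of _ "cnj_vec ` B"]) (use nz fin in auto)
      show "(\<Sum>w | r w \<noteq> 0. r w *s w) = cnj_vec v"
        unfolding eq[symmetric] using nz fin by (intro sum.mono_neutral_left) auto
    qed (use nz in auto)
    then show ?thesis
      by (simp add: r_def cnj_vec_simps)
  qed
  have "trace_on (cnj_vec ` V) f =
      (\<Sum>w\<in>cnj_vec ` B. vec.representation (cnj_vec ` B) (f w) w)"
    by (rule trace_on_basis[OF B' lin]) (use fV comm in auto)
  also have "\<dots> = (\<Sum>b\<in>B. vec.representation (cnj_vec ` B) (cnj_vec (f b)) (cnj_vec b))"
    by (subst sum.reindex) (auto simp: comm intro: inj_on_subset[OF inj_cnj_vec])
  also have "\<dots> = (\<Sum>b\<in>B. cnj (vec.representation B (f b) b))"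
    using B fV by (intro sum.cong refl rep) auto
  also have "\<dots> = cnj (trace_on V f)"
    by (subst trace_on_basis[OF B(1,2) lin fV]) simp
  finally show ?thesis .
qed

lemma linear_Lambda3_act: "Vector_Spaces.linear (*s) (*s) (Lambda3_act A)"
  by unfold_locales
    (auto simp: Lambda3_act_def vec_eq_iff algebra_simps sum.distrib sum_distrib_left)

definition signature_character :: "real^6^6 \<Rightarrow> complex" where
  "signature_character A =
     trace_on Lambda3_plus (Lambda3_act A) - trace_on Lambda3_minus (Lambda3_act A)"

lemma prod_6: "prod h (UNIV :: 6 set) = h 1 * h 2 * h 3 * h 4 * h 5 * h 6"
proof -
  have "(UNIV :: 6 set) = {1, 2, 3, 4, 5, 6}"
    by (rule sym, rule card_subset_eq) auto
  then have "prod h UNIV = prod h {1, 2, 3, 4, 5, 6 :: 6}"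
    by (rule arg_cong)
  then show ?thesis
    by (simp add: mult.assoc)
qed

lemma hodge_star_Lambda3_act:
  assumes A: "rotation_matrix A"
  shows "hodge_star (Lambda3_act A \<omega>) = Lambda3_act A (hodge_star \<omega>)"
proof -
  let ?P = "{p. p permutes (UNIV :: 6 set)}"
  have fin: "finite ?P"
    by (rule finite_permutations) simp
  have filter: "(\<Sum>p | p permutes (UNIV :: 6 set) \<and> Q p. g p) = (\<Sum>p\<in>?P. if Q p then g p else 0)"
    for Q and g :: "_ \<Rightarrow> complex"
    using sum.inter_filter[OF fin, of g Q] by simp
  have delta: "(\<Sum>a\<in>UNIV. \<Sum>b\<in>UNIV. \<Sum>c\<in>UNIV. if x = a \<and> y = b \<and> z = c then g a b c else 0) = g x y z"
    for x y z :: 6 and g :: "_ \<Rightarrow> _ \<Rightarrow> _ \<Rightarrow> complex"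
  proof -
    have 1: "(\<Sum>c\<in>UNIV. if x = a \<and> y = b \<and> z = c then g a b c else 0) =
        (if x = a \<and> y = b then g a b z else 0)" for a b
      by (cases "x = a \<and> y = b") auto
    have 2: "(\<Sum>b\<in>UNIV. if x = a \<and> y = b then g a b z else 0) = (if x = a then g a y z else 0)" for a
      by (cases "x = a") auto
    show ?thesis
      unfolding 1 2 by simp
  qed
  define d :: "6 \<Rightarrow> 6 \<Rightarrow> real" where "d = (\<lambda>i j. if i = j then 1 else 0)"
  have key: "(\<Sum>p\<in>?P. of_int (sign p) * (A$(p 1)$a * A$(p 2)$b * A$(p 3)$c * d (p 4) l * d (p 5) m * d (p 6) n))
      = (\<Sum>p\<in>?P. of_int (sign p) * (d (p 1) a * d (p 2) b * d (p 3) c * A$l$(p 4) * A$m$(p 5) * A$n$(p 6)))"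
    (is "?L = ?R") for a b c l m n
  proof -
    define N :: "real^6^6" where "N = (\<chi> i j.
      if i = 1 then d j a else if i = 2 then d j b else if i = 3 then d j c
      else if i = 4 then A$l$j else if i = 5 then A$m$j else A$n$j)"
    define X :: "real^6^6" where "X = (\<chi> i j.
      if i = 1 then A$j$a else if i = 2 then A$j$b else if i = 3 then A$j$c
      else if i = 4 then d j l else if i = 5 then d j m else d j n)"
    have o: "(\<Sum>k\<in>UNIV. A$i$k * A$j$k) = d i j" for i j
    proof -
      have "A ** transpose A = mat 1"
        using A by (simp add: rotation_matrix_def orthogonal_matrix_def)
      then have "(A ** transpose A) $ i $ j = mat 1 $ i $ j"
        by simp
      then show ?thesis
        by (simp add: matrix_matrix_mult_def transpose_def mat_def d_def)
    qed
    have X: "X = N ** transpose A"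
      by (simp add: vec_eq_iff X_def N_def matrix_matrix_mult_def transpose_def o)
        (auto simp: d_def if_distrib[of "\<lambda>x. x * _"] cong: if_cong)
    have "det X = det N"
      using A by (simp add: X det_mul det_transpose rotation_matrix_def)
    moreover have "?L = det X" "?R = det N"
      by (simp_all add: det_def prod_6 X_def N_def)
    ultimately show ?thesis
      by simp
  qed
  have h6: "6 * hodge_star \<omega> $ (a, b, c) = (\<Sum>p\<in>?P. if p 4 = a \<and> p 5 = b \<and> p 6 = c
      then of_int (sign p) * \<omega> $ (p 1, p 2, p 3) else 0)" for a b c
    by (simp add: hodge_star_def filter fact_numeral)
  have "hodge_star (Lambda3_act A \<omega>) $ (l, m, n) = Lambda3_act A (hodge_star \<omega>) $ (l, m, n)"
    for l m n
  proof -
    have "6 * hodge_star (Lambda3_act A \<omega>) $ (l, m, n) =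
      (\<Sum>p\<in>?P. if p 4 = l \<and> p 5 = m \<and> p 6 = n then of_int (sign p) *
        (\<Sum>a\<in>UNIV. \<Sum>b\<in>UNIV. \<Sum>c\<in>UNIV.
          of_real (A$(p 1)$a * A$(p 2)$b * A$(p 3)$c) * \<omega> $ (a, b, c)) else 0)"
      by (simp add: hodge_star_def Lambda3_act_def filter fact_numeral cong: if_cong)
    also have "\<dots> = (\<Sum>p\<in>?P. \<Sum>a\<in>UNIV. \<Sum>b\<in>UNIV. \<Sum>c\<in>UNIV. of_real (of_int (sign p) *
        (A$(p 1)$a * A$(p 2)$b * A$(p 3)$c * d (p 4) l * d (p 5) m * d (p 6) n)) * \<omega> $ (a, b, c))"
      by (intro sum.cong refl) (auto simp: d_def sum_distrib_left mult_ac)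
    also have "\<dots> = (\<Sum>a\<in>UNIV. \<Sum>b\<in>UNIV. \<Sum>c\<in>UNIV. \<Sum>p\<in>?P. of_real (of_int (sign p) *
        (A$(p 1)$a * A$(p 2)$b * A$(p 3)$c * d (p 4) l * d (p 5) m * d (p 6) n)) * \<omega> $ (a, b, c))"
      by (simp only: sum.swap[of _ UNIV ?P])
    also have "\<dots> = (\<Sum>a\<in>UNIV. \<Sum>b\<in>UNIV. \<Sum>c\<in>UNIV. \<Sum>p\<in>?P. of_real (of_int (sign p) *
        (d (p 1) a * d (p 2) b * d (p 3) c * A$l$(p 4) * A$m$(p 5) * A$n$(p 6))) * \<omega> $ (a, b, c))"
      by (simp only: sum_distrib_right[symmetric] of_real_sum[symmetric] key)
    also have "\<dots> = (\<Sum>p\<in>?P. \<Sum>a\<in>UNIV. \<Sum>b\<in>UNIV. \<Sum>c\<in>UNIV. of_real (of_int (sign p) *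
        (d (p 1) a * d (p 2) b * d (p 3) c * A$l$(p 4) * A$m$(p 5) * A$n$(p 6))) * \<omega> $ (a, b, c))"
      by (simp only: sum.swap[of _ UNIV ?P])
    also have "\<dots> = (\<Sum>p\<in>?P. of_int (sign p) * of_real (A$l$(p 4) * A$m$(p 5) * A$n$(p 6)) *
        \<omega> $ (p 1, p 2, p 3))"
    proof (intro sum.cong refl)
      fix p :: "6 \<Rightarrow> 6"
      have "(\<Sum>a\<in>UNIV. \<Sum>b\<in>UNIV. \<Sum>c\<in>UNIV. of_real (of_int (sign p) *
          (d (p 1) a * d (p 2) b * d (p 3) c * A$l$(p 4) * A$m$(p 5) * A$n$(p 6))) * \<omega> $ (a, b, c))
        = (\<Sum>a\<in>UNIV. \<Sum>b\<in>UNIV. \<Sum>c\<in>UNIV. if p 1 = a \<and> p 2 = b \<and> p 3 = c then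
          of_int (sign p) * of_real (A$l$(p 4) * A$m$(p 5) * A$n$(p 6)) * \<omega> $ (a, b, c) else 0)"
        by (intro sum.cong refl) (auto simp: d_def)
      then show "(\<Sum>a\<in>UNIV. \<Sum>b\<in>UNIV. \<Sum>c\<in>UNIV. of_real (of_int (sign p) *
          (d (p 1) a * d (p 2) b * d (p 3) c * A$l$(p 4) * A$m$(p 5) * A$n$(p 6))) * \<omega> $ (a, b, c))
        = of_int (sign p) * of_real (A$l$(p 4) * A$m$(p 5) * A$n$(p 6)) * \<omega> $ (p 1, p 2, p 3)"
        unfolding delta .
    qed
    also have "\<dots> = (\<Sum>p\<in>?P. \<Sum>a\<in>UNIV. \<Sum>b\<in>UNIV. \<Sum>c\<in>UNIV. if p 4 = a \<and> p 5 = b \<and> p 6 = c then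
        of_real (A$l$a * A$m$b * A$n$c) * (of_int (sign p) * \<omega> $ (p 1, p 2, p 3)) else 0)"
      unfolding delta by (simp add: mult_ac)
    also have "\<dots> = (\<Sum>a\<in>UNIV. \<Sum>b\<in>UNIV. \<Sum>c\<in>UNIV. \<Sum>p\<in>?P. if p 4 = a \<and> p 5 = b \<and> p 6 = c then
        of_real (A$l$a * A$m$b * A$n$c) * (of_int (sign p) * \<omega> $ (p 1, p 2, p 3)) else 0)"
      by (simp only: sum.swap[of _ UNIV ?P])
    also have "\<dots> = (\<Sum>a\<in>UNIV. \<Sum>b\<in>UNIV. \<Sum>c\<in>UNIV. of_real (A$l$a * A$m$b * A$n$c) *
        (6 * hodge_star \<omega> $ (a, b, c)))"
      by (simp add: h6 sum_distrib_left if_distrib[of "\<lambda>x. _ * x"] cong: if_cong)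
    also have "\<dots> = 6 * Lambda3_act A (hodge_star \<omega>) $ (l, m, n)"
      by (simp add: Lambda3_act_def sum_distrib_left mult_ac)
    finally show ?thesis
      by simp
  qed
  then show ?thesis
    by (auto simp: vec_eq_iff)
qed

lemma Lambda3_swap:
  assumes "\<omega> \<in> Lambda3"
  shows "\<omega> $ (j, i, k) = - \<omega> $ (i, j, k)" "\<omega> $ (i, k, j) = - \<omega> $ (i, j, k)"
  using assms unfolding Lambda3_def by blast+

lemma subspace_Lambda3: "vec.subspace Lambda3"
proof (rule vec.subspaceI)
  show "0 \<in> Lambda3"
    by (simp add: Lambda3_def)
next
  fix v w assume vw: "v \<in> Lambda3" "w \<in> Lambda3"
  have "(v + w) $ (j, i, k) = - (v + w) $ (i, j, k)" "(v + w) $ (i, k, j) = - (v + w) $ (i, j, k)"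
    for i j k
    using Lambda3_swap[OF vw(1), of j i k] Lambda3_swap[OF vw(2), of j i k]
      Lambda3_swap[OF vw(1), of i k j] Lambda3_swap[OF vw(2), of i k j] by simp_all
  then show "v + w \<in> Lambda3"
    unfolding Lambda3_def by blast
next
  fix c v assume v: "v \<in> Lambda3"
  have "(c *s v) $ (j, i, k) = - (c *s v) $ (i, j, k)" "(c *s v) $ (i, k, j) = - (c *s v) $ (i, j, k)"
    for i j k
    using Lambda3_swap[OF v, of j i k] Lambda3_swap[OF v, of i k j] by simp_all
  then show "c *s v \<in> Lambda3"
    unfolding Lambda3_def by blast
qed

lemma Lambda3_act_in_Lambda3: "\<omega> \<in> Lambda3 \<Longrightarrow> Lambda3_act A \<omega> \<in> Lambda3"
proof -
  assume w: "\<omega> \<in> Lambda3"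
  have "Lambda3_act A \<omega> $ (j, i, k) = - Lambda3_act A \<omega> $ (i, j, k)" for i j k
  proof -
    have "Lambda3_act A \<omega> $ (j, i, k) = (\<Sum>b\<in>UNIV. \<Sum>a\<in>UNIV. \<Sum>c\<in>UNIV.
        of_real (A$j$a * A$i$b * A$k$c) * \<omega> $ (a, b, c))"
      unfolding Lambda3_act_def by (simp, subst sum.swap, simp)
    also have "\<dots> = (\<Sum>b\<in>UNIV. \<Sum>a\<in>UNIV. \<Sum>c\<in>UNIV.
        - (of_real (A$i$b * A$j$a * A$k$c) * \<omega> $ (b, a, c)))"
    proof (intro sum.cong refl)
      fix a b c
      have "\<omega> $ (a, b, c) = - \<omega> $ (b, a, c)"
        using Lambda3_swap[OF w] by blast
      then show "of_real (A$j$a * A$i$b * A$k$c) * \<omega> $ (a, b, c) =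
          - (of_real (A$i$b * A$j$a * A$k$c) * \<omega> $ (b, a, c))"
        by (simp add: mult_ac)
    qed
    finally show ?thesis
      by (simp add: Lambda3_act_def sum_negf)
  qed
  moreover have "Lambda3_act A \<omega> $ (i, k, j) = - Lambda3_act A \<omega> $ (i, j, k)" for i j k
  proof -
    have "Lambda3_act A \<omega> $ (i, k, j) = (\<Sum>a\<in>UNIV. \<Sum>c\<in>UNIV. \<Sum>b\<in>UNIV.
        of_real (A$i$a * A$k$b * A$j$c) * \<omega> $ (a, b, c))"
      unfolding Lambda3_act_def by (simp, rule sum.cong, simp, subst sum.swap, simp)
    also have "\<dots> = (\<Sum>a\<in>UNIV. \<Sum>c\<in>UNIV. \<Sum>b\<in>UNIV.
        - (of_real (A$i$a * A$j$c * A$k$b) * \<omega> $ (a, c, b)))"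
    proof (intro sum.cong refl)
      fix a b c
      have "\<omega> $ (a, b, c) = - \<omega> $ (a, c, b)"
        using Lambda3_swap[OF w] by blast
      then show "of_real (A$i$a * A$k$b * A$j$c) * \<omega> $ (a, b, c) =
          - (of_real (A$i$a * A$j$c * A$k$b) * \<omega> $ (a, c, b))"
        by (simp add: mult_ac)
    qed
    finally show ?thesis
      by (simp add: Lambda3_act_def sum_negf)
  qed
  ultimately show ?thesis
    unfolding Lambda3_def by blast
qed

lemma signature_character_imaginary:
  assumes "rotation_matrix A"
  shows "Re (signature_character A) = 0"
proof -
  have lin_hodge: "hodge_star (v + w) = hodge_star v + hodge_star w"
    "hodge_star (c *s v) = c *s hodge_star v" "hodge_star (cnj_vec v) = cnj_vec (hodge_star v)"
    "hodge_star 0 = 0" for v w c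
    by (simp_all add: hodge_star_def vec_eq_iff cnj_vec_simps split_paired_all distrib_left
        sum.distrib sum_distrib_left sum_divide_distrib add_divide_distrib mult.left_commute)
  have act_smult: "Lambda3_act A (c *s v) = c *s Lambda3_act A v" for c v
    by (auto simp: Lambda3_act_def vec_eq_iff algebra_simps sum_distrib_left)
  have act_cnj: "Lambda3_act A (cnj_vec v) = cnj_vec (Lambda3_act A v)" for v
    by (auto simp: Lambda3_act_def vec_eq_iff cnj_vec_simps)
  have cnjL: "cnj_vec v \<in> Lambda3" if "v \<in> Lambda3" for v
  proof -
    have "cnj_vec v $ (j, i, k) = - cnj_vec v $ (i, j, k)"
      "cnj_vec v $ (i, k, j) = - cnj_vec v $ (i, j, k)" for i j k
      using Lambda3_swap[OF that, of j i k] Lambda3_swap[OF that, of i k j]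
      by (simp_all add: cnj_vec_simps)
    then show ?thesis
      unfolding Lambda3_def by blast
  qed
  have eq: "cnj_vec ` Lambda3_plus = Lambda3_minus"
  proof -
    have "cnj_vec v \<in> Lambda3_minus" if "v \<in> Lambda3_plus" for v
      using that cnjL by (auto simp: Lambda3_plus_def Lambda3_minus_def lin_hodge cnj_vec_simps)
    moreover have "cnj_vec v \<in> Lambda3_plus" if "v \<in> Lambda3_minus" for v
      using that cnjL by (auto simp: Lambda3_plus_def Lambda3_minus_def lin_hodge cnj_vec_simps)
    ultimately show ?thesis
      by (metis cnj_vec_simps(2) image_eqI image_subsetI subsetI subset_antisym)
  qed
  have "vec.subspace Lambda3_plus"
    using subspace_Lambda3 unfolding vec.subspace_def Lambda3_plus_def
    by (simp add: lin_hodge vec.scale_right_distrib mult.commute)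
  moreover have "Lambda3_act A ` Lambda3_plus \<subseteq> Lambda3_plus"
    using assms Lambda3_act_in_Lambda3
    by (auto simp: Lambda3_plus_def hodge_star_Lambda3_act act_smult)
  ultimately have "trace_on Lambda3_minus (Lambda3_act A) =
      cnj (trace_on Lambda3_plus (Lambda3_act A))"
    unfolding eq[symmetric] using linear_Lambda3_act act_cnj by (intro trace_on_cnj_vec)
  then show ?thesis
    by (simp add: signature_character_def)
qed

text \<open>The character is purely imaginary, so its gradient is that of its imaginary part. On the
  maximal torus the Killing metric is a constant multiple of the Euclidean metric of the
  coordinates; the multiple does not affect the orbits. The character changes sign under
  \<open>A \<mapsto> - A\<close>, so again only the unparametrised orbits descend to \<open>PSO(6)\<close>.\<close>

definition character_gradient :: "real^3 \<Rightarrow> real^3" where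
  "character_gradient =
     gradient (\<lambda>\<psi>. Im (signature_character (matrix_exp (block_so6 \<psi>))))"

definition gradient_foliation :: "(real^6^6) set set set set" where
  "gradient_foliation = {torus_conj_class ` vf_orbit character_gradient \<psi>\<^sub>0 | \<psi>\<^sub>0. True}"

end

theory Submission
  imports Defs
begin

text \<open>Every class of \<open>\<M>\<close> contains a diagonal matrix and every conjugacy class of \<open>PSO(6)\<close> meets the
  maximal torus, so that both spaces are quotients of \<open>\<real>\<^sup>3\<close>: one diagonalises the commuting real and
  imaginary parts of a symmetric unitary matrix, respectively brings a rotation into block form,
  and compactness of the acting groups shows that the maps from \<open>\<real>\<^sup>3\<close> are quotient maps. The doubling
  map is then a homeomorphism as soon as the two quotient maps have the same fibres. Both are
  the orbits of \<open>2 \<Gamma>\<^sub>D\<close> and \<open>W\<close> in the coordinate \<open>\<theta> = 2 \<psi>\<close>; on the \<open>SO(6)\<close> side the orientation is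
  detected by the signature character, which is a multiple of the polarised Pfaffian
  \<open>\<Sum>\<^sub>p sgn(p) A\<^bsub>p1 p4\<^esub> A\<^bsub>p2 p5\<^esub> A\<^bsub>p3 p6\<^esub>\<close> and equals
  \<open>8 \<i> sin \<theta>\<^sub>1 sin \<theta>\<^sub>2 sin \<theta>\<^sub>3\<close> on the torus. By the addition theorem,
  \<open>Z\<close> in the coordinate \<open>\<theta>\<close> has the components \<open>2 cos \<theta>\<^sub>k sin \<theta>\<^sub>\<ell> sin \<theta>\<^sub>m\<close>, which is a
  constant multiple of the gradient of that function.\<close>

text \<open>The factor 2 comes from the centre of SO(6). The exponential of a doubled vector is plus
  or minus the identity exactly when the numbers 2 psi_k / pi are integers of one common parity, and
  this is the condition that psi_i + psi_j and psi_i - psi_j lie in pi Z; so Gamma_D is the kernel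
  of doubling followed by the map to the torus of PSO(6).

  The delicate point is that W contains only even numbers of sign changes, whereas the eigenvalues
  of a rotation see each angle only up to sign. An invariant that is odd in every angle is required,
  and the character whose gradient flow is studied happens to be one.

  The quotient of the torus by W is never constructed. Both fibre relations are compared with the
  inductively generated relation \<open>torus_equiv\<close>: that it preserves a class is checked on
  generators, and the two converse statements both extract a permutation of diagonal entries from a
  matrix that intertwines two diagonal matrices.\<close>

lemma exhaust_6: "x = 1 \<or> x = 2 \<or> x = 3 \<or> x = 4 \<or> x = 5 \<or> x = 6" for x :: 6
proof (induct x)
  case (of_int z)
  then have "z = 0 \<or> z = 1 \<or> z = 2 \<or> z = 3 \<or> z = 4 \<or> z = 5"
    by fastforce
  then show ?case
    by auto
qed

lemma UNIV_6: "UNIV = {1, 2, 3, 4, 5, 6 :: 6}"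
  using exhaust_6 by auto

lemma forall_6: "(\<forall>i::6. P i) \<longleftrightarrow> P 1 \<and> P 2 \<and> P 3 \<and> P 4 \<and> P 5 \<and> P 6"
  by (metis exhaust_6)

lemma sum_6: "sum f (UNIV :: 6 set) = f 1 + f 2 + f 3 + f 4 + f 5 + f 6"
  unfolding UNIV_6 by (simp add: ac_simps)

section \<open>Orbits of vector fields\<close>

lemma has_vector_derivative_linear_image:
  fixes L :: "'a::euclidean_space \<Rightarrow> 'b::euclidean_space"
  assumes L: "linear L" and d: "(f has_vector_derivative v) (at (t::real))"
  shows "((\<lambda>t. L (f t)) has_vector_derivative L v) (at t)"
  using d L by (simp add: bounded_linear.has_vector_derivative linear_conv_bounded_linear)

lemma vf_orbit_linear_image_subset:
  fixes L :: "'a::euclidean_space \<Rightarrow> 'b::euclidean_space"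
  assumes L: "linear L" and LX: "\<And>x. L (X x) = Y (L x)"
  shows "L ` vf_orbit X x \<subseteq> vf_orbit Y (L x)"
proof
  fix z assume "z \<in> L ` vf_orbit X x"
  then obtain \<gamma> T t where T: "open T" "is_interval T" "(0::real) \<in> T" "t \<in> T" "\<gamma> 0 = x"
    "\<forall>s\<in>T. (\<gamma> has_vector_derivative X (\<gamma> s)) (at s)" and z: "z = L (\<gamma> t)"
    unfolding vf_orbit_def by blast
  have "\<forall>s\<in>T. ((\<lambda>t. L (\<gamma> t)) has_vector_derivative Y (L (\<gamma> s))) (at s)"
    using T(6) has_vector_derivative_linear_image[OF L] by (metis LX)
  then show "z \<in> vf_orbit Y (L x)"
    unfolding vf_orbit_def using T z
    by (intro CollectI exI[of _ "\<lambda>t. L (\<gamma> t)"] exI[of _ T] exI[of _ t]) auto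
qed

lemma vf_orbit_linear_image:
  fixes L :: "'a::euclidean_space \<Rightarrow> 'b::euclidean_space"
  assumes L: "linear L" and M: "linear M" and LM: "\<And>x. M (L x) = x" "\<And>y. L (M y) = y"
    and LX: "\<And>x. L (X x) = Y (L x)"
  shows "L ` vf_orbit X x = vf_orbit Y (L x)"
proof
  show "L ` vf_orbit X x \<subseteq> vf_orbit Y (L x)"
    using L LX by (rule vf_orbit_linear_image_subset)
  have "M (Y y) = X (M y)" for y
    using LX[of "M y"] LM by metis
  then have "M ` vf_orbit Y (L x) \<subseteq> vf_orbit X (M (L x))"
    by (rule vf_orbit_linear_image_subset[OF M])
  then show "vf_orbit Y (L x) \<subseteq> L ` vf_orbit X x"
    using LM by (metis image_eqI image_subset_iff subsetI)
qed

text \<open>Negative \<open>c\<close> is allowed, since \<open>vf_orbit\<close> follows integral curves in both time directions.\<close>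

lemma vf_orbit_scale_subset:
  assumes "c \<noteq> 0"
  shows "vf_orbit X x \<subseteq> vf_orbit (\<lambda>y. c *\<^sub>R X y) x"
proof
  fix z assume "z \<in> vf_orbit X x"
  then obtain \<gamma> T t where T: "open T" "is_interval T" "(0::real) \<in> T" "t \<in> T" "\<gamma> 0 = x"
    "\<forall>s\<in>T. (\<gamma> has_vector_derivative X (\<gamma> s)) (at s)" and z: "z = \<gamma> t"
    unfolding vf_orbit_def by blast
  let ?T = "(\<lambda>s. c * s) -` T"
  have "open ?T"
    by (intro open_vimage T continuous_intros)
  moreover have "is_interval ?T"
  proof -
    have "?T = (\<lambda>s. inverse c *\<^sub>R s) ` T"
      using assms by (auto simp: image_iff field_simps intro!: bexI[of _ "c * _"])
    then show ?thesis
      using T(2) by (metis convex_scaling is_interval_convex_1)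
  qed
  moreover have "0 \<in> ?T" "t / c \<in> ?T"
    using T assms by auto
  moreover have "((\<lambda>s. \<gamma> (c * s)) has_vector_derivative c *\<^sub>R X (\<gamma> (c * s))) (at s)" if "s \<in> ?T" for s
  proof -
    have "((\<lambda>s. c * s) has_vector_derivative c) (at s)"
      by (auto intro!: derivative_eq_intros)
    moreover have "(\<gamma> has_vector_derivative X (\<gamma> (c * s))) (at (c * s))"
      using T(6) that by auto
    ultimately show ?thesis
      using vector_diff_chain_at[of "\<lambda>s. c * s" c s \<gamma> "X (\<gamma> (c * s))"] by (simp add: o_def)
  qed
  ultimately show "z \<in> vf_orbit (\<lambda>y. c *\<^sub>R X y) x"
    unfolding vf_orbit_def using T z assms
    by (intro CollectI exI[of _ "\<lambda>s. \<gamma> (c * s)"] exI[of _ ?T] exI[of _ "t / c"]) auto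
qed

lemma vf_orbit_scale:
  assumes "c \<noteq> 0"
  shows "vf_orbit (\<lambda>y. c *\<^sub>R X y) x = vf_orbit X x"
  using vf_orbit_scale_subset[of c X x] vf_orbit_scale_subset[of "1 / c" "\<lambda>y. c *\<^sub>R X y" x] assms
  by auto

section \<open>The maximal torus\<close>

text \<open>Each diagonal block is \<open>a $ k\<close> times the identity plus \<open>b $ k\<close>
  times a square root of minus the identity, so these matrices multiply like triples of complex
  numbers. The family contains the Lie algebra elements (\<open>a = 0\<close>), the terms of their
  exponential series and the torus itself.\<close>

definition block6 :: "real^3 \<Rightarrow> real^3 \<Rightarrow> real^6^6" where
  "block6 a b = (\<chi> i j.
     if i = j then (if i = 1 \<or> i = 2 then a $ 1 else if i = 3 \<or> i = 4 then a $ 2 else a $ 3)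
     else if i = 1 \<and> j = 2 then b $ 1 else if i = 2 \<and> j = 1 then - b $ 1
     else if i = 3 \<and> j = 4 then b $ 2 else if i = 4 \<and> j = 3 then - b $ 2
     else if i = 5 \<and> j = 6 then b $ 3 else if i = 6 \<and> j = 5 then - b $ 3
     else 0)"

definition rot6 :: "real^3 \<Rightarrow> real^6^6" where
  "rot6 \<theta> = block6 (\<chi> k. cos (\<theta> $ k)) (\<chi> k. sin (\<theta> $ k))"

lemma block6_mult:
  "block6 a b ** block6 c d
      = block6 (\<chi> k. a $ k * c $ k - b $ k * d $ k) (\<chi> k. a $ k * d $ k + b $ k * c $ k)"
  unfolding vec_eq_iff forall_6 by (simp add: matrix_matrix_mult_def sum_6 block6_def)

lemma block6_one: "block6 1 0 = mat 1"
  unfolding vec_eq_iff forall_6 by (simp add: block6_def mat_def)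

lemma transpose_block6: "transpose (block6 a b) = block6 a (- b)"
  unfolding vec_eq_iff forall_6 by (simp add: block6_def transpose_def)

lemma block6_uminus: "block6 (- a) (- b) = - block6 a b"
  unfolding vec_eq_iff forall_6 by (simp add: block6_def)

lemma block_so6_eq: "block_so6 \<psi> = block6 0 \<psi>"
  unfolding vec_eq_iff forall_6 by (simp add: block6_def block_so6_def)

lemma scaleR_block6: "c *\<^sub>R block6 a b = block6 (c *\<^sub>R a) (c *\<^sub>R b)"
  unfolding vec_eq_iff forall_6 by (simp add: block6_def)

text \<open>\<open>cos_coeff\<close> vanishes at odd and \<open>sin_coeff\<close> at even indices,
  so one formula covers both parities, and the induction step is just the mutual recursion of the
  two coefficient sequences.\<close>

lemma block6_power:
  "(1 / fact n) *\<^sub>R ((**) (block6 0 \<psi>) ^^ n) (mat 1) =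
     block6 (\<chi> k. cos_coeff n * \<psi> $ k ^ n) (\<chi> k. sin_coeff n * \<psi> $ k ^ n)"
proof (induction n)
  case 0
  have "block6 (\<chi> k. 1) (\<chi> k. 0) = mat 1"
    unfolding vec_eq_iff forall_6 by (simp add: block6_def mat_def)
  then show ?case
    by simp
next
  case (Suc n)
  have "(1 / fact (Suc n)) *\<^sub>R ((**) (block6 0 \<psi>) ^^ Suc n) (mat 1)
     = (1 / real (Suc n)) *\<^sub>R (block6 0 \<psi> ** ((1 / fact n) *\<^sub>R ((**) (block6 0 \<psi>) ^^ n) (mat 1)))"
    by (simp add: vec_eq_iff matrix_matrix_mult_def sum_distrib_left field_simps)
  also have "\<dots> = block6 (\<chi> k. cos_coeff (Suc n) * \<psi> $ k ^ Suc n) (\<chi> k. sin_coeff (Suc n)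
      * \<psi> $ k ^ Suc n)"
    unfolding Suc block6_mult scaleR_block6
    by (rule arg_cong2[of _ _ _ _ block6])
      (simp_all add: vec_eq_iff sin_coeff_Suc cos_coeff_Suc)
  finally show ?case .
qed

lemma sums_vec:
  fixes f :: "nat \<Rightarrow> 'a::real_normed_vector^'n"
  assumes "\<And>i. (\<lambda>n. f n $ i) sums (s $ i)"
  shows "f sums s"
  using assms unfolding sums_def by (intro vec_tendstoI) simp

lemma matrix_exp_block_so6: "matrix_exp (block_so6 \<psi>) = rot6 \<psi>"
proof -
  let ?f = "\<lambda>n. block6 (\<chi> k. cos_coeff n * \<psi> $ k ^ n) (\<chi> k. sin_coeff n * \<psi> $ k ^ n)"
  have c: "(\<lambda>n. cos_coeff n * x ^ n) sums cos x" and s: "(\<lambda>n. sin_coeff n * x ^ n) sums sin x"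
    for x :: real
    using cos_converges[of x] sin_converges[of x] by simp_all
  have "?f sums rot6 \<psi>"
    by (intro sums_vec) (auto simp: block6_def rot6_def intro!: c s sums_minus)
  then show ?thesis
    unfolding matrix_exp_def block_so6_eq block6_power by (rule sums_unique[symmetric])
qed

lemma rot6_add: "rot6 (\<theta> + \<eta>) = rot6 \<theta> ** rot6 \<eta>"
  unfolding rot6_def block6_mult
  by (rule arg_cong2[of _ _ _ _ block6]) (simp_all add: vec_eq_iff cos_add sin_add algebra_simps)

lemma rot6_antipode: "rot6 (\<chi> k. \<theta> $ k + pi) = - rot6 \<theta>"
  by (simp add: rot6_def flip: block6_uminus) (simp add: uminus_vec_def)

lemma rot6_0: "rot6 0 = mat 1"
  unfolding block6_one[symmetric] rot6_def
  by (rule arg_cong2[of _ _ _ _ block6]) (simp_all add: vec_eq_iff)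

lemma transpose_rot6: "transpose (rot6 \<theta>) = rot6 (- \<theta>)"
  unfolding transpose_block6 rot6_def
  by (rule arg_cong2[of _ _ _ _ block6]) (simp_all add: vec_eq_iff)

lemma orthogonal_matrix_rot6: "orthogonal_matrix (rot6 \<theta>)"
  unfolding orthogonal_matrix transpose_rot6 rot6_add[symmetric] by (simp add: rot6_0)

text \<open>A torus element is the square of the one with half the angles, and an orthogonal matrix
  has determinant 1 or -1.\<close>

lemma det_rot6: "det (rot6 \<theta>) = 1"
proof -
  have "rot6 \<theta> = rot6 ((1 / 2) *\<^sub>R \<theta>) ** rot6 ((1 / 2) *\<^sub>R \<theta>)"
    unfolding rot6_add[symmetric] by (simp flip: scaleR_left.add)
  then have "det (rot6 \<theta>) = det (rot6 ((1 / 2) *\<^sub>R \<theta>)) * det (rot6 ((1 / 2) *\<^sub>R \<theta>))"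
    by (simp add: det_mul)
  then show ?thesis
    using det_orthogonal_matrix[OF orthogonal_matrix_rot6, of "(1 / 2) *\<^sub>R \<theta>"] by auto
qed

lemma rotation_matrix_rot6: "rotation_matrix (rot6 \<theta>)"
  by (simp add: rotation_matrix_def orthogonal_matrix_rot6 det_rot6)

section \<open>The signature character\<close>

text \<open>A permutation is determined by the image \<open>u\<close> of \<open>a\<close>, by the
  image of \<open>b\<close>, which is \<open>v\<close> up to the transposition of \<open>a\<close>
  and \<open>u\<close>, and by a permutation of the rest. The factor \<open>K\<close> depends only
  on \<open>u\<close> and \<open>v\<close>; for a sparse \<open>K\<close> most inner sums are
  multiplied by zero.\<close>

lemma sum_permutes_peel2:
  fixes K :: "'a \<Rightarrow> 'a \<Rightarrow> real"
  assumes S: "finite S" "a \<notin> S" "b \<notin> S" "a \<noteq> b"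
  shows "(\<Sum>p | p permutes insert a (insert b S). K (p a) (p b) * Y p) =
    (\<Sum>u\<in>insert a (insert b S). \<Sum>v\<in>insert b S. K u (Transposition.transpose a u v) *
       (\<Sum>q | q permutes S. Y (Transposition.transpose a u \<circ> (Transposition.transpose b v \<circ> q))))"
proof -
  have "(\<Sum>p | p permutes insert a (insert b S). K (p a) (p b) * Y p) =
    (\<Sum>u\<in>insert a (insert b S). \<Sum>v\<in>insert b S. \<Sum>q | q permutes S.
      K ((Transposition.transpose a u \<circ> (Transposition.transpose b v \<circ> q)) a)
        ((Transposition.transpose a u \<circ> (Transposition.transpose b v \<circ> q)) b) *
       Y (Transposition.transpose a u \<circ> (Transposition.transpose b v \<circ> q)))"
    using S by (subst sum_over_permutations_insert, simp, simp)+ simp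
  also have "\<dots> = (\<Sum>u\<in>insert a (insert b S). \<Sum>v\<in>insert b S. \<Sum>q | q permutes S.
      K u (Transposition.transpose a u v) *
       Y (Transposition.transpose a u \<circ> (Transposition.transpose b v \<circ> q)))"
  proof (intro sum.cong refl)
    fix u v q assume v: "v \<in> insert b S" and "q \<in> {q. q permutes S}"
    then have "q a = a" "q b = b"
      using S by (auto simp: permutes_def)
    moreover have "Transposition.transpose b v a = a"
      using v S by (auto simp: Transposition.transpose_def)
    ultimately show "K ((Transposition.transpose a u \<circ> (Transposition.transpose b v \<circ> q)) a)
        ((Transposition.transpose a u \<circ> (Transposition.transpose b v \<circ> q)) b) *
       Y (Transposition.transpose a u \<circ> (Transposition.transpose b v \<circ> q)) =
      K u (Transposition.transpose a u v) *
       Y (Transposition.transpose a u \<circ> (Transposition.transpose b v \<circ> q))"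
      by simp
  qed
  finally show ?thesis
    by (simp add: sum_distrib_left)
qed

text \<open>The right-hand side is, up to the factor \<open>\<plusminus> 8\<close>, the Pfaffian of the submatrix of \<open>M\<close> with
  indices \<open>t 2, t 5, t 3, t 6\<close>. Expanding the permutations of \<open>{2, 5, 3, 6}\<close> separately from the
  images of \<open>1\<close> and \<open>4\<close> avoids a sum over all 720 permutations.\<close>

lemma sum_permutes_pfaffian4:
  fixes M :: "real^6^6"
  assumes t: "permutation (t :: 6 \<Rightarrow> 6)" and M: "\<And>i j. M $ j $ i = - M $ i $ j"
  shows "(\<Sum>q | q permutes {2, 5, 3, 6}. of_int (sign (t \<circ> q)) *
      (M $ t (q 2) $ t (q 5) * M $ t (q 3) $ t (q 6))) =
    8 * of_int (sign t) * (M $ t 2 $ t 5 * M $ t 3 $ t 6 - M $ t 2 $ t 3 * M $ t 5 $ t 6 + M $ t 2 $ t 6 * M $ t 5 $ t 3)"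
proof -
  have 1: "(\<Sum>q | q permutes {2, 5, 3, 6}. of_int (sign (t \<circ> q)) *
      (M $ t (q 2) $ t (q 5) * M $ t (q 3) $ t (q 6))) =
     of_int (sign t) * (\<Sum>q | q permutes {2, 5, 3, 6}. of_int (sign q) *
      (M $ t (q 2) $ t (q 5) * M $ t (q 3) $ t (q 6)))"
    unfolding sum_distrib_left
  proof (intro sum.cong refl)
    fix q :: "6 \<Rightarrow> 6" assume "q \<in> {q. q permutes {2, 5, 3, 6}}"
    then have "permutation q"
      by (auto simp: permutation_permutes intro!: exI[of _ "{2, 5, 3, 6}"])
    then show "of_int (sign (t \<circ> q)) * (M $ t (q 2) $ t (q 5) * M $ t (q 3) $ t (q 6)) =
       real_of_int (sign t) * (of_int (sign q) * (M $ t (q 2) $ t (q 5) * M $ t (q 3) $ t (q 6)))"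
      using t by (simp add: sign_compose)
  qed
  have M0: "M $ i $ i = 0" for i
    using M[of i i] by simp
  \<comment> \<open>The 24 permutations realise the three pairings of four indices, 8 times each.
    Flipping a pair changes both the sign of \<open>q\<close> and that of an entry of
    \<open>M\<close>, and exchanging the two pairs is an even permutation, so the 8 terms
    agree.\<close>
  have "(\<Sum>q | q permutes {2, 5, 3, 6}. of_int (sign q) *
      (M $ t (q 2) $ t (q 5) * M $ t (q 3) $ t (q 6))) =
    8 * (M $ t 2 $ t 5 * M $ t 3 $ t 6 - M $ t 2 $ t 3 * M $ t 5 $ t 6 + M $ t 2 $ t 6 * M $ t 5 $ t 3)"
    by ((subst sum_over_permutations_insert, simp, simp)+,
      simp add: sign_compose permutation_compose permutation_swap_id sign_swap_id sign_id,
      simp add: M[of "t 5" "t 2"] M[of "t 6" "t 3"] M[of "t 3" "t 2"] M[of "t 6" "t 5"]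
        M[of "t 6" "t 2"] M[of "t 3" "t 5"])
  then show ?thesis
    unfolding 1 by simp
qed

text \<open>A nonzero term must pair the indices as the blocks do, {1,2}, {3,4}, {5,6}, which
  happens for 3! * 2^3 = 48 permutations with equal contributions. One of them sends 1, 4, 2, 5, 3,
  6 to 1, 2, 3, 4, 5, 6; it is a 4-cycle, whence the minus sign. Diagonal entries never occur, so
  \<open>a\<close> may be replaced by 0 to make the matrix antisymmetric.\<close>

lemma sum_permutes_block6:
  "(\<Sum>p | p permutes (UNIV :: 6 set). of_int (sign p) *
      (block6 a b $ p 1 $ p 4 * block6 a b $ p 2 $ p 5 * block6 a b $ p 3 $ p 6)) = - 48 * b $ 1 * b $ 2 * b $ 3"
  (is "sum ?f _ = _")
proof -
  define M where "M = block6 0 b"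
  have M: "M $ j $ i = - M $ i $ j" for i j
    using exhaust_6[of i] exhaust_6[of j] by (elim disjE) (simp_all add: M_def block6_def)
  have U: "(UNIV :: 6 set) = insert 1 (insert 4 {2, 5, 3, 6})"
    using exhaust_6 by auto
  have "(\<Sum>p | p permutes (UNIV :: 6 set). ?f p) = (\<Sum>p | p permutes (UNIV :: 6 set).
       M $ p 1 $ p 4 * (of_int (sign p) * (M $ p 2 $ p 5 * M $ p 3 $ p 6)))"
  proof (intro sum.cong refl)
    fix p :: "6 \<Rightarrow> 6" assume "p \<in> {p. p permutes UNIV}"
    then have "inj p"
      by (auto simp: permutes_inj)
    then have "p 1 \<noteq> p 4" "p 2 \<noteq> p 5" "p 3 \<noteq> p 6"
      by (simp_all add: inj_eq)
    then show "?f p = M $ p 1 $ p 4 * (of_int (sign p) * (M $ p 2 $ p 5 * M $ p 3 $ p 6))"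
      by (simp add: M_def block6_def)
  qed
  also have "\<dots> = (\<Sum>u\<in>insert 1 (insert 4 {2, 5, 3, 6}). \<Sum>v\<in>insert 4 {2, 5, 3, 6}.
      M $ u $ (Transposition.transpose 1 u v) * (\<Sum>q | q permutes {2, 5, 3, 6}.
        of_int (sign ((Transposition.transpose 1 u \<circ> Transposition.transpose 4 v) \<circ> q)) *
        (M $ (Transposition.transpose 1 u \<circ> Transposition.transpose 4 v) (q 2) $ (Transposition.transpose 1 u \<circ> Transposition.transpose 4 v) (q 5) *
         M $ (Transposition.transpose 1 u \<circ> Transposition.transpose 4 v) (q 3) $ (Transposition.transpose 1 u \<circ> Transposition.transpose 4 v) (q 6))))"
    unfolding U by (subst sum_permutes_peel2[where K = "\<lambda>u v. M $ u $ v"]) (simp_all add: o_assoc)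
  also have "\<dots> = - 48 * b $ 1 * b $ 2 * b $ 3"
    by (subst sum_permutes_pfaffian4, simp add: permutation_compose permutation_swap_id, rule M,
      simp add: sign_compose permutation_swap_id sign_swap_id Transposition.transpose_def,
      simp add: M_def block6_def)
  finally show ?thesis .
qed

section \<open>Traces on eigenspaces of the Hodge star\<close>

lemma representation_cart_basis:
  fixes x :: "'a::field^'n"
  shows "vec.representation cart_basis x (axis i 1) = x $ i"
proof -
  define r where "r = (\<lambda>b::'a^'n. if b \<in> cart_basis then x $ (THE i. b = axis i 1) else 0)"
  have r: "r (axis j 1) = x $ j" for j
    unfolding r_def by (auto simp: cart_basis_def axis_eq_axis)
  have inj: "inj (\<lambda>i. axis i 1 :: 'a^'n)"
    by (auto simp: inj_def axis_eq_axis)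
  have im: "cart_basis = range (\<lambda>i. axis i 1 :: 'a^'n)"
    by (auto simp: cart_basis_def)
  have eq: "(\<Sum>b\<in>cart_basis. r b *s b) = x"
    unfolding im by (subst sum.reindex[OF inj]) (simp add: r basis_expansion)
  have "vec.representation cart_basis x = r"
  proof (rule vec.representation_eqI[OF independent_cart_basis])
    show "x \<in> vec.span cart_basis"
      by (simp add: span_cart_basis)
    show "finite {b. r b \<noteq> 0}"
      by (rule finite_subset[OF _ finite_cart_basis]) (auto simp: r_def)
    show "(\<Sum>b | r b \<noteq> 0. r b *s b) = x"
      unfolding eq[symmetric] by (rule sum.mono_neutral_left) (auto simp: r_def finite_cart_basis)
  qed (auto simp: r_def split: if_splits)
  then show ?thesis
    by (simp add: r)
qed

text \<open>Extend a basis of \<open>V\<close> to the whole space. Since \<open>f \<circ> P\<close>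
  takes values in \<open>V\<close>, the added basis vectors contribute nothing to its trace, and on
  \<open>V\<close> it agrees with \<open>f\<close>. This computes the trace on an eigenspace in
  standard coordinates, without a basis of the eigenspace.\<close>

lemma trace_on_projection:
  fixes f P :: "'a::field^'n \<Rightarrow> 'a^'n"
  assumes f: "Vector_Spaces.linear (*s) (*s) f" and P: "Vector_Spaces.linear (*s) (*s) P"
    and PV: "range P \<subseteq> V" and Pid: "\<And>v. v \<in> V \<Longrightarrow> P v = v" and fV: "f ` V \<subseteq> V"
  shows "trace_on V f = (\<Sum>i\<in>UNIV. f (P (axis i 1)) $ i)"
proof -
  interpret P: Vector_Spaces.linear "(*s)" "(*s)" P by (rule P)
  have V: "V = range P"
    using PV Pid by (auto simp: image_iff) (metis)
  then have "vec.subspace V"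
    using vec.subspace_UNIV P.subspace_image by blast
  then obtain B where B: "vec.independent B" "vec.span B = V"
    using vec.basis_exists[of V] by (metis vec.span_subspace)
  define C where "C = vec.extend_basis B"
  have C: "vec.independent C" "vec.span C = UNIV" "B \<subseteq> C"
    using B by (simp_all add: C_def vec.independent_extend_basis vec.span_extend_basis vec.extend_basis_superset)
  have fin: "finite C"
    using C by (auto intro: vec.finiteI_independent)
  have fP: "Vector_Spaces.linear (*s) (*s) (f \<circ> P)"
    by (rule Vector_Spaces.linear_compose[OF P f])
  have rep: "vec.representation C (f (P v)) = vec.representation B (f (P v))" for v
  proof (rule vec.representation_extend)
    show "f (P v) \<in> vec.span B"
      unfolding B using PV fV by blast
  qed (use C in auto)
  have "(\<Sum>i\<in>UNIV. f (P (axis i 1)) $ i) =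
      (\<Sum>b\<in>cart_basis. vec.representation cart_basis ((f \<circ> P) b) b)"
  proof -
    have inj: "inj (\<lambda>i. axis i 1 :: 'a^'n)"
      by (auto simp: inj_def axis_eq_axis)
    have im: "cart_basis = range (\<lambda>i. axis i 1 :: 'a^'n)"
      by (auto simp: cart_basis_def)
    have "(\<Sum>b\<in>range (\<lambda>i. axis i 1 :: 'a^'n). vec.representation cart_basis ((f \<circ> P) b) b) =
        (\<Sum>i\<in>UNIV. f (P (axis i 1)) $ i)"
      by (subst sum.reindex[OF inj]) (simp add: representation_cart_basis)
    then show ?thesis
      unfolding im by simp
  qed
  also have "\<dots> = trace_on UNIV (f \<circ> P)"
    by (rule trace_on_basis[symmetric, OF independent_cart_basis span_cart_basis fP]) simp
  also have "\<dots> = (\<Sum>c\<in>C. vec.representation C ((f \<circ> P) c) c)"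
    by (rule trace_on_basis[OF C(1,2) fP]) simp
  also have "\<dots> = (\<Sum>c\<in>C. vec.representation B (f (P c)) c)"
    by (simp add: rep)
  also have "\<dots> = (\<Sum>c\<in>B. vec.representation B (f (P c)) c)"
    using C fin by (intro sum.mono_neutral_right) (auto dest: vec.representation_ne_zero)
  also have "\<dots> = (\<Sum>c\<in>B. vec.representation B (f c) c)"
    using B Pid vec.span_superset[of B] by (intro sum.cong refl) (auto simp: subset_iff)
  also have "\<dots> = trace_on V f"
    using B f fV by (intro trace_on_basis[symmetric]) auto
  finally show ?thesis ..
qed

lemma hodge_star_linear: "Vector_Spaces.linear (*s) (*s) hodge_star"
  by unfold_locales
    (simp_all add: hodge_star_def vec_eq_iff split_paired_all sum.distrib
      sum_distrib_left sum_divide_distrib add_divide_distrib algebra_simps)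

lemma hodge_star_in_Lambda3: "hodge_star \<omega> \<in> Lambda3"
proof -
  have swap: "(\<Sum>p | p permutes UNIV \<and> p 4 = l' \<and> p 5 = m' \<and> p 6 = n'.
      of_int (sign p) * \<omega> $ (p 1, p 2, p 3)) =
    - (\<Sum>p | p permutes UNIV \<and> p 4 = l \<and> p 5 = m \<and> p 6 = n.
      of_int (sign p) * \<omega> $ (p 1, p 2, p 3))"
    if \<tau>: "\<tau> = Transposition.transpose a b" "a \<noteq> b" "\<tau> 1 = 1" "\<tau> 2 = 2" "\<tau> 3 = 3"
      and e: "\<And>p. ((p \<circ> \<tau>) 4 = l' \<and> (p \<circ> \<tau>) 5 = m' \<and> (p \<circ> \<tau>) 6 = n') = (p 4 = l \<and> p 5 = m \<and> p 6 = n)"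
    for \<tau> :: "6 \<Rightarrow> 6" and a b and l m n l' m' n' :: 6
  proof -
    have tt: "\<tau> \<circ> \<tau> = id"
      by (simp add: \<tau>)
    have pt: "\<tau> permutes UNIV"
      unfolding \<tau> by (rule permutes_swap_id) auto
    show ?thesis
      unfolding sum_negf[symmetric]
    proof (rule sum.reindex_bij_witness[where i = "\<lambda>p :: 6 \<Rightarrow> 6. p \<circ> \<tau>" and j = "\<lambda>p :: 6 \<Rightarrow> 6. p \<circ> \<tau>"])
      fix p assume p: "p \<in> {p. p permutes UNIV \<and> p 4 = l' \<and> p 5 = m' \<and> p 6 = n'}"
      show "p \<circ> \<tau> \<circ> \<tau> = p"
        by (simp add: comp_assoc tt)
      show "p \<circ> \<tau> \<in> {p. p permutes UNIV \<and> p 4 = l \<and> p 5 = m \<and> p 6 = n}"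
        using p e[of "p \<circ> \<tau>"] pt by (auto simp: comp_assoc tt permutes_compose)
      have "permutation p"
        using p by (auto simp: permutation_permutes)
      then have "sign (p \<circ> \<tau>) = - sign p"
        using \<tau>(1,2) by (simp add: sign_compose permutation_swap_id sign_swap_id)
      then show "- (of_int (sign (p \<circ> \<tau>)) * \<omega> $ ((p \<circ> \<tau>) 1, (p \<circ> \<tau>) 2, (p \<circ> \<tau>) 3)) =
          of_int (sign p) * \<omega> $ (p 1, p 2, p 3)"
        using \<tau>(3-5) by simp
    next
      fix p assume p: "p \<in> {p. p permutes UNIV \<and> p 4 = l \<and> p 5 = m \<and> p 6 = n}"
      show "p \<circ> \<tau> \<circ> \<tau> = p"
        by (simp add: comp_assoc tt)
      show "p \<circ> \<tau> \<in> {p. p permutes UNIV \<and> p 4 = l' \<and> p 5 = m' \<and> p 6 = n'}"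
        using p e[of p] pt by (auto simp: permutes_compose)
    qed
  qed
  have "hodge_star \<omega> $ (j, i, k) = - hodge_star \<omega> $ (i, j, k)" for i j k
    unfolding hodge_star_def
    by (simp, subst swap[of "Transposition.transpose 4 5" 4 5 j i k i j k])
      (auto simp: Transposition.transpose_def)
  moreover have "hodge_star \<omega> $ (i, k, j) = - hodge_star \<omega> $ (i, j, k)" for i j k
    unfolding hodge_star_def
    by (simp, subst swap[of "Transposition.transpose 5 6" 5 6 i k j i j k])
      (auto simp: Transposition.transpose_def)
  ultimately show ?thesis
    unfolding Lambda3_def by blast
qed

text \<open>\<open>f\<close> is general because the induction splits a transposition off the left of
  \<open>r\<close> and absorbs it into \<open>f\<close>.\<close>

lemma Lambda3_permute:
  assumes "\<omega> \<in> Lambda3" "r permutes {1, 2, 3 :: 6}"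
  shows "\<omega> $ (f (r 1), f (r 2), f (r 3)) = of_int (sign r) * \<omega> $ (f 1, f 2, f 3)"
  using assms(2) finite[of "{1, 2, 3}"]
proof (induction r arbitrary: f rule: permutes_induct)
  case (swap a b r)
  have "permutation r"
    using swap by (auto simp: permutation_permutes intro!: exI[of _ "{1, 2, 3}"])
  then have s: "sign (Transposition.transpose a b \<circ> r) = - sign r"
    using swap by (simp add: sign_compose permutation_swap_id sign_swap_id)
  have sw: "\<omega> $ (f 2, f 1, f 3) = - \<omega> $ (f 1, f 2, f 3)" "\<omega> $ (f 1, f 3, f 2) = - \<omega> $ (f 1, f 2, f 3)"
    "\<omega> $ (f 3, f 2, f 1) = - \<omega> $ (f 1, f 2, f 3)"
    using Lambda3_swap[OF assms(1)] by (metis minus_equation_iff)+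
  have "\<omega> $ ((f \<circ> Transposition.transpose a b) 1, (f \<circ> Transposition.transpose a b) 2,
      (f \<circ> Transposition.transpose a b) 3) = - \<omega> $ (f 1, f 2, f 3)"
    using swap(1-3) by (auto simp: Transposition.transpose_def sw)
  with swap.IH[of "f \<circ> Transposition.transpose a b"] show ?case
    unfolding s by simp
qed (simp_all add: sign_id)

lemma bij_betw_permutes_coset:
  assumes p: "p permutes (UNIV :: 6 set)"
  shows "bij_betw (\<lambda>r. p \<circ> r) {r. r permutes {1, 2, 3}}
    {q. q permutes UNIV \<and> q 4 = p 4 \<and> q 5 = p 5 \<and> q 6 = p 6}"
proof (rule bij_betwI[where g = "\<lambda>q. inv_into UNIV p \<circ> q"])
  have ip: "inv_into UNIV p \<circ> p = id" "p \<circ> inv_into UNIV p = id"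
    using p by (simp_all add: permutes_inv_o)
  show "(\<lambda>r. p \<circ> r) \<in> {r. r permutes {1, 2, 3}} \<rightarrow>
      {q. q permutes UNIV \<and> q 4 = p 4 \<and> q 5 = p 5 \<and> q 6 = p 6}"
    using p by (auto intro: permutes_compose permutes_subset simp: permutes_not_in)
  show "(\<lambda>q. inv_into UNIV p \<circ> q) \<in> {q. q permutes UNIV \<and> q 4 = p 4 \<and> q 5 = p 5 \<and> q 6 = p 6} \<rightarrow>
      {r. r permutes {1, 2, 3}}"
  proof
    fix q assume q: "q \<in> {q. q permutes UNIV \<and> q 4 = p 4 \<and> q 5 = p 5 \<and> q 6 = p 6}"
    then have "(inv_into UNIV p \<circ> q) permutes UNIV"
      using p by (auto intro: permutes_compose permutes_inv)
    moreover have "(inv_into UNIV p \<circ> q) x = x" if "x \<notin> {1, 2, 3}" for x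
      using that exhaust_6[of x] q ip by (auto simp: o_def fun_eq_iff)
    ultimately show "inv_into UNIV p \<circ> q \<in> {r. r permutes {1, 2, 3}}"
      unfolding permutes_def by auto
  qed
qed (simp_all add: o_assoc permutes_inv_o[OF p])

text \<open>The permutations with prescribed values at 4, 5, 6 form a left coset of the symmetric
  group of {1,2,3}. On an alternating tensor its six elements contribute equally, which cancels the
  factor 3! in the definition of the star.\<close>

lemma hodge_star_apply:
  assumes w: "\<omega> \<in> Lambda3" and p: "p permutes (UNIV :: 6 set)"
  shows "hodge_star \<omega> $ (p 4, p 5, p 6) = of_int (sign p) * \<omega> $ (p 1, p 2, p 3)"
proof -
  have pp: "permutation p"
    using p by (auto simp: permutation_permutes)
  have "(\<Sum>q | q permutes UNIV \<and> q 4 = p 4 \<and> q 5 = p 5 \<and> q 6 = p 6.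
      of_int (sign q) * \<omega> $ (q 1, q 2, q 3)) =
    (\<Sum>r | r permutes {1, 2, 3}. of_int (sign (p \<circ> r)) * \<omega> $ (p (r 1), p (r 2), p (r 3)))"
    by (subst sum.reindex_bij_betw[OF bij_betw_permutes_coset[OF p], symmetric]) simp
  also have "\<dots> = (\<Sum>r | r permutes {1, 2, 3 :: 6}. of_int (sign p) * \<omega> $ (p 1, p 2, p 3))"
  proof (intro sum.cong refl)
    fix r assume "r \<in> {r. r permutes {1, 2, 3 :: 6}}"
    then have r: "r permutes {1, 2, 3}" "permutation r"
      by (auto simp: permutation_permutes intro!: exI[of _ "{1, 2, 3}"])
    have "of_int (sign r) * of_int (sign r) = (1 :: complex)"
      by (simp flip: of_int_mult)
    then show "of_int (sign (p \<circ> r)) * \<omega> $ (p (r 1), p (r 2), p (r 3)) =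
        of_int (sign p) * \<omega> $ (p 1, p 2, p 3)"
      using r by (simp add: Lambda3_permute[OF w] sign_compose[OF pp] flip: mult.assoc)
  qed
  also have "\<dots> = 6 * (of_int (sign p) * \<omega> $ (p 1, p 2, p 3))"
    by (simp add: card_permutations[of _ 3] fact_numeral)
  finally show ?thesis
    by (simp add: hodge_star_def fact_numeral)
qed

lemma exists_permutation_456:
  assumes "distinct [l, m, n :: 6]"
  shows "\<exists>p. p permutes (UNIV :: 6 set) \<and> p 4 = l \<and> p 5 = m \<and> p 6 = n"
proof -
  \<comment> \<open>Each transposition places one value, aiming at the preimage of that value under
    those applied after it; distinctness keeps it from disturbing the positions already
    settled.\<close>
  define t1 t2 t3 where "t1 = Transposition.transpose 4 l" and "t2 = Transposition.transpose 5 (t1 m)"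
    and "t3 = Transposition.transpose 6 (t2 (t1 n))"
  have "(t1 \<circ> t2 \<circ> t3) permutes UNIV"
    unfolding t1_def t2_def t3_def by (intro permutes_compose permutes_swap_id UNIV_I)
  moreover have "(t1 \<circ> t2 \<circ> t3) 6 = n" "(t1 \<circ> t2 \<circ> t3) 5 = m" "(t1 \<circ> t2 \<circ> t3) 4 = l"
    using assms unfolding t1_def t2_def t3_def by (auto simp: Transposition.transpose_def)
  ultimately show ?thesis
    by blast
qed

text \<open>Applying the star twice exchanges the two halves of the six indices. This exchange is a
  product of three transpositions, hence odd. At triples with a repeated index both sides
  vanish.\<close>

lemma hodge_star_hodge_star:
  assumes w: "\<omega> \<in> Lambda3"
  shows "hodge_star (hodge_star \<omega>) = - \<omega>"
proof -
  have "hodge_star (hodge_star \<omega>) $ (l, m, n) = - \<omega> $ (l, m, n)" for l m n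
  proof (cases "distinct [l, m, n]")
    case True
    then obtain p where p: "p permutes UNIV" "p 4 = l" "p 5 = m" "p 6 = n"
      using exists_permutation_456 by blast
    define \<tau> where "\<tau>
        = Transposition.transpose 1 4 \<circ> Transposition.transpose 2 5 \<circ> Transposition.transpose 3 (6::6)"
    have pt: "\<tau> permutes UNIV"
      unfolding \<tau>_def by (intro permutes_compose permutes_swap_id UNIV_I)
    have \<tau>: "\<tau> 1 = 4" "\<tau> 2 = 5" "\<tau> 3 = 6" "\<tau> 4 = 1" "\<tau> 5 = 2" "\<tau> 6 = 3"
      by (simp_all add: \<tau>_def Transposition.transpose_def)
    have "sign \<tau> = - 1"
      by (simp add: \<tau>_def sign_compose permutation_compose permutation_swap_id sign_swap_id)
    then have s: "sign (p \<circ> \<tau>) = - sign p"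
      using p pt by (subst sign_compose) (auto simp: permutation_permutes)
    have "hodge_star \<omega> $ (p 1, p 2, p 3) = - of_int (sign p) * \<omega> $ (p 4, p 5, p 6)"
      using hodge_star_apply[OF w permutes_compose[OF pt p(1)]] by (simp add: \<tau> s)
    then have "hodge_star (hodge_star \<omega>) $ (p 4, p 5, p 6) =
        of_int (sign p) * (- of_int (sign p) * \<omega> $ (p 4, p 5, p 6))"
      using hodge_star_apply[OF hodge_star_in_Lambda3 p(1)] by simp
    moreover have "of_int (sign p) * of_int (sign p) = (1 :: complex)"
      by (simp flip: of_int_mult)
    ultimately show ?thesis
      using p by (simp flip: mult.assoc)
  next
    case False
    have 0: "\<eta> $ (l, m, n) = 0" if \<eta>: "\<eta> \<in> Lambda3" for \<eta>
      using False Lambda3_swap[OF \<eta>, of l m n] Lambda3_swap[OF \<eta>, of m l n] Lambda3_swap[OF \<eta>, of m n l]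
      by (auto simp: eq_neg_iff_add_eq_0)
    show ?thesis
      using 0[OF w] 0[OF hodge_star_in_Lambda3] by simp
  qed
  then show ?thesis
    by (simp add: vec_eq_iff)
qed

text \<open>Since \<open>\<star>\<star> = - 1\<close> on three-forms, the operators \<open>(- \<star>\<star> \<mp> \<i> \<star>) / 2\<close> project the space of all tensors
  onto the two eigenspaces, and their difference is \<open>- \<i> \<star>\<close>.\<close>

lemma signature_character_trace:
  assumes A: "rotation_matrix A"
  shows "signature_character A =
    - \<i> * (\<Sum>x\<in>UNIV. Lambda3_act A (hodge_star (axis x 1)) $ x)"
proof -
  interpret h: Vector_Spaces.linear "(*s)" "(*s)" hodge_star
    by (rule hodge_star_linear)
  interpret f: Vector_Spaces.linear "(*s)" "(*s)" "Lambda3_act A"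
    by (rule linear_Lambda3_act)
  \<comment> \<open>\<open>- hodge_star (hodge_star \<omega>)\<close> stands in for \<omega>: it is
    alternating for every tensor and equals \<omega> on \<open>Lambda3\<close>. The image of
    \<open>P e\<close> has eigenvalue \<open>- e\<close>, so \<open>e = - \<i>\<close> gives
    \<open>Lambda3_plus\<close>.\<close>
  define P where "P = (\<lambda>e \<omega>. (1 / 2 :: complex) *s (- hodge_star (hodge_star \<omega>) + e *s hodge_star \<omega>))"
  have P: "trace_on {\<omega> \<in> Lambda3. hodge_star \<omega> = (- e) *s \<omega>} (Lambda3_act A) =
      (\<Sum>x\<in>UNIV. Lambda3_act A (P e (axis x 1)) $ x)" if e: "e * e = - 1" for e
  proof (rule trace_on_projection[OF linear_Lambda3_act])
    show "Vector_Spaces.linear (*s) (*s) (P e)"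
      by unfold_locales (simp_all add: P_def h.add h.scale algebra_simps vec_eq_iff)
    have "P e \<omega> \<in> Lambda3" for \<omega>
      unfolding P_def using subspace_Lambda3 hodge_star_in_Lambda3
      by (intro vec.subspace_scale vec.subspace_add vec.subspace_neg) auto
    moreover have "hodge_star (P e \<omega>) = (- e) *s P e \<omega>" for \<omega>
      unfolding P_def h.scale h.add h.neg hodge_star_hodge_star[OF hodge_star_in_Lambda3]
      using e by (simp add: vec_eq_iff algebra_simps)
    ultimately show "range (P e) \<subseteq> {\<omega> \<in> Lambda3. hodge_star \<omega> = (- e) *s \<omega>}"
      by auto
    show "P e v = v" if "v \<in> {\<omega> \<in> Lambda3. hodge_star \<omega> = (- e) *s \<omega>}" for v
      using that e by (simp add: P_def hodge_star_hodge_star vec_eq_iff) (simp flip: mult.assoc)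
    show "Lambda3_act A ` {\<omega> \<in> Lambda3. hodge_star \<omega> = (- e) *s \<omega>} \<subseteq>
        {\<omega> \<in> Lambda3. hodge_star \<omega> = (- e) *s \<omega>}"
      using A Lambda3_act_in_Lambda3 by (auto simp: hodge_star_Lambda3_act f.scale f.neg)
  qed
  have "Lambda3_act A (P (- \<i>) v) - Lambda3_act A (P \<i> v) = (- \<i>) *s Lambda3_act A (hodge_star v)" for v
    unfolding P_def f.scale f.add f.neg by (simp add: vec_eq_iff algebra_simps)
  then have "Lambda3_act A (P (- \<i>) v) $ x - Lambda3_act A (P \<i> v) $ x =
      - \<i> * Lambda3_act A (hodge_star v) $ x" for v x
    by (metis vector_minus_component vector_smult_component)
  then show ?thesis
    using P[of "- \<i>"] P[of \<i>]
    by (simp add: signature_character_def Lambda3_plus_def Lambda3_minus_def sum_distrib_left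
        flip: sum_subtractf)
qed

lemma Lambda3_act_axis: "Lambda3_act A (axis (a, b, c) 1) $ (i, j, k) =
    complex_of_real (A $ i $ a * A $ j $ b * A $ k $ c)"
proof -
  have "Lambda3_act A (axis (a, b, c) 1) $ (i, j, k) = (\<Sum>a'\<in>UNIV. \<Sum>b'\<in>UNIV. \<Sum>c'\<in>UNIV.
      if a' = a then if b' = b then if c' = c
          then complex_of_real (A $ i $ a' * A $ j $ b' * A $ k $ c') else 0 else 0 else 0)"
    unfolding Lambda3_act_def by (simp, intro sum.cong refl) (auto simp: axis_def)
  also have "\<dots> = (\<Sum>a'\<in>UNIV. \<Sum>b'\<in>UNIV.
      if a' = a then if b' = b then complex_of_real (A $ i $ a' * A $ j $ b' * A $ k $ c) else 0
          else 0)"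
    by (intro sum.cong refl) auto
  also have "\<dots> = (\<Sum>a'\<in>UNIV. if a' = a then complex_of_real (A $ i $ a' * A $ j $ b * A $ k $ c) else 0)"
    by (intro sum.cong refl) auto
  finally show ?thesis
    by simp
qed

text \<open>The trace runs over basis tensors \<open>x\<close>, the star over permutations with
  \<open>(p 4, p 5, p 6) = x\<close>; together they run over all permutations. The star is first
  moved outside the action, because the action on a basis tensor has plain products of entries as
  coefficients.\<close>

lemma signature_character_pfaffian:
  assumes A: "rotation_matrix A"
  shows "signature_character A = - \<i> / 6 * complex_of_real
    (\<Sum>p | p permutes UNIV. of_int (sign p) * (A $ p 1 $ p 4 * A $ p 2 $ p 5 * A $ p 3 $ p 6))"
proof -
  let ?g = "\<lambda>p. of_int (sign p) * complex_of_real (A $ p 1 $ p 4 * A $ p 2 $ p 5 * A $ p 3 $ p 6)"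
  have "Lambda3_act A (hodge_star (axis x 1)) $ x =
     (\<Sum>p \<in> {p \<in> {p. p permutes UNIV}. (p 4, p 5, p 6) = x}. ?g p) / 6" for x
  proof -
    obtain a b c where x: "x = (a, b, c)"
      by (metis prod_cases3)
    have "{p \<in> {p. p permutes UNIV}. (p 4, p 5, p 6) = x} = {p. p permutes UNIV \<and> p 4 = a \<and> p 5 = b
        \<and> p 6 = c}"
      by (auto simp: x)
    then show ?thesis
      unfolding hodge_star_Lambda3_act[OF A, symmetric]
      by (simp add: hodge_star_def Lambda3_act_axis x fact_numeral)
  qed
  then have "(\<Sum>x\<in>UNIV. Lambda3_act A (hodge_star (axis x 1)) $ x) = (\<Sum>p | p permutes UNIV. ?g p) / 6"
    by (simp only: sum_divide_distrib[symmetric], subst sum.group) (auto simp: finite_permutations)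
  then show ?thesis
    unfolding signature_character_trace[OF A] by simp
qed

lemma sum_triple: "(\<Sum>a\<in>UNIV. \<Sum>b\<in>UNIV. \<Sum>c\<in>UNIV. f a b c) = (\<Sum>(a, b, c)\<in>UNIV. f a b c)"
  by (simp add: sum.cartesian_product)

lemma Lambda3_act_mult: "Lambda3_act (X ** Y) \<omega> = Lambda3_act X (Lambda3_act Y \<omega>)"
proof -
  have prod3: "(\<Sum>u\<in>UNIV. f u) * (\<Sum>v\<in>UNIV. g v) * (\<Sum>w\<in>UNIV. h w) = (\<Sum>(u, v, w)\<in>UNIV. f u * g v * h w)"
    for f g h :: "6 \<Rightarrow> real"
    unfolding sum_triple[symmetric]
    by (subst sum_product) (simp only: sum_distrib_right, simp only: sum_distrib_left)
  have act: "Lambda3_act A \<omega> $ (i, j, k) = (\<Sum>x\<in>UNIV.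
      of_real (A $ i $ fst x * A $ j $ fst (snd x) * A $ k $ snd (snd x)) * \<omega> $ x)" for A \<omega> i j k
    by (simp add: Lambda3_act_def sum_triple split_def)
  have "Lambda3_act (X ** Y) \<omega> $ (i, j, k) = Lambda3_act X (Lambda3_act Y \<omega>) $ (i, j, k)" for i j k
  proof -
    let ?F = "\<lambda>x u. X$i$fst u * Y$fst u$fst x * (X$j$fst (snd u) * Y$fst (snd u)$fst (snd x)) *
      (X$k$snd (snd u) * Y$snd (snd u)$snd (snd x))"
    have "(X ** Y) $ i $ fst x * (X ** Y) $ j $ fst (snd x) * (X ** Y) $ k $ snd (snd x) =
        (\<Sum>u\<in>UNIV. ?F x u)" for x
      by (simp add: matrix_matrix_mult_def prod3 split_def)
    then have "Lambda3_act (X ** Y) \<omega> $ (i, j, k) = (\<Sum>x\<in>UNIV. \<Sum>u\<in>UNIV. of_real (?F x u) * \<omega> $ x)"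
      unfolding act by (simp only: of_real_sum sum_distrib_right)
    also have "\<dots> = (\<Sum>u\<in>UNIV. \<Sum>x\<in>UNIV. of_real (?F x u) * \<omega> $ x)"
      by (rule sum.swap)
    also have "\<dots> = Lambda3_act X (Lambda3_act Y \<omega>) $ (i, j, k)"
      unfolding act[of X] sum_distrib_left
    proof (intro sum.cong refl)
      fix u :: "6 \<times> 6 \<times> 6"
      have "Lambda3_act Y \<omega> $ u = (\<Sum>x\<in>UNIV. of_real (Y $ fst u $ fst x *
          Y $ fst (snd u) $ fst (snd x) * Y $ snd (snd u) $ snd (snd x)) * \<omega> $ x)"
        using act[of Y \<omega> "fst u" "fst (snd u)" "snd (snd u)"] by simp
      then show "(\<Sum>x\<in>UNIV. of_real (?F x u) * \<omega> $ x) = of_real (X $ i $ fst u * X $ j $ fst (snd u) *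
          X $ k $ snd (snd u)) * Lambda3_act Y \<omega> $ u"
        by (simp add: sum_distrib_left mult_ac)
    qed
    finally show ?thesis .
  qed
  then show ?thesis
    by (auto simp: vec_eq_iff)
qed

text \<open>On the full tensor space the character is \<open>- \<i>\<close> times the trace of the
  action composed with the star. The action is multiplicative and commutes with the star for
  rotations, so cyclicity of the trace removes the conjugating matrix.\<close>

lemma signature_character_conj:
  assumes A: "rotation_matrix A" and S: "rotation_matrix S"
  shows "signature_character (S ** A ** transpose S) = signature_character A"
proof -
  have S': "rotation_matrix (transpose S)"
    using S by (simp add: rotation_matrix_def orthogonal_matrix_transpose)
  have SAS: "rotation_matrix (S ** A ** transpose S)"
    using A S S' by (simp add: rotation_matrix_def orthogonal_matrix_mul det_mul)
  let ?H = "matrix hodge_star" and ?M = "\<lambda>A. matrix (Lambda3_act A)"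
  have tr: "signature_character B = - \<i> * trace (?M B ** ?H)" if "rotation_matrix B" for B
    unfolding signature_character_trace[OF that]
    by (simp add: matrix_compose_gen[OF hodge_star_linear linear_Lambda3_act, symmetric] trace_def)
      (simp add: matrix_def)
  have M: "?M (X ** Y) = ?M X ** ?M Y" for X Y
    unfolding matrix_compose_gen[OF linear_Lambda3_act linear_Lambda3_act, symmetric]
    by (rule arg_cong[of _ _ matrix]) (simp add: fun_eq_iff Lambda3_act_mult)
  have H: "?H ** ?M X = ?M X ** ?H" if "rotation_matrix X" for X
    unfolding matrix_compose_gen[OF linear_Lambda3_act hodge_star_linear, symmetric]
      matrix_compose_gen[OF hodge_star_linear linear_Lambda3_act, symmetric]
    by (simp add: o_def hodge_star_Lambda3_act[OF that])
  have "trace (?M (S ** A ** transpose S) ** ?H) = trace (?M S ** (?M A ** ?M (transpose S) ** ?H))"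
    by (simp add: M matrix_mul_assoc)
  also have "\<dots> = trace (?M A ** ?M (transpose S) ** ?H ** ?M S)"
    by (rule trace_mul_sym)
  also have "\<dots> = trace (?M A ** (?M (transpose S ** S) ** ?H))"
    by (simp add: M H[OF S] flip: matrix_mul_assoc)
  also have "\<dots> = trace (?M (A ** (transpose S ** S)) ** ?H)"
    unfolding M by (simp add: matrix_mul_assoc)
  also have "A ** (transpose S ** S) = A"
    using S by (simp add: rotation_matrix_def orthogonal_matrix)
  finally show ?thesis
    by (simp add: tr[OF SAS] tr[OF A])
qed

lemma signature_character_rot6:
  "signature_character (rot6 \<theta>) = 8 * \<i> * complex_of_real (sin (\<theta> $ 1) * sin (\<theta> $ 2) * sin (\<theta> $ 3))"
  unfolding signature_character_pfaffian[OF rotation_matrix_rot6]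
  unfolding rot6_def sum_permutes_block6 by simp

section \<open>The scaling field as a gradient\<close>

text \<open>The inverse of \<open>\<lambda>\<phi>. 2 *\<^sub>R psi_coord \<phi>\<close>, expressing
  the phases through the doubled coordinates.\<close>

definition phi_of :: "real^3 \<Rightarrow> real^3" where
  "phi_of \<theta> = (\<chi> k. (\<theta> $ (k + 1) + \<theta> $ (k + 2)) / 2)"

lemma numeral_mod_3: "(4 :: 3) = 1" "(5 :: 3) = 2" "(6 :: 3) = 3" "(7 :: 3) = 1"
  by simp_all

lemma psi_coord_nth:
  "(2 *\<^sub>R psi_coord \<phi>) $ 1 = \<phi> $ 2 + \<phi> $ 3 - \<phi> $ 1"
  "(2 *\<^sub>R psi_coord \<phi>) $ 2 = \<phi> $ 3 + \<phi> $ 1 - \<phi> $ 2"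
  "(2 *\<^sub>R psi_coord \<phi>) $ 3 = \<phi> $ 1 + \<phi> $ 2 - \<phi> $ 3"
  by (simp_all add: psi_coord_def numeral_mod_3)

lemma phi_of_nth:
  "phi_of \<theta> $ 1 = (\<theta> $ 2 + \<theta> $ 3) / 2"
  "phi_of \<theta> $ 2 = (\<theta> $ 3 + \<theta> $ 1) / 2"
  "phi_of \<theta> $ 3 = (\<theta> $ 1 + \<theta> $ 2) / 2"
  by (simp_all add: phi_of_def numeral_mod_3)

lemma psi_coord_inverse:
  "phi_of (2 *\<^sub>R psi_coord \<phi>) = \<phi>" "2 *\<^sub>R psi_coord (phi_of \<theta>) = \<theta>"
  unfolding vec_eq_iff forall_3 phi_of_nth psi_coord_nth by (simp_all add: field_simps)

lemma linear_psi_coord: "linear (\<lambda>\<phi>. 2 *\<^sub>R psi_coord \<phi>)"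
  by (rule linearI) (unfold vec_eq_iff forall_3 vector_add_component psi_coord_nth vector_scaleR_component[of _ "2 *\<^sub>R _"],
    simp_all add: psi_coord_nth algebra_simps)

lemma linear_phi_of: "linear phi_of"
  by (rule linearI) (simp_all add: phi_of_nth vec_eq_iff forall_3 field_simps)

lemma scaling_field_phi_of:
  "scaling_field (phi_of \<theta>) = (\<chi> k. sin (\<theta> $ (k + 1) + \<theta> $ (k + 2)) * sin (\<theta> $ k))"
proof -
  have "phi_of \<theta> $ (k + 1) + phi_of \<theta> $ (k + 2) - phi_of \<theta> $ k = (2 *\<^sub>R psi_coord (phi_of \<theta>)) $ k" for k
    by (simp add: psi_coord_def)
  moreover have "2 * phi_of \<theta> $ k = \<theta> $ (k + 1) + \<theta> $ (k + 2)" for k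
    by (simp add: phi_of_def)
  ultimately show ?thesis
    unfolding scaling_field_def psi_coord_inverse(2) by simp
qed

lemma psi_coord_scaling_field:
  "2 *\<^sub>R psi_coord (scaling_field (phi_of \<theta>)) =
     (\<chi> k. 2 * cos (\<theta> $ k) * sin (\<theta> $ (k + 1)) * sin (\<theta> $ (k + 2)))"
  unfolding scaling_field_phi_of vec_eq_iff forall_3 psi_coord_nth
  by (simp add: sin_add numeral_mod_3 algebra_simps)

lemma gradient_eqI:
  assumes "GDERIV f x :> D"
  shows "gradient f x = D"
  unfolding gradient_def
proof (rule the_equality)
  fix D' assume "GDERIV f x :> D'"
  then have "(\<lambda>h. h \<bullet> D') = (\<lambda>h. h \<bullet> D)"
    using assms unfolding gderiv_def by (rule has_derivative_unique)
  then show "D' = D"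
    by (metis inner_commute vector_eq_rdot)
qed (rule assms)

lemma character_gradient_eq:
  "character_gradient \<theta> = (\<chi> k. 8 * cos (\<theta> $ k) * sin (\<theta> $ (k + 1)) * sin (\<theta> $ (k + 2)))"
proof -
  have "GDERIV (\<lambda>\<theta> :: real^3. 8 * (sin (\<theta> $ 1) * sin (\<theta> $ 2) * sin (\<theta> $ 3))) \<theta> :>
     (\<chi> k. 8 * cos (\<theta> $ k) * sin (\<theta> $ (k + 1)) * sin (\<theta> $ (k + 2)))"
    unfolding gderiv_def
    by (auto intro!: derivative_eq_intros bounded_linear.has_derivative[OF bounded_linear_vec_nth]
        simp: inner_vec_def sum_3 fun_eq_iff numeral_mod_3 algebra_simps)
  then show ?thesis
    unfolding character_gradient_def matrix_exp_block_so6 signature_character_rot6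
    by (intro gradient_eqI) simp
qed

lemma vf_orbit_scaling_field:
  "(\<lambda>\<phi>. 2 *\<^sub>R psi_coord \<phi>) ` vf_orbit scaling_field \<phi> =
     vf_orbit character_gradient (2 *\<^sub>R psi_coord \<phi>)"
proof -
  \<comment> \<open>The factor 1/4 compares the coefficient 2 of the transformed scaling field with
    the coefficient 8 of the gradient.\<close>
  let ?Y = "\<lambda>\<theta>. (1 / 4) *\<^sub>R character_gradient \<theta>"
  have "2 *\<^sub>R psi_coord (scaling_field \<phi>) = ?Y (2 *\<^sub>R psi_coord \<phi>)" for \<phi>
    using psi_coord_scaling_field[of "2 *\<^sub>R psi_coord \<phi>"]
    by (simp add: psi_coord_inverse character_gradient_eq vec_eq_iff)
  then have "(\<lambda>\<phi>. 2 *\<^sub>R psi_coord \<phi>) ` vf_orbit scaling_field \<phi> = vf_orbit ?Y (2 *\<^sub>R psi_coord \<phi>)"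
    by (intro vf_orbit_linear_image[OF linear_psi_coord linear_phi_of] psi_coord_inverse)
  also have "\<dots> = vf_orbit character_gradient (2 *\<^sub>R psi_coord \<phi>)"
    by (rule vf_orbit_scale) simp
  finally show ?thesis .
qed

section \<open>Normal forms of symmetric unitary and of orthogonal matrices\<close>

text \<open>The eigenvector is a maximum point of the Rayleigh quotient.\<close>

lemma selfadjoint_eigenvector:
  fixes f :: "'a::euclidean_space \<Rightarrow> 'a"
  assumes f: "linear f" and sym: "\<And>x y. f x \<bullet> y = x \<bullet> f y"
    and V: "subspace V" "f ` V \<subseteq> V" "dim V \<ge> 1"
  obtains v c where "v \<in> V" "norm v = 1" "f v = c *\<^sub>R v"
proof -
  let ?K = "sphere 0 1 \<inter> V"
  have "V \<noteq> {0}" "0 \<in> V"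
    using V by (auto simp: subspace_0)
  then obtain x where x: "x \<in> V" "x \<noteq> 0"
    by auto
  then have "(1 / norm x) *\<^sub>R x \<in> ?K"
    using V by (auto simp: subspace_scale)
  moreover have "compact ?K"
    using V by (intro compact_Int_closed compact_sphere closed_subspace)
  moreover have "continuous_on ?K (\<lambda>x. f x \<bullet> x)"
    using f by (intro continuous_intros linear_continuous_on) (simp add: linear_conv_bounded_linear)
  ultimately obtain v where v: "v \<in> ?K" and max: "\<And>y. y \<in> ?K \<Longrightarrow> f y \<bullet> y \<le> f v \<bullet> v"
    using continuous_attains_sup[of ?K "\<lambda>x. f x \<bullet> x"] by blast
  define c where "c = f v \<bullet> v"
  \<comment> \<open>Homogeneous form of maximality: this quadratic form is nonnegative on
    \<open>V\<close> and vanishes at \<open>v\<close>.\<close>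
  have q: "c * (y \<bullet> y) - f y \<bullet> y \<ge> 0" if y: "y \<in> V" for y
  proof (cases "y = 0")
    case False
    let ?z = "(1 / norm y) *\<^sub>R y"
    have "?z \<in> ?K"
      using y V False by (auto simp: subspace_scale)
    then have "f ?z \<bullet> ?z \<le> c"
      unfolding c_def by (rule max)
    then have "f y \<bullet> y / (norm y)\<^sup>2 \<le> c"
      by (simp add: linear_scale[OF f] power2_eq_square)
    then show ?thesis
      using False by (simp add: divide_le_eq power2_norm_eq_inner)
  qed (use f in \<open>simp add: linear_0\<close>)
  define w where "w = f v - c *\<^sub>R v"
  have vV: "v \<in> V" "v \<bullet> v = 1"
    using v by (auto simp: dot_square_norm)
  have wV: "w \<in> V"
    unfolding w_def using vV V by (auto intro: subspace_diff subspace_scale)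
  define Q where "Q = c * (w \<bullet> w) - f w \<bullet> w"
  have Q: "Q \<ge> 0"
    unfolding Q_def using wV by (rule q)
  \<comment> \<open>Along the line from \<open>v\<close> in the direction of the defect
    \<open>w\<close>, the form has linear term \<open>- 2 * t * (w \<bullet> w)\<close>, which would
    make it negative for small positive \<open>t\<close> unless \<open>w = 0\<close>.\<close>
  have vt: "c * ((v + t *\<^sub>R w) \<bullet> (v + t *\<^sub>R w)) - f (v + t *\<^sub>R w) \<bullet> (v + t *\<^sub>R w) = t\<^sup>2 * Q
      - 2 * t * (w \<bullet> w)" for t
  proof -
    have "f w \<bullet> v = f v \<bullet> w"
      by (metis inner_commute sym)
    then have "c * ((v + t *\<^sub>R w) \<bullet> (v + t *\<^sub>R w)) - f (v + t *\<^sub>R w) \<bullet> (v + t *\<^sub>R w) =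
       c - f v \<bullet> v + 2 * t * (c * (v \<bullet> w) - f v \<bullet> w) + t\<^sup>2 * Q"
      using vV by (simp add: linear_add[OF f] linear_scale[OF f] inner_simps inner_commute[of w v] Q_def
          power2_eq_square algebra_simps)
    moreover have "c * (v \<bullet> w) - f v \<bullet> w = - (w \<bullet> w)"
      by (simp add: w_def inner_simps algebra_simps inner_commute)
    ultimately show ?thesis
      by (simp add: c_def)
  qed
  have "w = 0"
  proof (rule ccontr)
    assume "w \<noteq> 0"
    then have ww: "w \<bullet> w > 0"
      by simp
    \<comment> \<open>Chosen so that \<open>t * Q < w \<bullet> w\<close>, while nonnegativity of
      the form would demand \<open>t * Q \<ge> 2 * (w \<bullet> w)\<close>.\<close>
    define t where "t = (w \<bullet> w) / (Q + 1)"
    have t: "t > 0" "t * (Q + 1) = w \<bullet> w"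
      using ww Q by (auto simp: t_def)
    have "v + t *\<^sub>R w \<in> V"
      using vV wV V by (auto intro: subspace_add subspace_scale)
    from q[OF this] have "t * (t * Q - 2 * (w \<bullet> w)) \<ge> 0"
      unfolding vt by (simp add: power2_eq_square algebra_simps)
    then have "t * Q \<ge> 2 * (w \<bullet> w)"
      using t by (simp add: zero_le_mult_iff)
    then show False
      using t ww by (simp add: algebra_simps)
  qed
  then show ?thesis
    using that[of v c] v by (auto simp: w_def)
qed

text \<open>An eigenspace of \<open>f\<close> in \<open>V\<close> is invariant under the commuting
  map \<open>g\<close>, so the eigenvector of \<open>g\<close> can be sought inside it.\<close>

lemma commuting_selfadjoint_eigenvector:
  fixes f g :: "'a::euclidean_space \<Rightarrow> 'a"
  assumes f: "linear f" "\<And>x y. f x \<bullet> y = x \<bullet> f y" and g: "linear g" "\<And>x y. g x \<bullet> y = x \<bullet> g y"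
    and fg: "\<And>x. f (g x) = g (f x)"
    and V: "subspace V" "f ` V \<subseteq> V" "g ` V \<subseteq> V" "dim V \<ge> 1"
  obtains v a b where "v \<in> V" "norm v = 1" "f v = a *\<^sub>R v" "g v = b *\<^sub>R v"
proof -
  obtain u a where u: "u \<in> V" "norm u = 1" "f u = a *\<^sub>R u"
    using selfadjoint_eigenvector[OF f V(1,2,4)] by blast
  let ?E = "{x \<in> V. f x = a *\<^sub>R x}"
  have E: "subspace ?E"
    using V(1) f(1) unfolding subspace_def
    by (auto simp: linear_0 linear_add linear_scale algebra_simps)
  have "g ` ?E \<subseteq> ?E"
    using V(3) by (auto simp: fg linear_scale[OF g(1)])
  moreover have "dim ?E \<ge> 1"
  proof -
    have "u \<in> ?E" "u \<noteq> 0"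
      using u by auto
    then have "dim ?E \<noteq> 0"
      by (metis (no_types, lifting) dim_eq_0 singletonD subsetD)
    then show ?thesis
      by linarith
  qed
  ultimately obtain v b where "v \<in> ?E" "norm v = 1" "g v = b *\<^sub>R v"
    using selfadjoint_eigenvector[OF g E] by blast
  then show ?thesis
    using that by blast
qed

text \<open>Induction on the dimension: by selfadjointness the orthogonal complement in
  \<open>V\<close> of a common eigenvector is again invariant under both maps.\<close>

lemma commuting_selfadjoint_diagonalization:
  fixes f g :: "'a::euclidean_space \<Rightarrow> 'a"
  assumes f: "linear f" "\<And>x y. f x \<bullet> y = x \<bullet> f y" and g: "linear g" "\<And>x y. g x \<bullet> y = x \<bullet> g y"
    and fg: "\<And>x. f (g x) = g (f x)"
    and V: "subspace V" "f ` V \<subseteq> V" "g ` V \<subseteq> V"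
  shows "\<exists>B. finite B \<and> B \<subseteq> V \<and> card B = dim V \<and> pairwise orthogonal B \<and>
    (\<forall>v\<in>B. norm v = 1 \<and> (\<exists>a. f v = a *\<^sub>R v) \<and> (\<exists>b. g v = b *\<^sub>R v))"
  using V
proof (induction "dim V" arbitrary: V)
  case 0
  then show ?case
    by (intro exI[of _ "{}"]) auto
next
  case (Suc n)
  then obtain v a b where v: "v \<in> V" "norm v = 1" "f v = a *\<^sub>R v" "g v = b *\<^sub>R v"
    using commuting_selfadjoint_eigenvector[OF f g fg, of V] by (metis le_add1 plus_1_eq_Suc)
  let ?V = "{y \<in> V. \<forall>x\<in>span {v}. orthogonal x y}"
  have sp: "(\<forall>x\<in>span {v}. orthogonal x y) \<longleftrightarrow> v \<bullet> y = 0" for y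
    by (auto simp: span_singleton orthogonal_def)
  have "dim ?V + dim (span {v}) = dim V"
    using v Suc.prems(1) by (intro dim_subspace_orthogonal_to_vectors) (auto simp: span_minimal)
  moreover have "dim {v} = 1"
    using v by (subst dim_singleton) auto
  ultimately have n: "n = dim ?V"
    using Suc.hyps(2) by (simp add: dim_span)
  have "subspace ?V"
    using Suc.prems(1) unfolding sp subspace_def by (auto simp: inner_simps)
  moreover have "f ` ?V \<subseteq> ?V" "g ` ?V \<subseteq> ?V"
    using Suc.prems v f(2)[of v] g(2)[of v] unfolding sp by (auto simp flip: f(2) g(2))
  ultimately obtain B where B: "finite B" "B \<subseteq> ?V" "card B = dim ?V" "pairwise orthogonal B"
    "\<forall>v\<in>B. norm v = 1 \<and> (\<exists>a. f v = a *\<^sub>R v) \<and> (\<exists>b. g v = b *\<^sub>R v)"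
    using Suc.hyps(1)[OF n] by blast
  have "v \<notin> B"
    using B(2) v unfolding sp by (auto simp: dot_square_norm)
  then have "card (insert v B) = dim V"
    using B n Suc.hyps(2) by simp
  moreover have "pairwise orthogonal (insert v B)"
    using B(2,4) unfolding sp pairwise_insert by (auto simp: orthogonal_def inner_commute)
  ultimately show ?case
    using B v by (intro exI[of _ "insert v B"]) auto
qed

lemma orthogonal_matrix_columns:
  fixes h :: "'n::finite \<Rightarrow> real^'n"
  assumes "\<And>i j. h i \<bullet> h j = (if i = j then 1 else 0)"
  shows "orthogonal_matrix (\<chi> i j. h j $ i)"
  using assms unfolding orthogonal_matrix
  by (simp add: vec_eq_iff matrix_matrix_mult_def transpose_def mat_def inner_vec_def)

lemma matrix_mult_column: "(A ** B) $ i $ j = (A *v (\<chi> i. B $ i $ j)) $ i"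
  by (simp add: matrix_matrix_mult_def matrix_vector_mult_def)

lemma inner_matrix_vector_left: "(A *v x) \<bullet> y = x \<bullet> (transpose A *v y)"
  for A :: "real^'n^'m"
  by (metis dot_lmul_matrix transpose_matrix_vector transpose_transpose)

lemma simultaneous_diagonalization:
  fixes X Y :: "real^'n^'n"
  assumes X: "transpose X = X" and Y: "transpose Y = Y" and XY: "X ** Y = Y ** X"
  obtains S a b where "orthogonal_matrix S"
    "X ** S = S ** (\<chi> i j. if i = j then a i else 0)" "Y ** S = S ** (\<chi> i j. if i = j then b i else 0)"
proof -
  have "(X *v x) \<bullet> y = x \<bullet> (X *v y)" "(Y *v x) \<bullet> y = x \<bullet> (Y *v y)" for x y
    by (simp_all add: inner_matrix_vector_left X Y)
  moreover have "X *v (Y *v x) = Y *v (X *v x)" for x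
    by (simp add: matrix_vector_mul_assoc XY)
  ultimately obtain B where B: "finite B" "card B = CARD('n)" "pairwise orthogonal B"
    "\<forall>v\<in>B. norm v = 1 \<and> (\<exists>a. X *v v = a *\<^sub>R v) \<and> (\<exists>b. Y *v v = b *\<^sub>R v)"
    using commuting_selfadjoint_diagonalization[of "(*v) X" "(*v) Y" UNIV]
    by (metis matrix_vector_mul_linear subspace_UNIV subset_UNIV dim_UNIV DIM_cart DIM_real mult_1_right)
  obtain h where h: "bij_betw h (UNIV :: 'n set) B"
    using B finite_same_card_bij[of "UNIV :: 'n set" B] by auto
  then have hB: "h i \<in> B" for i
    by (auto simp: bij_betw_def)
  then have "\<forall>i. \<exists>a. X *v h i = a *\<^sub>R h i" "\<forall>i. \<exists>b. Y *v h i = b *\<^sub>R h i"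
    using B(4) by blast+
  then obtain a b where ab: "\<And>i. X *v h i = a i *\<^sub>R h i" "\<And>i. Y *v h i = b i *\<^sub>R h i"
    unfolding choice_iff by blast
  have on: "h i \<bullet> h j = (if i = j then 1 else 0)" for i j
  proof (cases "i = j")
    case True
    then show ?thesis
      using B(4) hB[of j] by (simp add: dot_square_norm)
  next
    case False
    then have "h i \<noteq> h j"
      using h by (auto simp: bij_betw_def inj_def)
    then show ?thesis
      using False B(3) hB by (auto simp: pairwise_def orthogonal_def)
  qed
  let ?S = "\<chi> i j. h j $ i"
  have "X ** ?S = ?S ** (\<chi> i j. if i = j then a i else 0)"
      "Y ** ?S = ?S ** (\<chi> i j. if i = j then b i else 0)"
    by (simp_all add: vec_eq_iff matrix_mult_column ab)
      (simp_all add: matrix_vector_mult_def if_distrib[of "\<lambda>x. _ * x"] mult.commute cong: if_cong)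
  then show ?thesis
    using that orthogonal_matrix_columns[of h] on by blast
qed

declare transpose_matrix_vector [simp del]

text \<open>An eigenvector \<open>v\<close> of the selfadjoint map \<open>A + A\<^sup>T\<close> spans together with \<open>A v\<close> a subspace which
  is invariant under \<open>A\<close>, because \<open>A\<^sup>2 v = 2 c A v - v\<close>.\<close>

lemma orthogonal_matrix_reduce:
  fixes A :: "real^'n^'n"
  assumes A: "orthogonal_matrix A"
      and V: "subspace V" "(*v) A ` V \<subseteq> V" "(*v) (transpose A) ` V \<subseteq> V" "dim V \<ge> 1"
  obtains (eigenvector) v \<epsilon> where "v \<in> V" "norm v = 1" "\<epsilon> \<in> {1, -1}" "A *v v = \<epsilon> *\<^sub>R v"
  | (plane) u w \<theta> where "u \<in> V" "w \<in> V" "norm u = 1" "norm w = 1" "u \<bullet> w = 0"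
      "A *v u = cos \<theta> *\<^sub>R u - sin \<theta> *\<^sub>R w" "A *v w = sin \<theta> *\<^sub>R u + cos \<theta> *\<^sub>R w"
proof -
  let ?f = "\<lambda>x. A *v x + transpose A *v x"
  have AA: "A *v (transpose A *v x) = x" "transpose A *v (A *v x) = x" for x
    using A by (simp_all add: matrix_vector_mul_assoc orthogonal_matrix_def)
  have nA: "norm (A *v x) = norm x" for x
    by (simp add: norm_eq inner_matrix_vector_left AA)
  have "linear ?f"
    by (intro linear_compose_add matrix_vector_mul_linear)
  moreover have "?f x \<bullet> y = x \<bullet> ?f y" for x y
    by (simp add: inner_add_left inner_add_right inner_matrix_vector_left add.commute)
  moreover have "?f ` V \<subseteq> V"
    using V by (auto intro!: subspace_add)
  ultimately obtain v k where v: "v \<in> V" "norm v = 1" "?f v = k *\<^sub>R v"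
    using selfadjoint_eigenvector[of ?f V] V by blast
  have vv: "v \<bullet> v = 1"
    using v by (simp add: dot_square_norm)
  define c where "c = (A *v v) \<bullet> v"
  define p where "p = A *v v - c *\<^sub>R v"
  have "k = ?f v \<bullet> v"
    using v vv by simp
  also have "\<dots> = 2 * c"
    using inner_matrix_vector_left[of "transpose A" v v]
    by (simp add: c_def inner_add_left inner_commute[of v "A *v v"])
  finally have k: "k = 2 * c" .
  show ?thesis
  proof (cases "p = 0")
    case True
    then have "A *v v = c *\<^sub>R v"
      by (simp add: p_def)
    moreover from this have "\<bar>c\<bar> = 1"
      using nA[of v] v by simp
    ultimately show ?thesis
      using eigenvector[of v c] v by (auto simp: abs_if split: if_splits)
  next
    case False
    define s where "s = norm p"
    \<comment> \<open>The minus sign follows the convention of \<open>rot6\<close>, whose first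
      column is (cos, - sin, 0, 0, 0, 0).\<close>
    define w where "w = (- 1 / s) *\<^sub>R p"
    have s: "s > 0"
      using False by (simp add: s_def)
    have pV: "p \<in> V"
      unfolding p_def using v V by (auto intro!: subspace_diff subspace_scale)
    have Av: "A *v v = c *\<^sub>R v - s *\<^sub>R w"
      using s by (simp add: w_def p_def)
    have vp: "v \<bullet> p = 0"
      by (simp add: p_def inner_diff_right vv c_def inner_commute)
    have w: "norm w = 1" "v \<bullet> w = 0"
      using s vp by (auto simp: w_def s_def)
    have wV: "w \<in> V"
      unfolding w_def by (rule subspace_scale[OF V(1) pV])
    have "w \<bullet> w = 1"
      using w by (simp add: dot_square_norm)
    then have "(c *\<^sub>R v - s *\<^sub>R w) \<bullet> (c *\<^sub>R v - s *\<^sub>R w) = c\<^sup>2 + s\<^sup>2"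
      using w vv by (simp add: inner_diff_left inner_diff_right inner_commute[of w v] power2_eq_square)
    then have "(norm (A *v v))\<^sup>2 = c\<^sup>2 + s\<^sup>2"
      by (simp only: Av power2_norm_eq_inner)
    then have cs: "c\<^sup>2 + s\<^sup>2 = 1"
      using nA v by simp
    have "transpose A *v v = (2 * c) *\<^sub>R v - A *v v"
      using v(3) by (simp add: k algebra_simps)
    then have "v = A *v ((2 * c) *\<^sub>R v - A *v v)"
      using AA(1)[of v] by simp
    then have AAv: "A *v (A *v v) = (2 * c) *\<^sub>R (A *v v) - v"
      by (simp add: matrix_vector_mult_diff_distrib matrix_vector_mult_scaleR algebra_simps)
    have "A *v p = c *\<^sub>R (A *v v) - v"
      by (simp add: p_def AAv matrix_vector_mult_diff_distrib matrix_vector_mult_scaleR scaleR_add_left[symmetric] algebra_simps)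
    also have "\<dots> = (c\<^sup>2 - 1) *\<^sub>R v - (c * s) *\<^sub>R w"
      unfolding Av by (simp add: algebra_simps power2_eq_square)
    also have "c\<^sup>2 - 1 = - s\<^sup>2"
      using cs by simp
    finally have Ap: "A *v p = (- s\<^sup>2) *\<^sub>R v - (c * s) *\<^sub>R w" .
    have "A *v w = (- 1 / s) *\<^sub>R (A *v p)"
      by (simp only: w_def matrix_vector_mult_scaleR)
    also have "\<dots> = s *\<^sub>R v + c *\<^sub>R w"
      unfolding Ap using s by (simp add: vec_eq_iff field_simps power2_eq_square)
    finally have "A *v w = s *\<^sub>R v + c *\<^sub>R w" .
    moreover obtain \<theta> where "c = cos \<theta>" "s = sin \<theta>"
      using sincos_total_2pi[OF cs] by metis
    ultimately show ?thesis
      using plane[of v w \<theta>] v w wV Av by simp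
  qed
qed

text \<open>The case \<open>\<epsilon> = - 1\<close> is a reflection block; it arises when two eigenvectors for the eigenvalues
  \<open>- 1\<close> and \<open>1\<close> have to be paired.\<close>

definition block_pair :: "real^'n^'n \<Rightarrow> real \<Rightarrow> real \<Rightarrow> real^'n \<Rightarrow> real^'n \<Rightarrow> bool" where
  "block_pair A \<epsilon> \<theta> u w \<longleftrightarrow> norm u = 1 \<and> norm w = 1 \<and> u \<bullet> w = 0 \<and> (\<epsilon> = 1 \<or> \<epsilon> = - 1 \<and> \<theta> = 0) \<and>
     A *v u = \<epsilon> *\<^sub>R (cos \<theta> *\<^sub>R u - sin \<theta> *\<^sub>R w) \<and> A *v w = sin \<theta> *\<^sub>R u + cos \<theta> *\<^sub>R w"

lemma subspace_orthogonal_complement_in: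
  assumes V: "subspace V" shows "subspace {y \<in> V. \<forall>x\<in>B. x \<bullet> y = 0}"
  using V by (auto simp: subspace_def inner_simps)

lemma dim_orthogonal_complement_in:
  fixes V :: "'a::euclidean_space set"
  assumes V: "subspace V" "B \<subseteq> V" and B: "finite B" "\<And>b. b \<in> B \<Longrightarrow> b \<noteq> 0" "pairwise orthogonal B"
  shows "dim {y \<in> V. \<forall>x\<in>B. x \<bullet> y = 0} + card B = dim V"
proof -
  have eq: "{y \<in> V. \<forall>x\<in>B. x \<bullet> y = 0} = {y \<in> V. \<forall>x\<in>span B. orthogonal x y}"
  proof (intro Collect_cong conj_cong refl iffI ballI)
    fix y x assume "\<forall>x\<in>B. x \<bullet> y = 0" "x \<in> span B"
    then show "orthogonal x y"
      using orthogonal_to_span[of x B y] by (simp add: orthogonal_def inner_commute)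
  qed (auto simp: orthogonal_def intro: span_base)
  have "independent B"
    using B by (intro pairwise_orthogonal_independent) auto
  then have "dim (span B) = card B"
    by (simp add: dim_eq_card_independent)
  moreover have "dim {y \<in> V. \<forall>x\<in>span B. orthogonal x y} + dim (span B) = dim V"
    using V by (intro dim_subspace_orthogonal_to_vectors) (auto simp: span_minimal)
  ultimately show ?thesis
    unfolding eq by simp
qed

text \<open>If only a real eigenvector is found, its complement in \<open>V\<close> is still
  invariant and, as \<open>dim V \<ge> 2\<close>, nonzero. It yields either a rotation plane or a
  second eigenvector to pair with the first.\<close>

lemma orthogonal_matrix_block_pair:
  fixes A :: "real^'n^'n"
  assumes A: "orthogonal_matrix A"
      and V: "subspace V" "(*v) A ` V \<subseteq> V" "(*v) (transpose A) ` V \<subseteq> V" "dim V \<ge> 2"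
  obtains u w \<epsilon> \<theta> where "u \<in> V" "w \<in> V" "block_pair A \<epsilon> \<theta> u w"
proof -
  have AA: "A *v (transpose A *v x) = x" "transpose A *v (A *v x) = x" for x
    using A by (simp_all add: matrix_vector_mul_assoc orthogonal_matrix_def)
  have "dim V \<ge> 1"
    using V by simp
  from A V(1-3) this show ?thesis
  proof (cases rule: orthogonal_matrix_reduce)
    case (plane u w \<theta>)
    then show ?thesis
      using that[of u w 1 \<theta>] by (simp add: block_pair_def)
  next
    case (eigenvector v \<epsilon>)
    let ?V = "{y \<in> V. \<forall>x\<in>{v}. x \<bullet> y = 0}"
    have \<epsilon>: "\<epsilon> * \<epsilon> = 1"
      using eigenvector by auto
    have v0: "v \<noteq> 0"
      using eigenvector by auto
    have "dim ?V + card {v} = dim V"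
      using eigenvector V v0 by (intro dim_orthogonal_complement_in) (auto simp: pairwise_def)
    then have d: "dim ?V \<ge> 1"
      using V by simp
    have "transpose A *v (A *v v) = \<epsilon> *\<^sub>R (transpose A *v v)"
      by (simp add: eigenvector matrix_vector_mult_scaleR)
    then have "transpose A *v v = \<epsilon> *\<^sub>R v"
      using \<epsilon> by (metis AA(2) scaleR_scaleR scaleR_one)
    then have "(*v) A ` ?V \<subseteq> ?V" "(*v) (transpose A) ` ?V \<subseteq> ?V"
      using V eigenvector by (auto simp: inner_commute[of v] inner_matrix_vector_left)
    from A subspace_orthogonal_complement_in[OF V(1)] this d show ?thesis
    proof (cases rule: orthogonal_matrix_reduce)
      case (plane u w \<theta>)
      then show ?thesis
        using that[of u w 1 \<theta>] by (simp add: block_pair_def)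
    next
      case e': (eigenvector v' \<epsilon>')
      have vv': "v \<bullet> v' = 0" "v' \<bullet> v = 0" "v \<in> V" "v' \<in> V"
        using e' eigenvector by (auto simp: inner_commute)
      consider "\<epsilon> = 1" "\<epsilon>' = 1" | "\<epsilon> = 1" "\<epsilon>' = -1" | "\<epsilon> = -1" "\<epsilon>' = 1" | "\<epsilon> = -1" "\<epsilon>' = -1"
        using e' eigenvector by auto
      then show ?thesis
        \<comment> \<open>Equal eigenvalues give a rotation by 0 or pi. For opposite ones the
          eigenvector for -1 comes first, since \<epsilon> acts on the first vector of a
          pair.\<close>
        using that[of v v' 1 0] that[of v' v "-1" 0] that[of v v' "-1" 0] that[of v v' 1 pi]
          vv' e' eigenvector
        by cases (simp_all add: block_pair_def)
    qed
  qed
qed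

text \<open>The complement of the plane is invariant under \<open>A\<close> because the plane is
  invariant under the transpose, and vice versa. The transpose is the inverse, so its values on
  \<open>u\<close> and \<open>w\<close> are read off from explicit preimages under
  \<open>A\<close>.\<close>

lemma block_pair_complement:
  fixes A :: "real^'n^'n"
  assumes A: "orthogonal_matrix A" and V: "subspace V" "(*v) A ` V \<subseteq> V" "(*v) (transpose A) ` V \<subseteq> V"
    and uw: "u \<in> V" "w \<in> V" "block_pair A \<epsilon> \<theta> u w"
    and W: "W = {y \<in> V. \<forall>x\<in>{u, w}. x \<bullet> y = 0}"
  shows "subspace W" "(*v) A ` W \<subseteq> W" "(*v) (transpose A) ` W \<subseteq> W" "dim W + 2 = dim V"
proof -
  have AA: "transpose A *v (A *v x) = x" for x
    using A by (simp_all add: matrix_vector_mul_assoc orthogonal_matrix_def)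
  have b: "norm u = 1" "norm w = 1" "u \<bullet> w = 0" "\<epsilon> * \<epsilon> = 1"
    and Au: "A *v u = \<epsilon> *\<^sub>R (cos \<theta> *\<^sub>R u - sin \<theta> *\<^sub>R w)" and Aw: "A *v w = sin \<theta> *\<^sub>R u + cos \<theta> *\<^sub>R w"
    using uw by (auto simp: block_pair_def)
  have cs: "cos \<theta> * cos \<theta> + sin \<theta> * sin \<theta> = 1"
    by (metis power2_eq_square sin_cos_squared_add2)
  have "u = A *v ((\<epsilon> * cos \<theta>) *\<^sub>R u + sin \<theta> *\<^sub>R w)"
  proof -
    have "A *v ((\<epsilon> * cos \<theta>) *\<^sub>R u + sin \<theta> *\<^sub>R w) =
        ((\<epsilon> * \<epsilon>) * (cos \<theta> * cos \<theta>) + sin \<theta> * sin \<theta>) *\<^sub>R u + (sin \<theta> * cos \<theta> - (\<epsilon> * \<epsilon>) * (cos \<theta> * sin \<theta>)) *\<^sub>R w"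
      by (simp add: matrix_vector_right_distrib matrix_vector_mult_scaleR Au Aw algebra_simps)
    then show ?thesis
      using b cs by simp
  qed
  then have Tu: "transpose A *v u = (\<epsilon> * cos \<theta>) *\<^sub>R u + sin \<theta> *\<^sub>R w"
    by (metis AA)
  have "w = A *v ((- \<epsilon> * sin \<theta>) *\<^sub>R u + cos \<theta> *\<^sub>R w)"
  proof -
    have "A *v ((- \<epsilon> * sin \<theta>) *\<^sub>R u + cos \<theta> *\<^sub>R w) =
        (sin \<theta> * cos \<theta> - (\<epsilon> * \<epsilon>) * (cos \<theta> * sin \<theta>)) *\<^sub>R u + (cos \<theta> * cos \<theta> + (\<epsilon> * \<epsilon>) * (sin \<theta> * sin \<theta>)) *\<^sub>R w"
      by (simp add: matrix_vector_right_distrib matrix_vector_mult_scaleR Au Aw vec_eq_iff algebra_simps)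
    then show ?thesis
      using b cs by simp
  qed
  then have Tw: "transpose A *v w = (- \<epsilon> * sin \<theta>) *\<^sub>R u + cos \<theta> *\<^sub>R w"
    by (metis AA)
  show "subspace W"
    unfolding W using V(1) by (rule subspace_orthogonal_complement_in)
  have W': "y \<in> W \<longleftrightarrow> y \<in> V \<and> y \<bullet> u = 0 \<and> y \<bullet> w = 0" for y
    by (auto simp: W inner_commute)
  have "(A *v y) \<bullet> u = 0" "(A *v y) \<bullet> w = 0" "(transpose A *v y) \<bullet> u = 0" "(transpose A *v y) \<bullet> w = 0"
    if "y \<bullet> u = 0" "y \<bullet> w = 0" for y
    using that by (simp_all add: inner_matrix_vector_left Tu Tw Au Aw inner_simps)
  then show "(*v) A ` W \<subseteq> W" "(*v) (transpose A) ` W \<subseteq> W"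
    using V(2,3) by (auto simp: W' image_subset_iff)
  have "u \<noteq> w"
    using b by (auto simp: dot_square_norm)
  moreover have "dim W + card {u, w} = dim V"
    unfolding W using V(1) uw(1,2) b by (intro dim_orthogonal_complement_in)
        (auto simp: pairwise_def orthogonal_def inner_commute)
  ultimately show "dim W + 2 = dim V"
    by simp
qed

definition frame6 :: "real^6^6 \<Rightarrow> real^3 \<Rightarrow> real^3 \<Rightarrow> (6 \<Rightarrow> real^6) \<Rightarrow> bool" where
  "frame6 A \<epsilon> \<theta> h \<longleftrightarrow> (\<forall>i j. h i \<bullet> h j = (if i = j then 1 else 0)) \<and>
     block_pair A (\<epsilon> $ 1) (\<theta> $ 1) (h 1) (h 2) \<and> block_pair A (\<epsilon> $ 2) (\<theta> $ 2) (h 3) (h 4) \<and>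
     block_pair A (\<epsilon> $ 3) (\<theta> $ 3) (h 5) (h 6)"

text \<open>Collects the signs that \<open>block_pair\<close> puts on the first vector of each pair;
  \<open>rot6 \<theta> ** reflect6 \<epsilon>\<close> is the matrix of \<open>A\<close> in a
  frame.\<close>

definition reflect6 :: "real^3 \<Rightarrow> real^6^6" where
  "reflect6 \<epsilon> = (\<chi> i j. if i \<noteq> j then 0 else if i = 1 then \<epsilon> $ 1 else if i = 3 then \<epsilon> $ 2
      else if i = 5 then \<epsilon> $ 3 else 1)"

lemma det_reflect6: "det (reflect6 \<epsilon>) = \<epsilon> $ 1 * \<epsilon> $ 2 * \<epsilon> $ 3"
  by (subst det_diagonal) (simp_all add: reflect6_def prod_6)

lemma reflect6_one: "reflect6 1 = mat 1"
  by (simp add: reflect6_def mat_def vec_eq_iff)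

lemma transpose_reflect6: "transpose (reflect6 \<epsilon>) = reflect6 \<epsilon>"
  by (simp add: reflect6_def transpose_def vec_eq_iff)

lemma reflect6_mult: "reflect6 \<epsilon> ** reflect6 \<delta> = reflect6 (\<epsilon> * \<delta>)"
  unfolding vec_eq_iff forall_6 by (simp add: matrix_matrix_mult_def sum_6 reflect6_def)

lemma reflect6_rot6:
  "reflect6 (- 1) ** rot6 \<theta> = rot6 (- \<theta>) ** reflect6 (- 1)"
  unfolding vec_eq_iff forall_6
  by (simp add: matrix_matrix_mult_def sum_6 reflect6_def rot6_def block6_def)

lemma frame6_conj:
  assumes "frame6 A \<epsilon> \<theta> h"
  shows "\<exists>S. orthogonal_matrix S \<and> A = S ** (rot6 \<theta> ** reflect6 \<epsilon>) ** transpose S"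
proof (intro exI conjI)
  let ?S = "\<chi> i j. h j $ i"
  show S: "orthogonal_matrix ?S"
    using assms by (intro orthogonal_matrix_columns) (simp add: frame6_def)
  have "A ** ?S = ?S ** (rot6 \<theta> ** reflect6 \<epsilon>)"
  proof -
    have Ah: "A *v h 1 = \<epsilon> $ 1 *\<^sub>R (cos (\<theta> $ 1) *\<^sub>R h 1 - sin (\<theta> $ 1) *\<^sub>R h 2)"
      "A *v h 2 = sin (\<theta> $ 1) *\<^sub>R h 1 + cos (\<theta> $ 1) *\<^sub>R h 2"
      "A *v h 3 = \<epsilon> $ 2 *\<^sub>R (cos (\<theta> $ 2) *\<^sub>R h 3 - sin (\<theta> $ 2) *\<^sub>R h 4)"
      "A *v h 4 = sin (\<theta> $ 2) *\<^sub>R h 3 + cos (\<theta> $ 2) *\<^sub>R h 4"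
      "A *v h 5 = \<epsilon> $ 3 *\<^sub>R (cos (\<theta> $ 3) *\<^sub>R h 5 - sin (\<theta> $ 3) *\<^sub>R h 6)"
      "A *v h 6 = sin (\<theta> $ 3) *\<^sub>R h 5 + cos (\<theta> $ 3) *\<^sub>R h 6"
      using assms unfolding frame6_def block_pair_def by blast+
    have "(A ** ?S) $ i $ j = (A *v h j) $ i" for i j
      by (simp add: matrix_mult_column)
    moreover have "\<forall>j. (A *v h j) $ i = (?S ** (rot6 \<theta> ** reflect6 \<epsilon>)) $ i $ j" for i
      unfolding forall_6 Ah
      by (simp add: matrix_matrix_mult_def sum_6 reflect6_def rot6_def block6_def algebra_simps)
    ultimately show ?thesis
      by (simp add: vec_eq_iff)
  qed
  then show "A = ?S ** (rot6 \<theta> ** reflect6 \<epsilon>) ** transpose ?S"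
    using S by (metis matrix_mul_assoc matrix_mul_rid orthogonal_matrix_def)
qed

lemma frame6_exists:
  assumes A: "orthogonal_matrix A"
  shows "\<exists>\<epsilon> \<theta> h. frame6 A \<epsilon> \<theta> h"
proof -
  have V0: "subspace UNIV" "(*v) A ` UNIV \<subseteq> UNIV" "(*v) (transpose A) ` UNIV \<subseteq> UNIV"
    "dim (UNIV :: (real^6) set) = 6"
    by auto
  then have "dim (UNIV :: (real^6) set) \<ge> 2"
    by simp
  then obtain u1 w1 \<epsilon>1 \<theta>1 where 1: "u1 \<in> UNIV" "w1 \<in> UNIV" "block_pair A \<epsilon>1 \<theta>1 u1 w1"
    using orthogonal_matrix_block_pair[OF A V0(1-3)] by metis
  define W1 where "W1 = {y \<in> UNIV. \<forall>x\<in>{u1, w1}. x \<bullet> y = 0}"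
  note V1 = block_pair_complement[OF A V0(1-3) 1 W1_def]
  have "dim W1 \<ge> 2"
    using V1(4) V0(4) by simp
  then obtain u2 w2 \<epsilon>2 \<theta>2 where 2: "u2 \<in> W1" "w2 \<in> W1" "block_pair A \<epsilon>2 \<theta>2 u2 w2"
    using orthogonal_matrix_block_pair[OF A V1(1-3)] by metis
  define W2 where "W2 = {y \<in> W1. \<forall>x\<in>{u2, w2}. x \<bullet> y = 0}"
  note V2 = block_pair_complement[OF A V1(1-3) 2 W2_def]
  have "dim W2 \<ge> 2"
    using V2(4) V1(4) V0(4) by simp
  then obtain u3 w3 \<epsilon>3 \<theta>3 where 3: "u3 \<in> W2" "w3 \<in> W2" "block_pair A \<epsilon>3 \<theta>3 u3 w3"
    using orthogonal_matrix_block_pair[OF A V2(1-3)] by metis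
  define h where "h = (\<lambda>i :: 6. if i = 1 then u1 else if i = 2 then w1 else if i = 3 then u2
    else if i = 4 then w2 else if i = 5 then u3 else w3)"
  have orth: "x \<bullet> y = 0" "y \<bullet> x = 0" if "x \<in> {u1, w1}" "y \<in> {u2, w2, u3, w3}" for x y
    using that 2 3 by (auto simp: W1_def W2_def inner_commute)
  have orth': "x \<bullet> y = 0" "y \<bullet> x = 0" if "x \<in> {u2, w2}" "y \<in> {u3, w3}" for x y
    using that 3 by (auto simp: W2_def inner_commute)
  have n: "u \<bullet> u = 1 \<and> w \<bullet> w = 1 \<and> u \<bullet> w = 0 \<and> w \<bullet> u = 0" if "block_pair A \<epsilon> \<theta> u w" for \<epsilon> \<theta> u w
    using that by (auto simp: block_pair_def dot_square_norm inner_commute)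
  have "\<forall>i j. h i \<bullet> h j = (if i = j then 1 else 0)"
    unfolding forall_6 using n[OF 1(3)] n[OF 2(3)] n[OF 3(3)] by (simp add: h_def orth orth')
  then have "frame6 A (vector [\<epsilon>1, \<epsilon>2, \<epsilon>3]) (vector [\<theta>1, \<theta>2, \<theta>3]) h"
    using 1 2 3 unfolding frame6_def vector_3 by (simp add: h_def)
  then show ?thesis
    by blast
qed

text \<open>Determinant 1 forces the number of reflection blocks to be 0 or 2. Two of them have
  eigenvalues -1, 1 and -1, 1; exchanging one basis vector regroups these into -1, -1 and 1, 1, that
  is, rotations by pi and 0.\<close>

lemma frame6_rotation:
  assumes A: "rotation_matrix A"
  shows "\<exists>\<theta> h. frame6 A 1 \<theta> h"
proof -
  obtain \<epsilon> \<theta> h where f: "frame6 A \<epsilon> \<theta> h"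
    using frame6_exists[of A] A unfolding rotation_matrix_def by blast
  then obtain S where S: "orthogonal_matrix S" "A = S ** (rot6 \<theta> ** reflect6 \<epsilon>) ** transpose S"
    using frame6_conj by blast
  have "det S * det S = 1"
    using det_orthogonal_matrix[OF S(1)] by auto
  moreover have "det A = (det S * det S) * (\<epsilon> $ 1 * \<epsilon> $ 2 * \<epsilon> $ 3)"
    unfolding S(2) by (simp add: det_mul det_rot6 det_reflect6)
  ultimately have \<epsilon>: "\<epsilon> $ 1 * \<epsilon> $ 2 * \<epsilon> $ 3 = 1"
    using A by (simp add: rotation_matrix_def)
  have b: "block_pair A (\<epsilon> $ 1) (\<theta> $ 1) (h 1) (h 2)" "block_pair A (\<epsilon> $ 2) (\<theta> $ 2) (h 3) (h 4)"
     "block_pair A (\<epsilon> $ 3) (\<theta> $ 3) (h 5) (h 6)" and h: "h i \<bullet> h j = (if i = j then 1 else 0)" for i j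
    using f by (simp_all add: frame6_def)
  have "\<epsilon> $ k = 1 \<or> \<epsilon> $ k = - 1 \<and> \<theta> $ k = 0" for k
    using b exhaust_3[of k] by (auto simp: block_pair_def)
  from this[of 1] this[of 2] this[of 3] \<epsilon> consider "\<epsilon> $ 1 = 1" "\<epsilon> $ 2 = 1" "\<epsilon> $ 3 = 1"
    | "\<epsilon> $ 1 = 1" "\<epsilon> $ 2 = - 1" "\<epsilon> $ 3 = - 1" "\<theta> $ 2 = 0" "\<theta> $ 3 = 0"
    | "\<epsilon> $ 1 = - 1" "\<epsilon> $ 2 = 1" "\<epsilon> $ 3 = - 1" "\<theta> $ 1 = 0" "\<theta> $ 3 = 0"
    | "\<epsilon> $ 1 = - 1" "\<epsilon> $ 2 = - 1" "\<epsilon> $ 3 = 1" "\<theta> $ 1 = 0" "\<theta> $ 2 = 0"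
    by auto
  moreover have swap: "frame6 A 1 \<theta>' (h \<circ> Transposition.transpose i j)"
    if "block_pair A 1 (\<theta>' $ 1) ((h \<circ> Transposition.transpose i j) 1) ((h \<circ> Transposition.transpose i j) 2)"
     "block_pair A 1 (\<theta>' $ 2) ((h \<circ> Transposition.transpose i j) 3) ((h \<circ> Transposition.transpose i j) 4)"
     "block_pair A 1 (\<theta>' $ 3) ((h \<circ> Transposition.transpose i j) 5) ((h \<circ> Transposition.transpose i j) 6)"
    for \<theta>' :: "real^3" and i j
    using that unfolding frame6_def by (auto simp: h) (metis transpose_involutory)
  ultimately show ?thesis
  proof cases
    case 1
    then have "frame6 A 1 \<theta> h"
      using b h by (simp add: frame6_def)
    then show ?thesis
      by blast
  next
    case 2
    then have "frame6 A 1 (vector [\<theta> $ 1, pi, 0]) (h \<circ> Transposition.transpose 4 5)"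
      using b by (intro swap) (auto simp: vector_3 block_pair_def Transposition.transpose_def h)
    then show ?thesis
      by blast
  next
    case 3
    then have "frame6 A 1 (vector [pi, \<theta> $ 2, 0]) (h \<circ> Transposition.transpose 2 5)"
      using b by (intro swap) (auto simp: vector_3 block_pair_def Transposition.transpose_def h)
    then show ?thesis
      by blast
  next
    case 4
    then have "frame6 A 1 (vector [pi, 0, \<theta> $ 3]) (h \<circ> Transposition.transpose 2 3)"
      using b by (intro swap) (auto simp: vector_3 block_pair_def Transposition.transpose_def h)
    then show ?thesis
      by blast
  qed
qed

text \<open>A frame of the wrong orientation is corrected by reflecting one axis in each of the
  three blocks. This has determinant -1 and negates all three angles, which stays within the
  torus.\<close>

lemma rotation_matrix_torus:
  assumes A: "rotation_matrix A"
  obtains S \<theta> where "rotation_matrix S" "A = S ** rot6 \<theta> ** transpose S"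
proof -
  obtain S \<theta> where S: "orthogonal_matrix S" "A = S ** rot6 \<theta> ** transpose S"
    using frame6_rotation[OF A] frame6_conj by (metis reflect6_one matrix_mul_rid)
  show ?thesis
  proof (cases "det S = 1")
    case True
    then show ?thesis
      using that S by (simp add: rotation_matrix_def)
  next
    case False
    let ?F = "reflect6 (- 1)"
    have F: "?F ** ?F = mat 1"
      by (simp add: reflect6_mult reflect6_one)
    have "orthogonal_matrix ?F"
      unfolding orthogonal_matrix transpose_reflect6 by (rule F)
    moreover have "det S = - 1"
      using False det_orthogonal_matrix[OF S(1)] by blast
    ultimately have "rotation_matrix (S ** ?F)"
      using S by (simp add: rotation_matrix_def orthogonal_matrix_mul det_mul det_reflect6)
    moreover have "(S ** ?F) ** rot6 (- \<theta>) ** transpose (S ** ?F)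
        = S ** rot6 \<theta> ** (?F ** ?F) ** transpose S"
      using reflect6_rot6[of "- \<theta>"]
      by (simp add: matrix_transpose_mul transpose_reflect6 flip: matrix_mul_assoc)
    ultimately show ?thesis
      using that[of "S ** ?F" "- \<theta>"] S(2) F by simp
  qed
qed

section \<open>Moduli classes\<close>

abbreviation cmat :: "real^4^4 \<Rightarrow> complex^4^4" where
  "cmat \<equiv> map_matrix complex_of_real"

definition phase :: "real \<Rightarrow> complex^4^4 \<Rightarrow> complex^4^4" where
  "phase t = map_matrix ((*) (exp (- 2 * \<i> * complex_of_real t)))"

text \<open>All four phases are free, so that permuting the entries and multiplying by a common
  phase stay within the family; \<open>diag_phase\<close> is the slice with first phase 0.\<close>

definition diag_exp :: "real^4 \<Rightarrow> complex^4^4" where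
  "diag_exp x = (\<chi> i j. if i = j then exp (- 2 * \<i> * complex_of_real (x $ i)) else 0)"

lemma cmat_mult: "cmat (A ** B) = cmat A ** cmat B"
  by (simp add: vec_eq_iff matrix_matrix_mult_def)

lemma cmat_transpose: "cmat (transpose A) = transpose (cmat A)"
  by (simp add: vec_eq_iff transpose_def)

lemma cmat_one: "cmat (mat 1) = mat 1"
  by (simp add: vec_eq_iff mat_def)

lemma phase_mult: "phase t A ** B = phase t (A ** B)" "A ** phase t B = phase t (A ** B)"
  by (simp_all add: phase_def vec_eq_iff matrix_matrix_mult_def sum_distrib_left mult_ac)

lemma phase_phase: "phase s (phase t A) = phase (s + t) A"
  by (simp add: phase_def vec_eq_iff ring_distribs flip: mult.assoc exp_add)

lemma phase_0: "phase 0 A = A"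
  by (simp add: phase_def vec_eq_iff)

lemma phase_diag_exp: "phase t (diag_exp x) = diag_exp (\<chi> i. x $ i + t)"
  by (simp add: phase_def vec_eq_iff diag_exp_def ring_distribs add.commute flip: exp_add)

lemma moduli_class_iff:
  "M \<in> moduli_class \<Lambda> \<longleftrightarrow>
     (\<exists>t S. rotation_matrix S \<and> M = phase t (cmat S ** \<Lambda> ** transpose (cmat S)))"
  unfolding moduli_class_def phase_def by blast

lemma moduli_class_refl: "\<Lambda> \<in> moduli_class \<Lambda>"
  unfolding moduli_class_iff
  by (rule exI[of _ 0], rule exI[of _ "mat 1"])
    (simp add: phase_0 cmat_one rotation_matrix_def orthogonal_matrix_id)

lemma moduli_class_mono:
  assumes "M \<in> moduli_class \<Lambda>"
  shows "moduli_class M \<subseteq> moduli_class \<Lambda>"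
proof
  fix N assume "N \<in> moduli_class M"
  then obtain t S where S: "rotation_matrix S" "N = phase t (cmat S ** M ** transpose (cmat S))"
    by (auto simp: moduli_class_iff)
  obtain s R where R: "rotation_matrix R" "M = phase s (cmat R ** \<Lambda> ** transpose (cmat R))"
    using assms by (auto simp: moduli_class_iff)
  have "N = phase (t + s) (cmat (S ** R) ** \<Lambda> ** transpose (cmat (S ** R)))"
    unfolding S(2) R(2)
    by (simp add: phase_mult phase_phase cmat_mult matrix_transpose_mul matrix_mul_assoc)
  moreover have "rotation_matrix (S ** R)"
    using S R by (simp add: rotation_matrix_def orthogonal_matrix_mul det_mul)
  ultimately show "N \<in> moduli_class \<Lambda>"
    unfolding moduli_class_iff by blast
qed

lemma moduli_class_sym:
  assumes "M \<in> moduli_class \<Lambda>"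
  shows "\<Lambda> \<in> moduli_class M"
proof -
  obtain t S where S: "rotation_matrix S" "M = phase t (cmat S ** \<Lambda> ** transpose (cmat S))"
    using assms by (auto simp: moduli_class_iff)
  have "transpose (cmat S) ** cmat S = mat 1"
    unfolding cmat_transpose[symmetric] cmat_mult[symmetric]
    using S by (simp add: rotation_matrix_def orthogonal_matrix cmat_one)
  then have "\<Lambda> = phase (- t) (cmat (transpose S) ** M ** transpose (cmat (transpose S)))"
    unfolding S(2) phase_mult phase_phase cmat_transpose transpose_transpose
    by (simp add: phase_0 matrix_mul_assoc) (simp flip: matrix_mul_assoc)
  moreover have "rotation_matrix (transpose S)"
    using S by (simp add: rotation_matrix_def orthogonal_matrix_transpose)
  ultimately show ?thesis
    unfolding moduli_class_iff by blast
qed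

lemma moduli_class_eq_iff: "moduli_class M = moduli_class \<Lambda> \<longleftrightarrow> M \<in> moduli_class \<Lambda>"
  using moduli_class_refl moduli_class_mono moduli_class_sym by blast

definition reflect4 :: "real^4^4" where
  "reflect4 = (\<chi> i j. if i \<noteq> j then 0 else if i = 1 then - 1 else 1)"

lemma prod_4: "prod f (UNIV :: 4 set) = f 1 * f 2 * f 3 * f 4"
  unfolding UNIV_4 by (simp add: ac_simps)

lemma reflect4: "orthogonal_matrix reflect4" "det reflect4 = - 1"
  "cmat reflect4 ** diag_exp x ** transpose (cmat reflect4) = diag_exp x"
proof -
  show "orthogonal_matrix reflect4"
    unfolding orthogonal_matrix vec_eq_iff forall_4
    by (simp add: matrix_matrix_mult_def transpose_def sum_4 mat_def reflect4_def)
  show "det reflect4 = - 1"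
    by (subst det_diagonal) (simp_all add: reflect4_def prod_4)
  show "cmat reflect4 ** diag_exp x ** transpose (cmat reflect4) = diag_exp x"
    unfolding vec_eq_iff forall_4
    by (simp add: matrix_matrix_mult_def transpose_def sum_4 reflect4_def diag_exp_def)
qed

text \<open>Diagonal matrices are fixed under conjugation by \<open>reflect4\<close>, which has
  determinant -1, so they have the same orbits under O(4) and SO(4).\<close>

lemma rotation_conj_diag_exp:
  assumes S: "orthogonal_matrix S"
  obtains R where "rotation_matrix R"
    "cmat R ** diag_exp x ** transpose (cmat R) = cmat S ** diag_exp x ** transpose (cmat S)"
proof (cases "det S = 1")
  case True
  then show ?thesis
    using that S by (simp add: rotation_matrix_def)
next
  case False
  then have "det S = - 1"
    using det_orthogonal_matrix[OF S] by blast
  then have "rotation_matrix (S ** reflect4)"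
    using S by (simp add: rotation_matrix_def orthogonal_matrix_mul det_mul reflect4)
  moreover have "cmat (S ** reflect4) ** diag_exp x ** transpose (cmat (S ** reflect4)) =
      cmat S ** (cmat reflect4 ** diag_exp x ** transpose (cmat reflect4)) ** transpose (cmat S)"
    by (simp add: cmat_mult matrix_transpose_mul matrix_mul_assoc)
  ultimately show ?thesis
    using that by (simp add: reflect4)
qed

lemma invertible_matrix_inv:
  assumes "invertible A"
  shows "A ** matrix_inv A = mat 1" "matrix_inv A ** A = mat 1"
  using assms someI_ex[of "\<lambda>B. A ** B = mat 1 \<and> B ** A = mat 1"]
  unfolding invertible_def matrix_inv_def by blast+

lemma sym_unitary_iff:
  "\<Lambda> \<in> sym_unitary \<longleftrightarrow> \<Lambda> = transpose \<Lambda> \<and> \<Lambda> ** map_matrix cnj \<Lambda> = mat 1"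
proof
  assume "\<Lambda> \<in> sym_unitary"
  then show "\<Lambda> = transpose \<Lambda> \<and> \<Lambda> ** map_matrix cnj \<Lambda> = mat 1"
    using invertible_matrix_inv(1)[of \<Lambda>] unfolding sym_unitary_def by auto
next
  assume \<Lambda>: "\<Lambda> = transpose \<Lambda> \<and> \<Lambda> ** map_matrix cnj \<Lambda> = mat 1"
  then have inv: "\<Lambda> ** map_matrix cnj \<Lambda> = mat 1" "map_matrix cnj \<Lambda> ** \<Lambda> = mat 1"
    using matrix_left_right_inverse by auto
  then have I: "invertible \<Lambda>"
    unfolding invertible_def by blast
  then have "matrix_inv \<Lambda> = (map_matrix cnj \<Lambda> ** \<Lambda>) ** matrix_inv \<Lambda>"
    by (simp add: inv)
  also have "\<dots> = map_matrix cnj \<Lambda>"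
    using invertible_matrix_inv[OF I] by (simp flip: matrix_mul_assoc)
  finally show "\<Lambda> \<in> sym_unitary"
    using \<Lambda> I unfolding sym_unitary_def by simp
qed

lemma sym_unitary_diagonalization:
  assumes "\<Lambda> \<in> sym_unitary"
  obtains R x where "rotation_matrix R" "\<Lambda> = cmat R ** diag_exp x ** transpose (cmat R)"
proof -
  have \<Lambda>: "\<Lambda> = transpose \<Lambda>" "\<Lambda> ** map_matrix cnj \<Lambda> = mat 1"
    using assms unfolding sym_unitary_iff by auto
  have sym: "\<Lambda> $ i $ j = \<Lambda> $ j $ i" for i j
    using arg_cong[OF \<Lambda>(1), of "\<lambda>M. M $ i $ j"] by (simp add: transpose_def)
  have un: "(\<Lambda> ** map_matrix cnj \<Lambda>) $ i $ j = mat 1 $ i $ j" for i j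
    by (simp only: \<Lambda>(2))
  define X Y where "X = map_matrix Re \<Lambda>" and "Y = map_matrix Im \<Lambda>"
  \<comment> \<open>The real and imaginary parts of
    \<open>\<Lambda> ** map_matrix cnj \<Lambda> = mat 1\<close>.\<close>
  have XY: "X ** X + Y ** Y = mat 1" "X ** Y = Y ** X"
  proof -
    have "(X ** X + Y ** Y) $ i $ j = mat 1 $ i $ j" for i j
      using arg_cong[OF un[of i j], of Re]
      by (simp add: X_def Y_def matrix_matrix_mult_def mat_def sum.distrib split: if_splits)
    then show "X ** X + Y ** Y = mat 1"
      unfolding vec_eq_iff by blast
    have "(X ** Y) $ i $ j = (Y ** X) $ i $ j" for i j
      using arg_cong[OF un[of i j], of Im]
      by (simp add: X_def Y_def matrix_matrix_mult_def mat_def sum_subtractf sum.distrib sum_negf split: if_splits)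
    then show "X ** Y = Y ** X"
      unfolding vec_eq_iff by blast
  qed
  have tr: "transpose X = X" "transpose Y = Y"
    unfolding vec_eq_iff transpose_def X_def Y_def using sym by simp_all
  obtain S a b where S: "orthogonal_matrix S"
    "X ** S = S ** (\<chi> i j. if i = j then a i else 0)" "Y ** S = S ** (\<chi> i j. if i = j then b i else 0)"
    by (rule simultaneous_diagonalization[OF tr XY(2)])
  let ?a = "\<chi> i j. if i = j then a i else 0" and ?b = "\<chi> i j. if i = j then b i else 0"
  \<comment> \<open>Transports the real part of unitarity to the eigenvalues: \<open>a i\<close> and
    \<open>b i\<close> are the coordinates of a point on the unit circle.\<close>
  have "S = (X ** X + Y ** Y) ** S"
    by (simp add: XY)
  also have "\<dots> = X ** (X ** S) + Y ** (Y ** S)"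
    unfolding matrix_mul_assoc
    by (simp add: matrix_matrix_mult_def vec_eq_iff ring_distribs sum.distrib)
  also have "\<dots> = (X ** S) ** ?a + (Y ** S) ** ?b"
    by (simp only: S matrix_mul_assoc)
  also have "\<dots> = S ** (?a ** ?a + ?b ** ?b)"
    by (simp only: S matrix_add_ldistrib matrix_mul_assoc)
  finally have "transpose S ** S = transpose S ** (S ** (?a ** ?a + ?b ** ?b))"
    by (rule arg_cong)
  then have "?a ** ?a + ?b ** ?b = mat 1"
    using S(1) unfolding matrix_mul_assoc by (simp only: orthogonal_matrix matrix_mul_lid)
  then have "(?a ** ?a + ?b ** ?b) $ i $ i = mat 1 $ i $ i" for i
    by (rule arg_cong)
  then have ab: "(a i)\<^sup>2 + (b i)\<^sup>2 = 1" for i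
    by (simp add: matrix_matrix_mult_def mat_def power2_eq_square if_distrib[of "\<lambda>x. _ * x"]
        cong: if_cong)
  have "\<forall>i. \<exists>x. a i = cos x \<and> b i = sin x"
    using sincos_total_2pi[OF ab] by metis
  then obtain y where y: "\<And>i. a i = cos (y i)" "\<And>i. b i = sin (y i)"
    unfolding choice_iff by blast
  \<comment> \<open>Undoes the factor -2 in the exponent of \<open>diag_exp\<close>.\<close>
  define x :: "real^4" where "x = (\<chi> i. - y i / 2)"
  have e: "exp (- 2 * \<i> * complex_of_real (x $ i)) = Complex (a i) (b i)" for i
    by (simp add: x_def y complex_eq_iff Re_exp Im_exp)
  have "(\<Lambda> ** cmat S) $ i $ j = (cmat S ** diag_exp x) $ i $ j" for i j
  proof -
    have "(X ** S) $ i $ j = S $ i $ j * a j" "(Y ** S) $ i $ j = S $ i $ j * b j"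
      unfolding S by (simp_all add: matrix_matrix_mult_def if_distrib[of "\<lambda>x. _ * x"] cong: if_cong)
    moreover have "(cmat S ** diag_exp x) $ i $ j = of_real (S $ i $ j) * Complex (a j) (b j)"
      unfolding diag_exp_def e by (simp add: matrix_matrix_mult_def if_distrib[of "\<lambda>x. _ * x"]
          cong: if_cong)
    ultimately show ?thesis
      by (simp add: complex_eq_iff matrix_matrix_mult_def X_def Y_def)
  qed
  then have "\<Lambda> ** cmat S = cmat S ** diag_exp x"
    unfolding vec_eq_iff by blast
  moreover have "cmat S ** transpose (cmat S) = mat 1"
    unfolding cmat_transpose[symmetric] cmat_mult[symmetric]
    using S(1) by (simp add: orthogonal_matrix_def cmat_one)
  ultimately have "\<Lambda> = cmat S ** diag_exp x ** transpose (cmat S)"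
    by (metis matrix_mul_assoc matrix_mul_rid)
  then show ?thesis
    using rotation_conj_diag_exp[OF S(1), of x] that by metis
qed

lemma conj_diag_exp_in_sym_unitary:
  assumes "rotation_matrix R"
  shows "cmat R ** diag_exp x ** transpose (cmat R) \<in> sym_unitary"
proof -
  have t: "transpose (diag_exp x) = diag_exp x"
    by (simp add: vec_eq_iff transpose_def diag_exp_def)
  have "exp (- 2 * \<i> * complex_of_real t) * cnj (exp (- 2 * \<i> * complex_of_real t)) = 1" for t
    by (simp add: exp_cnj flip: exp_add)
  then have u: "diag_exp x ** map_matrix cnj (diag_exp x) = mat 1"
    by (simp add: vec_eq_iff diag_exp_def matrix_matrix_mult_def mat_def if_distrib[of
        "\<lambda>x. _ * x"] if_distrib[of cnj] cong: if_cong)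
  have c: "map_matrix cnj (A ** B) = map_matrix cnj A ** map_matrix cnj B" for A B :: "complex^4^4"
    by (simp add: vec_eq_iff matrix_matrix_mult_def)
  have r: "map_matrix cnj (cmat R) = cmat R" "map_matrix cnj (transpose (cmat R)) = transpose (cmat R)"
    by (simp_all add: vec_eq_iff transpose_def)
  have R: "transpose (cmat R) ** cmat R = mat 1" "cmat R ** transpose (cmat R) = mat 1"
    unfolding cmat_transpose[symmetric] cmat_mult[symmetric]
    using assms by (simp_all add: rotation_matrix_def orthogonal_matrix_def cmat_one)
  have "cmat R ** diag_exp x ** transpose (cmat R)
      ** (cmat R ** map_matrix cnj (diag_exp x) ** transpose (cmat R))
     = cmat R ** (diag_exp x ** (transpose (cmat R) ** cmat R) ** map_matrix cnj (diag_exp x)) ** transpose (cmat R)"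
    by (simp add: matrix_mul_assoc)
  then show ?thesis
    unfolding sym_unitary_iff by (simp add: c r R u t matrix_transpose_mul) (simp add: matrix_mul_assoc)
qed

section \<open>Conjugacy classes of the torus\<close>

lemma SO6_simps:
  "carrier SO6 = {A. rotation_matrix A}" "A \<otimes>\<^bsub>SO6\<^esub> B = A ** B" "\<one>\<^bsub>SO6\<^esub> = mat 1"
  by (simp_all add: SO6_def)

lemma PSO6_class_eq: "PSO6_class A = {A, - A}"
  by (auto simp: PSO6_class_def r_coset_def SO6_simps minus_one_matrix_mult)

lemma PSO6_class_eq_iff: "PSO6_class A = PSO6_class B \<longleftrightarrow> A = B \<or> A = - B"
  by (auto simp: PSO6_class_eq doubleton_eq_iff)

lemma matrix_mult_minus:
  fixes A B :: "real^6^6"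
  shows "- A ** B = - (A ** B)" "A ** - B = - (A ** B)"
  by (simp_all add: vec_eq_iff matrix_matrix_mult_def sum_negf)

lemma carrier_PSO6: "carrier PSO6 = PSO6_class ` {A. rotation_matrix A}"
  by (auto simp: PSO6_def FactGroup_def RCOSETS_def PSO6_class_def SO6_simps)

lemma PSO6_class_mult: "PSO6_class A \<otimes>\<^bsub>PSO6\<^esub> PSO6_class B = PSO6_class (A ** B)"
  by (auto simp: PSO6_def FactGroup_def set_mult_def PSO6_class_eq SO6_simps matrix_mult_minus)

lemma rotation_matrix_mult: "rotation_matrix A \<Longrightarrow> rotation_matrix B \<Longrightarrow> rotation_matrix (A ** B)"
  for A B :: "real^'n^'n"
  by (simp add: rotation_matrix_def orthogonal_matrix_mul det_mul)

lemma rotation_matrix_transpose: "rotation_matrix A \<Longrightarrow> rotation_matrix (transpose A)"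
  for A :: "real^'n^'n"
  by (simp add: rotation_matrix_def orthogonal_matrix_transpose)

lemma rotation_matrix_cancel:
  fixes S :: "real^'n^'n"
  assumes "rotation_matrix S" shows "S ** transpose S = mat 1" "transpose S ** S = mat 1"
  using assms by (simp_all add: rotation_matrix_def orthogonal_matrix_def)

lemma PSO6_class_inv:
  assumes "rotation_matrix S"
  shows "inv\<^bsub>PSO6\<^esub> (PSO6_class S) = PSO6_class (transpose S)"
proof (rule group.inv_equality[OF PSO6_group])
  have "\<one>\<^bsub>PSO6\<^esub> = PSO6_class (mat 1)"
    by (simp add: PSO6_def FactGroup_def PSO6_class_eq)
  then show "PSO6_class (transpose S) \<otimes>\<^bsub>PSO6\<^esub> PSO6_class S = \<one>\<^bsub>PSO6\<^esub>"
    using assms by (simp add: PSO6_class_mult rotation_matrix_cancel)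
qed (use assms in \<open>auto simp: carrier_PSO6 rotation_matrix_transpose\<close>)

lemma PSO6_conj_class_eq:
  "PSO6_conj_class (PSO6_class A) = {PSO6_class (S ** A ** transpose S) | S. rotation_matrix S}"
  unfolding PSO6_conj_class_def orbit_def carrier_PSO6
  by (auto simp: PSO6_class_mult PSO6_class_inv)
    (metis (no_types, lifting) PSO6_class_mult PSO6_class_inv imageI mem_Collect_eq)

lemma PSO6_conj_class_eq_iff:
  "PSO6_conj_class (PSO6_class A) = PSO6_conj_class (PSO6_class B) \<longleftrightarrow>
     (\<exists>S. rotation_matrix S \<and> (B = S ** A ** transpose S \<or> B = - (S ** A ** transpose S)))"
proof -
  have sub: "PSO6_conj_class (PSO6_class B) \<subseteq> PSO6_conj_class (PSO6_class A)"
    if S: "rotation_matrix S" "PSO6_class B = PSO6_class (S ** A ** transpose S)" for A B S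
  proof -
    have "PSO6_class (R ** B ** transpose R) = PSO6_class ((R ** S) ** A ** transpose (R ** S))" for R
      using S(2) unfolding PSO6_class_eq_iff
      by (auto simp: matrix_transpose_mul matrix_mul_assoc matrix_mult_minus)
    then show ?thesis
      unfolding PSO6_conj_class_eq using rotation_matrix_mult[OF _ S(1)] by blast
  qed
  have "PSO6_conj_class (PSO6_class A) = PSO6_conj_class (PSO6_class B) \<longleftrightarrow>
     (\<exists>S. rotation_matrix S \<and> PSO6_class B = PSO6_class (S ** A ** transpose S))"
  proof
    have "rotation_matrix (mat 1 :: real^6^6)"
        "PSO6_class B = PSO6_class (mat 1 ** B ** transpose (mat 1))"
      by (simp_all add: rotation_matrix_def orthogonal_matrix_id)
    then have "PSO6_class B \<in> PSO6_conj_class (PSO6_class B)"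
      unfolding PSO6_conj_class_eq by blast
    moreover assume "PSO6_conj_class (PSO6_class A) = PSO6_conj_class (PSO6_class B)"
    ultimately show "\<exists>S. rotation_matrix S \<and> PSO6_class B = PSO6_class (S ** A ** transpose S)"
      unfolding PSO6_conj_class_eq by blast
  next
    assume "\<exists>S. rotation_matrix S \<and> PSO6_class B = PSO6_class (S ** A ** transpose S)"
    then obtain S where S: "rotation_matrix S" "PSO6_class B = PSO6_class (S ** A ** transpose S)"
      by blast
    have "PSO6_class A = PSO6_class (transpose S ** B ** transpose (transpose S))"
    proof -
      have "transpose S ** (S ** A ** transpose S) ** S = (transpose S ** S) ** A ** (transpose S ** S)"
        by (simp only: matrix_mul_assoc)
      then have "transpose S ** (S ** A ** transpose S) ** S = A"
        using S(1) by (simp add: rotation_matrix_cancel)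
      then show ?thesis
        using S(2) unfolding PSO6_class_eq_iff by (auto simp: matrix_mult_minus)
    qed
    then show "PSO6_conj_class (PSO6_class A) = PSO6_conj_class (PSO6_class B)"
      using sub[OF S] sub[OF rotation_matrix_transpose[OF S(1)], of A B] by blast
  qed
  then show ?thesis
    unfolding PSO6_class_eq_iff by simp
qed

lemma torus_conj_class_eq_iff:
  "torus_conj_class \<theta> = torus_conj_class \<eta> \<longleftrightarrow> (\<exists>S. rotation_matrix S \<and>
     (rot6 \<eta> = S ** rot6 \<theta> ** transpose S \<or> rot6 \<eta> = - (S ** rot6 \<theta> ** transpose S)))"
  unfolding torus_conj_class_def matrix_exp_block_so6 by (rule PSO6_conj_class_eq_iff)

text \<open>The equivalence relation defined by \<open>\<Gamma>\<^sub>D\<close> and \<open>W\<close> in the doubled coordinates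
  \<open>\<theta> = 2 \<psi>\<close>: the lattice \<open>2 \<Gamma>\<^sub>D\<close> is generated by \<open>(2 \<pi> \<int>)\<^sup>3\<close> and \<open>(\<pi>, \<pi>, \<pi>)\<close>.\<close>

inductive torus_equiv :: "real^3 \<Rightarrow> real^3 \<Rightarrow> bool" where
  periodic: "rot6 \<eta> = rot6 \<theta> \<Longrightarrow> torus_equiv \<theta> \<eta>"
| antipode: "torus_equiv \<theta> (\<chi> k. \<theta> $ k + pi)"
| swap12: "torus_equiv \<theta> (vector [\<theta> $ 2, \<theta> $ 1, \<theta> $ 3])"
| swap23: "torus_equiv \<theta> (vector [\<theta> $ 1, \<theta> $ 3, \<theta> $ 2])"
| neg12: "torus_equiv \<theta> (vector [- \<theta> $ 1, - \<theta> $ 2, \<theta> $ 3])"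
| sym: "torus_equiv \<theta> \<eta> \<Longrightarrow> torus_equiv \<eta> \<theta>"
| trans: "torus_equiv \<theta> \<eta> \<Longrightarrow> torus_equiv \<eta> \<zeta> \<Longrightarrow> torus_equiv \<theta> \<zeta>"

section \<open>Lattice and Weyl group acting on the classes\<close>

lemma orthogonal_permutation_matrix:
  assumes p: "p permutes (UNIV :: 'n::finite set)"
  shows "orthogonal_matrix (\<chi> i j. if j = p i then 1 else (0 :: real))"
    (is "orthogonal_matrix ?S")
proof -
  have "inj p"
    using p by (rule permutes_inj)
  then have "?S ** transpose ?S = mat 1"
    by (simp add: vec_eq_iff matrix_matrix_mult_def transpose_def mat_def inj_eq if_distrib[of
        "\<lambda>x. _ * x"] cong: if_cong)
  then show ?thesis
    using orthogonal_matrix[of "transpose ?S"] orthogonal_matrix_transpose[of ?S] by simp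
qed

lemma det_permutation_matrix:
  assumes p: "p permutes (UNIV :: 'n::finite set)"
  shows "det (\<chi> i j. if j = p i then 1 else (0 :: real)) = of_int (sign p)"
proof -
  have "(\<chi> i j. if j = p i then 1 else (0 :: real)) = (\<chi> i. mat 1 $ p i)"
    by (simp add: vec_eq_iff mat_def)
  then show ?thesis
    using det_permute_rows[OF p, of "mat 1 :: real^'n^'n"] by simp
qed

text \<open>Exchanging two blocks moves two pairs of indices, hence is an even permutation, and its
  matrix is a rotation.\<close>

lemma torus_conj_class_swap:
  fixes a b c d :: 6
  assumes \<tau>: "\<tau> = Transposition.transpose a b \<circ> Transposition.transpose c d" "a \<noteq> b" "c \<noteq> d"
    and eq: "\<And>i j. rot6 \<eta> $ i $ j = rot6 \<theta> $ \<tau> i $ \<tau> j"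
  shows "torus_conj_class \<theta> = torus_conj_class \<eta>"
proof -
  let ?S = "\<chi> i j. if j = \<tau> i then 1 else (0 :: real)"
  have p: "\<tau> permutes UNIV"
    unfolding \<tau> by (intro permutes_compose permutes_swap_id UNIV_I)
  have "sign \<tau> = 1"
    using \<tau> by (simp add: sign_compose permutation_swap_id sign_swap_id)
  then have "rotation_matrix ?S"
    using orthogonal_permutation_matrix[OF p] det_permutation_matrix[OF p]
    by (simp add: rotation_matrix_def)
  moreover have "rot6 \<eta> = ?S ** rot6 \<theta> ** transpose ?S"
    by (simp add: vec_eq_iff eq matrix_matrix_mult_def transpose_def
        if_distrib[of "\<lambda>x. x * _"] if_distrib[of "\<lambda>x. _ * x"] cong: if_cong)
  ultimately show ?thesis
    unfolding torus_conj_class_eq_iff by blast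
qed

lemma torus_conj_class_cong:
  assumes "torus_equiv \<theta> \<eta>"
  shows "torus_conj_class \<theta> = torus_conj_class \<eta>"
  using assms
proof induction
  case (periodic \<eta> \<theta>)
  then show ?case
    by (simp add: torus_conj_class_def matrix_exp_block_so6)
next
  case (antipode \<theta>)
  have "rot6 (\<chi> k. \<theta> $ k + pi) = - (mat 1 ** rot6 \<theta> ** transpose (mat 1))"
    by (simp add: rot6_antipode)
  then show ?case
    unfolding torus_conj_class_eq_iff
    by (intro exI[of _ "mat 1"]) (simp add: rotation_matrix_def orthogonal_matrix_id)
next
  case (swap12 \<theta>)
  show ?case
  proof (rule torus_conj_class_swap[OF refl, of 1 3 2 4])
    show "rot6 (vector [\<theta> $ 2, \<theta> $ 1, \<theta> $ 3]) $ i $ j =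
      rot6 \<theta> $ (Transposition.transpose 1 3 \<circ> Transposition.transpose 2 4) i $
        (Transposition.transpose 1 3 \<circ> Transposition.transpose 2 4) j" for i j
      using exhaust_6[of i] exhaust_6[of j]
      by (elim disjE) (simp_all add: rot6_def block6_def Transposition.transpose_def)
  qed simp_all
next
  case (swap23 \<theta>)
  show ?case
  proof (rule torus_conj_class_swap[OF refl, of 3 5 4 6])
    show "rot6 (vector [\<theta> $ 1, \<theta> $ 3, \<theta> $ 2]) $ i $ j =
      rot6 \<theta> $ (Transposition.transpose 3 5 \<circ> Transposition.transpose 4 6) i $
        (Transposition.transpose 3 5 \<circ> Transposition.transpose 4 6) j" for i j
      using exhaust_6[of i] exhaust_6[of j]
      by (elim disjE) (simp_all add: rot6_def block6_def Transposition.transpose_def)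
  qed simp_all
next
  case (neg12 \<theta>)
  \<comment> \<open>Reflecting one axis in each of two blocks has determinant 1 and negates both
    angles.\<close>
  let ?S = "reflect6 (vector [- 1, - 1, 1])"
  have "?S ** ?S = mat 1"
    unfolding reflect6_mult reflect6_one[symmetric]
    by (rule arg_cong[of _ _ reflect6]) (simp add: vec_eq_iff forall_3)
  then have "rotation_matrix ?S"
    by (simp add: rotation_matrix_def orthogonal_matrix transpose_reflect6 det_reflect6)
  moreover have "rot6 (vector [- \<theta> $ 1, - \<theta> $ 2, \<theta> $ 3]) = ?S ** rot6 \<theta> ** transpose ?S"
    unfolding transpose_reflect6 vec_eq_iff forall_6
    by (simp add: matrix_matrix_mult_def sum_6 reflect6_def rot6_def block6_def)
  ultimately show ?case
    unfolding torus_conj_class_eq_iff by blast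
qed simp_all

lemma torus_equiv_swap13: "torus_equiv \<theta> (vector [\<theta> $ 3, \<theta> $ 2, \<theta> $ 1])"
  using torus_equiv.trans[OF torus_equiv.trans[OF swap12 swap23] swap12, of \<theta>] by simp

lemma torus_equiv_refl: "torus_equiv \<theta> \<theta>"
  by (rule periodic) simp

lemma torus_equiv_neg23: "torus_equiv \<theta> (vector [\<theta> $ 1, - \<theta> $ 2, - \<theta> $ 3])"
  using torus_equiv.trans[OF torus_equiv.trans[OF torus_equiv_swap13 neg12] torus_equiv_swap13, of \<theta>] by simp

lemma torus_equiv_neg13: "torus_equiv \<theta> (vector [- \<theta> $ 1, \<theta> $ 2, - \<theta> $ 3])"
  using torus_equiv.trans[OF torus_equiv.trans[OF swap12 torus_equiv_neg23] swap12, of \<theta>] by simp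

lemma moduli_class_diag_exp_shift:
    "moduli_class (diag_exp (\<chi> i. x $ i + t)) = moduli_class (diag_exp x)"
  unfolding moduli_class_eq_iff moduli_class_iff
  by (rule exI[of _ t], rule exI[of _ "mat 1"])
    (simp add: phase_diag_exp cmat_one rotation_matrix_def orthogonal_matrix_id)

text \<open>Odd permutations are included, since an orthogonal matrix conjugating a diagonal matrix
  can be replaced by a rotation.\<close>

lemma moduli_class_diag_exp_permute:
  assumes p: "p permutes UNIV"
  shows "moduli_class (diag_exp (\<chi> i. x $ p i)) = moduli_class (diag_exp x)"
proof -
  let ?S = "\<chi> i j. if j = p i then 1 else (0 :: real)"
  obtain R where R: "rotation_matrix R"
    "cmat R ** diag_exp x ** transpose (cmat R) = cmat ?S ** diag_exp x ** transpose (cmat ?S)"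
    using rotation_conj_diag_exp[OF orthogonal_permutation_matrix[OF p]] by blast
  have "inj p"
    using p by (rule permutes_inj)
  then have "diag_exp (\<chi> i. x $ p i) = cmat ?S ** diag_exp x ** transpose (cmat ?S)"
    by (simp add: vec_eq_iff diag_exp_def matrix_matrix_mult_def transpose_def inj_eq
        if_distrib[of complex_of_real] if_distrib[of "\<lambda>x. x * _"] if_distrib[of "\<lambda>x. _ * x"]
            cong: if_cong)
  then show ?thesis
    unfolding moduli_class_eq_iff moduli_class_iff using R
    by (intro exI[of _ "0 :: real"] exI[of _ R]) (auto simp: phase_0)
qed

definition phase4 :: "real^3 \<Rightarrow> real^4" where
  "phase4 \<phi> = vector [0, \<phi> $ 1, \<phi> $ 2, \<phi> $ 3]"

lemma vector_4 [simp]: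
  "(vector [a, b, c, d] :: 'a::zero^4) $ 1 = a" "(vector [a, b, c, d] :: 'a^4) $ 2 = b"
  "(vector [a, b, c, d] :: 'a^4) $ 3 = c" "(vector [a, b, c, d] :: 'a^4) $ 4 = d"
  unfolding vector_def by simp_all

lemma diag_phase_eq: "diag_phase \<phi> = diag_exp (phase4 \<phi>)"
  unfolding vec_eq_iff forall_4 by (simp add: diag_phase_def diag_exp_def phase4_def)

text \<open>The coordinate \<open>\<theta>\<close> of \<open>diag_exp x\<close> without the normalisation \<open>x $ 1 = 0\<close>. It is invariant under
  adding a constant to \<open>x\<close>, and permuting the entries of \<open>x\<close> acts on it through \<open>W\<close>; this is the
  isomorphism of the Weyl groups of types \<open>A\<^sub>3\<close> and \<open>D\<^sub>3\<close>.\<close>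

definition theta4 :: "real^4 \<Rightarrow> real^3" where
  "theta4 x = vector [x $ 3 + x $ 4 - x $ 1 - x $ 2, x $ 2 + x $ 4 - x $ 1 - x $ 3, x $ 2 + x $ 3
      - x $ 1 - x $ 4]"

lemma theta4_phase4: "theta4 (phase4 \<phi>) = 2 *\<^sub>R psi_coord \<phi>"
  unfolding vec_eq_iff forall_3 psi_coord_nth theta4_def phase4_def by simp

lemma diag_exp_cong:
  assumes "\<And>i. \<exists>n :: int. x $ i = y $ i + pi * n"
  shows "diag_exp x = diag_exp y"
proof -
  have "exp (- 2 * \<i> * complex_of_real (x $ i)) = exp (- 2 * \<i> * complex_of_real (y $ i))" for i
  proof -
    obtain n :: int where "x $ i = y $ i + pi * n"
      using assms by blast
    then show ?thesis
      unfolding exp_eq by (intro exI[of _ "- n"]) (simp add: algebra_simps)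
  qed
  then show ?thesis
    by (simp only: diag_exp_def)
qed

lemma moduli_class_phi_of_cong:
  assumes "torus_equiv \<theta> \<eta>"
  shows "moduli_class (diag_phase (phi_of \<theta>)) = moduli_class (diag_phase (phi_of \<eta>))"
  using assms
proof induction
  case (periodic \<eta> \<theta>)
  have "sin (\<eta> $ k) = sin (\<theta> $ k) \<and> cos (\<eta> $ k) = cos (\<theta> $ k)" for k
    using arg_cong[OF periodic, of "\<lambda>A. A $ 1 $ 1"] arg_cong[OF periodic, of "\<lambda>A. A $ 1 $ 2"]
      arg_cong[OF periodic, of "\<lambda>A. A $ 3 $ 3"] arg_cong[OF periodic, of "\<lambda>A. A $ 3 $ 4"]
      arg_cong[OF periodic, of "\<lambda>A. A $ 5 $ 5"] arg_cong[OF periodic, of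
          "\<lambda>A. A $ 5 $ 6"] exhaust_3[of k]
    by (auto simp: rot6_def block6_def)
  then have "\<forall>k. \<exists>n :: int. \<eta> $ k = \<theta> $ k + 2 * pi * n"
    unfolding sin_cos_eq_iff by blast
  then obtain n :: "3 \<Rightarrow> int" where n: "\<And>k. \<eta> $ k = \<theta> $ k + 2 * pi * n k"
    unfolding choice_iff by blast
  \<comment> \<open>\<open>phi_of\<close> averages two angles, so a period 2 pi of one angle becomes
    a period pi of two phases.\<close>
  have "\<exists>m :: int. phase4 (phi_of \<theta>) $ i = phase4 (phi_of \<eta>) $ i + pi * m" for i
    using exhaust_4[of i]
  proof (elim disjE)
    assume "i = 1" then show ?thesis by (intro exI[of _ 0]) (simp add: phase4_def)
  next
    assume "i = 2" then show ?thesis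
      by (intro exI[of _ "- n 2 - n 3"]) (simp add: phase4_def phi_of_nth n field_simps)
  next
    assume "i = 3" then show ?thesis
      by (intro exI[of _ "- n 3 - n 1"]) (simp add: phase4_def phi_of_nth n field_simps)
  next
    assume "i = 4" then show ?thesis
      by (intro exI[of _ "- n 1 - n 2"]) (simp add: phase4_def phi_of_nth n field_simps)
  qed
  then show ?case
    unfolding diag_phase_eq by (metis diag_exp_cong)
next
  case (antipode \<theta>)
  have "\<exists>m :: int. phase4 (phi_of (\<chi> k. \<theta> $ k + pi)) $ i = phase4 (phi_of \<theta>) $ i + pi * m" for i
    using exhaust_4[of i]
    by (elim disjE; intro exI[of _ "if i = 1 then 0 else 1"])
        (simp_all add: phase4_def phi_of_nth field_simps)
  then show ?case
    unfolding diag_phase_eq by (metis diag_exp_cong)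
next
  case (swap12 \<theta>)
  have "phase4 (phi_of (vector [\<theta> $ 2, \<theta> $ 1, \<theta> $ 3]))
      = (\<chi> i. phase4 (phi_of \<theta>) $ Transposition.transpose 2 3 i)"
    unfolding vec_eq_iff forall_4 by (simp add: phase4_def phi_of_nth Transposition.transpose_def)
  then show ?case
    unfolding diag_phase_eq by (simp add: moduli_class_diag_exp_permute permutes_swap_id)
next
  case (swap23 \<theta>)
  have "phase4 (phi_of (vector [\<theta> $ 1, \<theta> $ 3, \<theta> $ 2]))
      = (\<chi> i. phase4 (phi_of \<theta>) $ Transposition.transpose 3 4 i)"
    unfolding vec_eq_iff forall_4 by (simp add: phase4_def phi_of_nth Transposition.transpose_def)
  then show ?case
    unfolding diag_phase_eq by (simp add: moduli_class_diag_exp_permute permutes_swap_id)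
next
  case (neg12 \<theta>)
  \<comment> \<open>This permutation brings the last phase to the first place; subtracting it from
    all entries restores the normalisation that the first phase is 0.\<close>
  let ?p = "Transposition.transpose 1 4 \<circ> Transposition.transpose 2 3 :: 4 \<Rightarrow> 4"
  have "phase4 (phi_of (vector [- \<theta> $ 1, - \<theta> $ 2, \<theta> $ 3])) =
      (\<chi> i. (\<chi> i. phase4 (phi_of \<theta>) $ ?p i) $ i + (- phi_of \<theta> $ 3))"
    unfolding vec_eq_iff forall_4
    by (simp add: phase4_def phi_of_nth Transposition.transpose_def field_simps)
  moreover have "?p permutes UNIV"
    by (intro permutes_compose permutes_swap_id UNIV_I)
  ultimately show ?case
    unfolding diag_phase_eq by (simp only: moduli_class_diag_exp_shift moduli_class_diag_exp_permute)
qed simp_all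

section \<open>Fibres of the two quotient maps\<close>

text \<open>The three coordinates belong to the three splittings of four indices into two pairs, the
  pair without 1 counting positively. A transposition permutes the splittings and reverses none of
  them if it fixes 1, and two otherwise.\<close>

lemma torus_equiv_theta4_transpose:
  "torus_equiv (theta4 (\<chi> i. x $ Transposition.transpose a b i)) (theta4 x)"
proof -
  let ?T = "\<lambda>a b. theta4 (\<chi> i. x $ Transposition.transpose a b i)"
  let ?t = "theta4 x"
  have s: "Transposition.transpose a b = Transposition.transpose b a" for a b :: 4
    by (rule Transposition.transpose_commute)
  have 23: "?T 2 3 = vector [?t $ 2, ?t $ 1, ?t $ 3]"
    and 34: "?T 3 4 = vector [?t $ 1, ?t $ 3, ?t $ 2]"
    and 24: "?T 2 4 = vector [?t $ 3, ?t $ 2, ?t $ 1]"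
    and 12: "?T 1 2 = vector [?t $ 1, - ?t $ 3, - ?t $ 2]"
    and 13: "?T 1 3 = vector [- ?t $ 3, ?t $ 2, - ?t $ 1]"
    and 14: "?T 1 4 = vector [- ?t $ 2, - ?t $ 1, ?t $ 3]"
    by (simp_all add: theta4_def Transposition.transpose_def vec_eq_iff forall_3)
  have "torus_equiv ?t (vector [?t $ 1, - ?t $ 3, - ?t $ 2])"
    using torus_equiv.trans[OF swap23 torus_equiv_neg23, of ?t] by simp
  moreover have "torus_equiv ?t (vector [- ?t $ 3, ?t $ 2, - ?t $ 1])"
    using torus_equiv.trans[OF torus_equiv_swap13 torus_equiv_neg13, of ?t] by simp
  moreover have "torus_equiv ?t (vector [- ?t $ 2, - ?t $ 1, ?t $ 3])"
    using torus_equiv.trans[OF swap12 neg12, of ?t] by simp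
  moreover have "torus_equiv ?t (?T a a)" for a
    by (simp add: torus_equiv_refl)
  ultimately have "torus_equiv ?t (?T a b)"
    using exhaust_4[of a] exhaust_4[of b] swap12[of ?t] swap23[of ?t] torus_equiv_swap13[of ?t]
      s[of 2 1] s[of 3 1] s[of 4 1] s[of 3 2] s[of 4 2] s[of 4 3] 12 13 14 23 24 34
    by (elim disjE) simp_all
  then show ?thesis
    by (rule torus_equiv.sym)
qed

lemma torus_equiv_theta4_permute:
  assumes "p permutes (UNIV :: 4 set)"
  shows "torus_equiv (theta4 (\<chi> i. x $ p i)) (theta4 x)"
proof -
  have "finite (UNIV :: 4 set)"
    by simp
  then show ?thesis
    using assms
  proof (induction rule: permutes_rev_induct)
    case id
    then show ?case
      by (simp add: torus_equiv_refl)
  next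
    case (swap a b p)
    show ?case
      using torus_equiv.trans[OF torus_equiv_theta4_transpose[of "\<chi> i. x $ p i" a b] swap.IH] by simp
  qed
qed

text \<open>An invertible matrix that intertwines two diagonal matrices matches their entries along such
  a permutation.\<close>

lemma det_nonzero_permutation:
  fixes A :: "'a::field^'n^'n"
  assumes "det A \<noteq> 0"
  obtains p where "p permutes UNIV" "\<And>i. A $ i $ p i \<noteq> 0"
proof -
  obtain p where "p permutes (UNIV :: 'n set)" "of_int (sign p) * (\<Prod>i\<in>UNIV. A $ i $ p i) \<noteq> 0"
    using assms unfolding det_def by (metis (mono_tags, lifting) mem_Collect_eq sum.neutral)
  then show ?thesis
    using that by auto
qed

text \<open>In the intertwining relation a nonzero entry \<open>S $ i $ j\<close> forces
  \<open>y $ i\<close> and \<open>x $ j + t\<close> to agree modulo pi. A permutation along nonzero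
  entries therefore matches all phases, up to the common shift \<open>t\<close>.\<close>

lemma torus_equiv_of_moduli_class_eq:
  assumes "moduli_class (diag_exp x) = moduli_class (diag_exp y)"
  shows "torus_equiv (theta4 x) (theta4 y)"
proof -
  obtain t S where S: "rotation_matrix S"
    and y: "diag_exp y = phase t (cmat S ** diag_exp x ** transpose (cmat S))"
  proof -
    have "diag_exp y \<in> moduli_class (diag_exp x)"
      using assms moduli_class_refl by simp
    then show ?thesis
      using that unfolding moduli_class_iff by blast
  qed
  have "transpose (cmat S) ** cmat S = mat 1"
    unfolding cmat_transpose[symmetric] cmat_mult[symmetric]
    using S by (simp add: rotation_matrix_def orthogonal_matrix cmat_one)
  then have eq: "diag_exp y ** cmat S = phase t (cmat S ** diag_exp x)"
    unfolding y phase_mult by (simp flip: matrix_mul_assoc)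
  have e: "exp (- 2 * \<i> * complex_of_real (y $ i)) * S $ i $ j =
      exp (- 2 * \<i> * complex_of_real t) * (S $ i $ j * exp (- 2 * \<i> * complex_of_real (x $ j)))" for i j
  proof -
    have "(diag_exp y ** cmat S) $ i $ j = exp (- 2 * \<i> * complex_of_real (y $ i)) * S $ i $ j"
      unfolding diag_exp_def matrix_matrix_mult_def
      by (simp add: if_distrib[of "\<lambda>x. x * _"] cong: if_cong)
    moreover have "phase t (cmat S ** diag_exp x) $ i $ j
        = exp (- 2 * \<i> * complex_of_real t) * (S $ i $ j * exp (- 2 * \<i> * complex_of_real (x $ j)))"
      unfolding diag_exp_def matrix_matrix_mult_def phase_def
      by (simp add: if_distrib[of "\<lambda>x. _ * x"] cong: if_cong)
    ultimately show ?thesis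
      using eq by metis
  qed
  have "det S \<noteq> 0"
    using S by (simp add: rotation_matrix_def)
  then obtain p where p: "p permutes UNIV" "\<And>i. S $ i $ p i \<noteq> 0"
    using det_nonzero_permutation by blast
  have "\<exists>n :: int. y $ i = x $ p i + t + pi * n" for i
  proof -
    have "exp (- 2 * \<i> * complex_of_real (y $ i))
        = exp (- 2 * \<i> * complex_of_real t) * exp (- 2 * \<i> * complex_of_real (x $ p i))"
      using e[of i "p i"] p(2)[of i] by (simp add: mult.left_commute mult.commute)
    also have "\<dots> = exp (- 2 * \<i> * complex_of_real (x $ p i + t))"
      by (simp add: exp_add[symmetric] ring_distribs add.commute)
    finally obtain n :: int where "- 2 * \<i> * complex_of_real (y $ i) =
        - 2 * \<i> * complex_of_real (x $ p i + t) + complex_of_real (of_int (2 * n) * pi) * \<i>"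
      unfolding exp_eq by blast
    then have "Im (- 2 * \<i> * complex_of_real (y $ i)) =
        Im (- 2 * \<i> * complex_of_real (x $ p i + t) + complex_of_real (of_int (2 * n) * pi) * \<i>)"
      by (rule arg_cong)
    then show ?thesis
      by (intro exI[of _ "- n"]) (simp add: algebra_simps)
  qed
  then obtain n :: "4 \<Rightarrow> int" where n: "\<And>i. y $ i = x $ p i + t + pi * n i"
    by metis
  define z :: "real^4" where "z = (\<chi> i. x $ p i)"
  \<comment> \<open>All three coordinates change by \<open>pi * N\<close> up to multiples of 2 pi,
    so the parity of \<open>N\<close> decides whether a shift by (pi, pi, pi) is involved.\<close>
  define N where "N = n 3 + n 4 - n 1 - n 2"
  have \<theta>: "theta4 y $ 1 = theta4 z $ 1 + pi * N"
      "theta4 y $ 2 = theta4 z $ 2 + pi * N + 2 * pi * (n 2 - n 3)"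
     "theta4 y $ 3 = theta4 z $ 3 + pi * N + 2 * pi * (n 2 - n 4)"
    by (simp_all add: theta4_def n z_def N_def algebra_simps)
  have per: "torus_equiv \<zeta> \<eta>" if "\<And>k. \<exists>m :: int. \<eta> $ k = \<zeta> $ k + 2 * pi * m" for \<zeta> \<eta>
  proof (rule periodic)
    have "sin (\<eta> $ k) = sin (\<zeta> $ k) \<and> cos (\<eta> $ k) = cos (\<zeta> $ k)" for k
      unfolding sin_cos_eq_iff by (rule that)
    then show "rot6 \<eta> = rot6 \<zeta>"
      by (simp add: rot6_def)
  qed
  have "torus_equiv (theta4 z) (theta4 y)"
  proof (cases "even N")
    case True
    then obtain m where "N = 2 * m"
      by (elim evenE)
    then have "\<exists>m :: int. theta4 y $ k = theta4 z $ k + 2 * pi * m" for k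
      using exhaust_3[of k] \<theta>
      by (elim disjE; intro exI[of _
          "if k = 1 then m else if k = 2 then m + n 2 - n 3 else m + n 2 - n 4"])
        (simp_all add: algebra_simps)
    then show ?thesis
      by (rule per)
  next
    case False
    then obtain m where "N = 2 * m + 1"
      by (elim oddE)
    then have "\<exists>m :: int. theta4 y $ k = (\<chi> k. theta4 z $ k + pi) $ k + 2 * pi * m" for k
      using exhaust_3[of k] \<theta>
      by (elim disjE; intro exI[of _
          "if k = 1 then m else if k = 2 then m + n 2 - n 3 else m + n 2 - n 4"])
        (simp_all add: algebra_simps)
    then have "torus_equiv (\<chi> k. theta4 z $ k + pi) (theta4 y)"
      by (rule per)
    then show ?thesis
      using antipode torus_equiv.trans by blast
  qed
  then show ?thesis
    using torus_equiv_theta4_permute[OF p(1), of x] torus_equiv.sym torus_equiv.trans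
    unfolding z_def by blast
qed

lemma torus_equiv_of_cos_eq:
  assumes c: "\<And>k. cos (\<eta> $ k) = cos (\<zeta> $ k)"
    and s: "sin (\<eta> $ 1) * sin (\<eta> $ 2) * sin (\<eta> $ 3) = sin (\<zeta> $ 1) * sin (\<zeta> $ 2) * sin (\<zeta> $ 3)"
  shows "torus_equiv \<zeta> \<eta>"
proof -
  have sgn: "sin (\<eta> $ k) = sin (\<zeta> $ k) \<or> sin (\<eta> $ k) = - sin (\<zeta> $ k)" for k
    using c[of k] by (metis power2_eq_iff sin_squared_eq)
  \<comment> \<open>If the product is nonzero, the number of sign changes is even. If it vanishes,
    one of the values is 0 and may be counted as changed or unchanged to make the number
    even.\<close>
  have *: "x = a \<and> y = b \<and> z = c \<or> x = - a \<and> y = - b \<and> z = c \<or> x = - a \<and> y = b \<and> z = - c \<or>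
      x = a \<and> y = - b \<and> z = - c"
    if "x = a \<or> x = - a" "y = b \<or> y = - b" "z = c \<or> z = - c" "x * y * z = a * b * c"
    for x y z a b c :: real
    using that by auto
  have per: "torus_equiv \<zeta>' \<eta>" if "cos (\<zeta>' $ 1) = cos (\<eta> $ 1) \<and> sin (\<zeta>' $ 1) = sin (\<eta> $ 1)"
    "cos (\<zeta>' $ 2) = cos (\<eta> $ 2) \<and> sin (\<zeta>' $ 2) = sin (\<eta> $ 2)"
    "cos (\<zeta>' $ 3) = cos (\<eta> $ 3) \<and> sin (\<zeta>' $ 3) = sin (\<eta> $ 3)" for \<zeta>'
  proof (rule torus_equiv.periodic)
    have "cos (\<zeta>' $ k) = cos (\<eta> $ k) \<and> sin (\<zeta>' $ k) = sin (\<eta> $ k)" for k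
      using that exhaust_3[of k] by auto
    then show "rot6 \<eta> = rot6 \<zeta>'"
      by (simp add: rot6_def)
  qed
  from *[OF sgn sgn sgn s] show ?thesis
  proof (elim disjE conjE)
    assume "sin (\<eta> $ 1) = sin (\<zeta> $ 1)" "sin (\<eta> $ 2) = sin (\<zeta> $ 2)" "sin (\<eta> $ 3) = sin (\<zeta> $ 3)"
    then show ?thesis
      by (intro per) (simp_all add: c)
  next
    assume "sin (\<eta> $ 1) = - sin (\<zeta> $ 1)" "sin (\<eta> $ 2) = - sin (\<zeta> $ 2)" "sin (\<eta> $ 3) = sin (\<zeta> $ 3)"
    then show ?thesis
      by (intro torus_equiv.trans[OF torus_equiv.neg12 per]) (simp_all add: c)
  next
    assume "sin (\<eta> $ 1) = - sin (\<zeta> $ 1)" "sin (\<eta> $ 2) = sin (\<zeta> $ 2)" "sin (\<eta> $ 3) = - sin (\<zeta> $ 3)"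
    then show ?thesis
      by (intro torus_equiv.trans[OF torus_equiv_neg13 per]) (simp_all add: c)
  next
    assume "sin (\<eta> $ 1) = sin (\<zeta> $ 1)" "sin (\<eta> $ 2) = - sin (\<zeta> $ 2)" "sin (\<eta> $ 3) = - sin (\<zeta> $ 3)"
    then show ?thesis
      by (intro torus_equiv.trans[OF torus_equiv_neg23 per]) (simp_all add: c)
  qed
qed

definition double_cos :: "real^3 \<Rightarrow> 6 \<Rightarrow> real" where
  "double_cos \<theta> i = cos (\<theta> $ (if i = 1 \<or> i = 2 then 1 else if i = 3 \<or> i = 4 then 2 else 3))"

text \<open>Passing to the symmetric part removes the sines and leaves a diagonal matrix, so that
  conjugacy can be exploited as for \<open>diag_exp\<close>.\<close>

lemma rot6_plus_transpose:
  "rot6 \<theta> + transpose (rot6 \<theta>) = (\<chi> i j. if i = j then 2 * double_cos \<theta> i else 0)"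
  unfolding vec_eq_iff forall_6
  by (simp add: rot6_def block6_def transpose_def double_cos_def)

lemma mset_eq_cases3:
  assumes "{#a, b, c#} = {#x, y, z#}"
  shows "a = x \<and> b = y \<and> c = z \<or> a = x \<and> b = z \<and> c = y \<or> a = y \<and> b = x \<and> c = z \<or>
    a = y \<and> b = z \<and> c = x \<or> a = z \<and> b = x \<and> c = y \<or> a = z \<and> b = y \<and> c = x"
  using assms by (auto simp: add_eq_conv_ex)

text \<open>Each cosine occurs twice on the diagonal of the symmetric part, so comparing diagonals
  gives only a doubled equality.\<close>

lemma mset_double_cancel:
  assumes "M + M = N + (N :: 'a multiset)"
  shows "M = N"
proof (rule multiset_eqI)
  fix x
  show "count M x = count N x"
    using arg_cong[OF assms, of "\<lambda>M. count M x"] by simp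
qed

text \<open>The symmetric parts determine the cosines up to order, hence \<open>\<eta>\<close> up to order, signs and periods.
  The parity of the number of sign changes is detected by the character, unless some sine
  vanishes, in which case the sign of that angle is irrelevant.\<close>

lemma torus_equiv_of_conj:
  assumes S: "rotation_matrix S" and eq: "rot6 \<eta> = S ** rot6 \<theta> ** transpose S"
  shows "torus_equiv \<theta> \<eta>"
proof -
  have add: "S ** A ** transpose S + S ** B ** transpose S = S ** (A + B) ** transpose S" for A B
    by (simp add: vec_eq_iff matrix_matrix_mult_def ring_distribs sum.distrib)
  have "rot6 \<eta> + transpose (rot6 \<eta>) = S ** (rot6 \<theta> + transpose (rot6 \<theta>)) ** transpose S"
    unfolding eq add[symmetric] by (simp add: matrix_transpose_mul matrix_mul_assoc)
  then have "(rot6 \<eta> + transpose (rot6 \<eta>)) ** S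
      = S ** (rot6 \<theta> + transpose (rot6 \<theta>)) ** (transpose S ** S)"
    by (simp add: matrix_mul_assoc)
  then have eq': "(rot6 \<eta> + transpose (rot6 \<eta>)) ** S = S ** (rot6 \<theta> + transpose (rot6 \<theta>))"
    using S by (simp add: rotation_matrix_cancel)
  have e: "double_cos \<eta> i * S $ i $ j = S $ i $ j * double_cos \<theta> j" for i j
  proof -
    have "((rot6 \<eta> + transpose (rot6 \<eta>)) ** S) $ i $ j = 2 * (double_cos \<eta> i * S $ i $ j)"
      unfolding rot6_plus_transpose
      by (simp add: matrix_matrix_mult_def if_distrib[of "\<lambda>x. x * _"] cong: if_cong)
    moreover have "(S ** (rot6 \<theta> + transpose (rot6 \<theta>))) $ i $ j = 2 * (S $ i $ j * double_cos \<theta> j)"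
      unfolding rot6_plus_transpose
      by (simp add: matrix_matrix_mult_def if_distrib[of "\<lambda>x. _ * x"] cong: if_cong)
    ultimately show ?thesis
      unfolding eq' by auto
  qed
  have "det S \<noteq> 0"
    using S by (simp add: rotation_matrix_def)
  then obtain p where p: "p permutes UNIV" "\<And>i. S $ i $ p i \<noteq> 0"
    using det_nonzero_permutation by blast
  have "image_mset p (mset_set UNIV) = mset_set UNIV"
    using p(1) by (subst image_mset_mset_set) (simp_all add: permutes_inj permutes_surj)
  moreover have "double_cos \<eta> = double_cos \<theta> \<circ> p"
    using e p(2) by (metis comp_apply ext mult.commute mult_cancel_left)
  ultimately have "image_mset (double_cos \<eta>) (mset_set UNIV)
      = image_mset (double_cos \<theta>) (mset_set UNIV)"
    by (metis multiset.map_comp)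
  then have "{#cos (\<eta> $ 1), cos (\<eta> $ 2), cos (\<eta> $ 3)#} + {#cos (\<eta> $ 1), cos (\<eta> $ 2), cos (\<eta> $ 3)#} =
      {#cos (\<theta> $ 1), cos (\<theta> $ 2), cos (\<theta> $ 3)#} + {#cos (\<theta> $ 1), cos (\<theta> $ 2), cos (\<theta> $ 3)#}"
    unfolding UNIV_6 by (simp add: double_cos_def add_mset_commute)
  then have c: "{#cos (\<eta> $ 1), cos (\<eta> $ 2), cos (\<eta> $ 3)#} = {#cos (\<theta> $ 1), cos (\<theta> $ 2), cos (\<theta> $ 3)#}"
    by (rule mset_double_cancel)
  have s: "sin (\<eta> $ 1) * sin (\<eta> $ 2) * sin (\<eta> $ 3) = sin (\<theta> $ 1) * sin (\<theta> $ 2) * sin (\<theta> $ 3)"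
  proof -
    have "signature_character (rot6 \<eta>) = signature_character (rot6 \<theta>)"
      unfolding eq by (rule signature_character_conj[OF rotation_matrix_rot6 S])
    then have "complex_of_real (sin (\<eta> $ 1) * sin (\<eta> $ 2) * sin (\<eta> $ 3)) =
        complex_of_real (sin (\<theta> $ 1) * sin (\<theta> $ 2) * sin (\<theta> $ 3))"
      unfolding signature_character_rot6 by simp
    then show ?thesis
      unfolding of_real_eq_iff .
  qed
  \<comment> \<open>Once the angles are reordered to match the cosines, the sines still satisfy the
    required equation because their product is symmetric.\<close>
  have *: "torus_equiv \<theta> \<eta>" if t: "torus_equiv \<theta> (vector [x, y, z])"
    and c: "cos (\<eta> $ 1) = cos x" "cos (\<eta> $ 2) = cos y" "cos (\<eta> $ 3) = cos z"
    and xyz: "sin x * sin y * sin z = sin (\<theta> $ 1) * sin (\<theta> $ 2) * sin (\<theta> $ 3)" for x y z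
  proof (rule torus_equiv.trans[OF t torus_equiv_of_cos_eq])
    show "cos (\<eta> $ k) = cos (vector [x, y, z] $ k)" for k
      using exhaust_3[of k] c by auto
  qed (use s xyz in simp)
  have 231: "torus_equiv \<theta> (vector [\<theta> $ 2, \<theta> $ 3, \<theta> $ 1])"
    using torus_equiv.trans[OF torus_equiv.swap12 torus_equiv.swap23, of \<theta>] by simp
  have 312: "torus_equiv \<theta> (vector [\<theta> $ 3, \<theta> $ 1, \<theta> $ 2])"
    using torus_equiv.trans[OF torus_equiv.swap23 torus_equiv.swap12, of \<theta>] by simp
  have 123: "torus_equiv \<theta> (vector [\<theta> $ 1, \<theta> $ 2, \<theta> $ 3])"
    by (rule torus_equiv.periodic, rule arg_cong[of _ _ rot6]) (simp add: vec_eq_iff forall_3)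
  from mset_eq_cases3[OF c] show ?thesis
    using *[OF 123] *[OF 231] *[OF 312] *[OF torus_equiv.swap12] *[OF torus_equiv.swap23] *[OF torus_equiv_swap13]
    by (elim disjE conjE) (simp_all add: mult_ac)
qed

lemma torus_equiv_iff_torus_conj_class_eq:
  "torus_equiv \<theta> \<eta> \<longleftrightarrow> torus_conj_class \<theta> = torus_conj_class \<eta>"
proof
  assume "torus_conj_class \<theta> = torus_conj_class \<eta>"
  then obtain S where S: "rotation_matrix S" and
    "rot6 \<eta> = S ** rot6 \<theta> ** transpose S \<or> rot6 \<eta> = - (S ** rot6 \<theta> ** transpose S)"
    unfolding torus_conj_class_eq_iff by blast
  then consider "rot6 \<eta> = S ** rot6 \<theta> ** transpose S"
    | "rot6 \<eta> = S ** rot6 (\<chi> k. \<theta> $ k + pi) ** transpose S"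
    by (auto simp: rot6_antipode matrix_mult_minus)
  then show "torus_equiv \<theta> \<eta>"
    using torus_equiv_of_conj[OF S] torus_equiv.antipode torus_equiv.trans by cases blast+
qed (rule torus_conj_class_cong)

section \<open>Quotient topologies\<close>

text \<open>The preimage in \<open>S\<close> of a set whose pullback to \<open>'a\<close> is closed is the image under \<open>G\<close> of a
  compact set. In the applications \<open>B\<close> is a fundamental box of the torus and \<open>K\<close> the compact group
  acting on \<open>S\<close>; no Hausdorff property of the quotient is needed.\<close>

lemma quotient_map_of_compact_cover:
  fixes f :: "'a::metric_space \<Rightarrow> 'b::metric_space" and G :: "'c::metric_space \<times> 'a \<Rightarrow> 'b"
  assumes Q: "quotient_map (top_of_set S) Y Q"
    and f: "continuous_on UNIV f" "range f \<subseteq> S"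
    and K: "compact K" "compact B" and G: "continuous_on (K \<times> B) G"
    and QG: "\<And>k a. k \<in> K \<Longrightarrow> a \<in> B \<Longrightarrow> G (k, a) \<in> S \<and> Q (G (k, a)) = Q (f a)"
    and surj: "S \<subseteq> G ` (K \<times> B)"
  shows "quotient_map euclidean Y (\<lambda>a. Q (f a))"
  unfolding quotient_map_closedin
proof (intro conjI allI impI)
  have top: "Q ` S = topspace Y"
    using quotient_imp_surjective_map[OF Q] by simp
  have QS: "\<exists>a\<in>B. Q s = Q (f a)" if "s \<in> S" for s
    using surj QG that by fastforce
  show "(\<lambda>a. Q (f a)) ` topspace euclidean = topspace Y"
    unfolding top[symmetric] using f(2) QS by fastforce
  fix U assume U: "U \<subseteq> topspace Y"
  let ?C = "{a \<in> topspace euclidean. Q (f a) \<in> U}"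
  show "closedin euclidean ?C = closedin Y U"
  proof
    assume "closedin Y U"
    moreover have "continuous_map euclidean (top_of_set S) f"
      using f by (auto simp: continuous_map_in_subtopology)
    then have "continuous_map euclidean Y (Q \<circ> f)"
      using quotient_imp_continuous_map[OF Q] by (rule continuous_map_compose)
    ultimately show "closedin euclidean ?C"
      using closedin_continuous_map_preimage by fastforce
  next
    assume "closedin euclidean ?C"
    then have "compact (K \<times> (B \<inter> ?C))"
      using K by (intro compact_Times compact_Int_closed) auto
    moreover have "continuous_on (K \<times> (B \<inter> ?C)) G"
      using G by (rule continuous_on_subset) auto
    ultimately have "compact (G ` (K \<times> (B \<inter> ?C)))"
      using compact_continuous_image by blast
    moreover have "{s \<in> S. Q s \<in> U} = G ` (K \<times> (B \<inter> ?C))"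
    proof (intro Set.set_eqI iffI)
      fix s assume s: "s \<in> {s \<in> S. Q s \<in> U}"
      then obtain k a where ka: "k \<in> K" "a \<in> B" "s = G (k, a)"
        using surj by blast
      then have "a \<in> ?C"
        using QG[of k a] s by auto
      then show "s \<in> G ` (K \<times> (B \<inter> ?C))"
        using ka by blast
    qed (use QG in auto)
    ultimately have "closedin (top_of_set S) {s \<in> S. Q s \<in> U}"
      by (intro closed_subset compact_imp_closed) auto
    then show "closedin Y U"
      using Q U unfolding quotient_map_closedin by auto
  qed
qed

text \<open>Each quotient map factors through the other, and the two factorisations are mutually
  inverse because both are determined by values on points of \<open>X\<close>.\<close>

lemma homeomorphic_map_quotients:
  assumes q: "quotient_map X Y q" and r: "quotient_map X Z r"
    and qr: "\<And>x y. x \<in> topspace X \<Longrightarrow> y \<in> topspace X \<Longrightarrow> q x = q y \<longleftrightarrow> r x = r y"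
  obtains D where "homeomorphic_map Y Z D" "\<And>x. x \<in> topspace X \<Longrightarrow> D (q x) = r x"
proof -
  obtain D where D: "continuous_map Y Z D" "\<And>x. x \<in> topspace X \<Longrightarrow> D (q x) = r x"
    using quotient_map_lift_exists[OF q quotient_imp_continuous_map[OF r]] qr by metis
  obtain E where E: "continuous_map Z Y E" "\<And>x. x \<in> topspace X \<Longrightarrow> E (r x) = q x"
    using quotient_map_lift_exists[OF r quotient_imp_continuous_map[OF q]] qr by metis
  have "\<forall>y\<in>topspace Y. E (D y) = y" "\<forall>z\<in>topspace Z. D (E z) = z"
    using D(2) E(2) quotient_imp_surjective_map[OF q] quotient_imp_surjective_map[OF r] by force+
  then have "homeomorphic_maps Y Z D E"
    using D E by (simp add: homeomorphic_maps_def)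
  then show ?thesis
    using that D(2) homeomorphic_maps_imp_map by blast
qed

lemma continuous_on_matrix_mult:
  fixes f g :: "'a::topological_space \<Rightarrow> 'b::real_normed_algebra_1^'n^'n"
  assumes "continuous_on S f" "continuous_on S g"
  shows "continuous_on S (\<lambda>x. f x ** g x)"
  unfolding matrix_matrix_mult_def using assms by (intro continuous_intros)

lemma continuous_on_transpose:
  fixes f :: "'a::topological_space \<Rightarrow> 'b::real_normed_algebra_1^'n^'n"
  assumes "continuous_on S f"
  shows "continuous_on S (\<lambda>x. transpose (f x))"
  unfolding transpose_def using assms by (intro continuous_intros)

lemma compact_rotation_matrices: "compact {A :: real^'n^'n. rotation_matrix A}"
  unfolding compact_eq_bounded_closed
proof
  have "norm A \<le> sqrt (real CARD('n))" if A: "rotation_matrix A" for A :: "real^'n^'n"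
  proof -
    have "A ** transpose A = mat 1"
      using A by (simp add: rotation_matrix_def orthogonal_matrix_def)
    then have "(A ** transpose A) $ i $ i = 1" for i
      by (simp add: mat_def)
    then have "A $ i \<bullet> A $ i = 1" for i
      by (simp add: matrix_matrix_mult_def transpose_def inner_vec_def)
    then have "norm (A $ i) = 1" for i
      by (simp add: norm_eq_sqrt_inner)
    then show ?thesis
      by (simp add: norm_vec_def L2_set_def)
  qed
  then show "bounded {A :: real^'n^'n. rotation_matrix A}"
    unfolding bounded_iff by blast
  have "{A :: real^'n^'n. rotation_matrix A} = {A. transpose A ** A = mat 1} \<inter> {A. det A = 1}"
    by (auto simp: rotation_matrix_def orthogonal_matrix)
  moreover have "closed {A :: real^'n^'n. transpose A ** A = mat 1}"
    by (intro closed_Collect_eq continuous_on_matrix_mult continuous_on_transpose continuous_intros)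
  moreover have "closed {A :: real^'n^'n. det A = 1}"
    unfolding det_def by (intro closed_Collect_eq continuous_intros)
  ultimately show "closed {A :: real^'n^'n. rotation_matrix A}"
    by (simp add: closed_Int)
qed

text \<open>Both endpoints are included so that the period boxes formed from such intervals are
  compact.\<close>

lemma exists_mod_interval:
  fixes x P :: real
  assumes "P > 0"
  shows "\<exists>y. 0 \<le> y \<and> y \<le> P \<and> (\<exists>n :: int. x = y + P * n)"
proof (intro exI conjI)
  let ?n = "\<lfloor>x / P\<rfloor>"
  show "x = (x - P * ?n) + P * ?n"
    by simp
  have "?n * P \<le> x"
    using assms of_int_floor_le[of "x / P"] by (simp only: pos_le_divide_eq)
  moreover have "x / P \<le> ?n + 1"
    by linarith
  ultimately show "0 \<le> x - P * ?n" "x - P * ?n \<le> P"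
    using assms by (simp_all add: field_simps)
qed

lemma quotient_map_moduli: "quotient_map euclidean moduli_topology (\<lambda>\<phi>. moduli_class (diag_phase \<phi>))"
proof (rule quotient_map_of_compact_cover)
  \<comment> \<open>The factor \<open>exp (- 2 * \<i> * t)\<close> has period pi in
    \<open>t\<close>, so this interval covers the whole circle of phases.\<close>
  let ?K = "{0..pi} \<times> {R :: real^4^4. rotation_matrix R}"
  let ?B = "cbox (0 :: real^3) (\<chi> k. pi)"
  let ?G = "\<lambda>x. phase (fst (fst x)) (cmat (snd (fst x)) ** diag_phase (snd x)
      ** transpose (cmat (snd (fst x))))"
  show "quotient_map (top_of_set sym_unitary) moduli_topology moduli_class"
    unfolding moduli_topology_def by (rule quotient_map_quotient_topology)
  have entry: "continuous_on S (\<lambda>x. diag_phase (f x) $ i $ j)" if f: "continuous_on S f" for S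
      and f :: "'a::topological_space \<Rightarrow> real^3" and i j
    by (cases "i = j"; cases "i = 1"; cases "i = 2"; cases "i = 3")
      (auto simp: diag_phase_def intro!: continuous_intros f)
  have diag: "continuous_on S (\<lambda>x. diag_phase (f x))" if f: "continuous_on S f" for S
      and f :: "'a::topological_space \<Rightarrow> real^3"
  proof -
    have "continuous_on S (\<lambda>x. \<chi> i j. diag_phase (f x) $ i $ j)"
      by (intro continuous_on_vec_lambda entry f)
    then show ?thesis
      by simp
  qed
  show "continuous_on UNIV diag_phase"
    using diag[of UNIV "\<lambda>x. x"] by (simp add: continuous_on_id)
  have SU: "cmat R ** diag_phase \<phi> ** transpose (cmat R) \<in> sym_unitary" if "rotation_matrix R" for R \<phi>
    unfolding diag_phase_eq by (rule conj_diag_exp_in_sym_unitary[OF that])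
  have "rotation_matrix (mat 1 :: real^4^4)"
    by (simp add: rotation_matrix_def orthogonal_matrix_id)
  then show "range diag_phase \<subseteq> sym_unitary"
    using SU[of "mat 1"] by (auto simp: cmat_one)
  show "compact ?K" "compact ?B"
    by (auto intro!: compact_Times compact_rotation_matrices)
  show "continuous_on (?K \<times> ?B) ?G"
    unfolding phase_def map_matrix_def
    by (intro continuous_intros continuous_on_matrix_mult continuous_on_transpose diag)
  show "?G (k, \<phi>) \<in> sym_unitary \<and> moduli_class (?G (k, \<phi>)) = moduli_class (diag_phase \<phi>)"
    if kK: "k \<in> ?K" for k \<phi>
  proof
    obtain t R where k: "k = (t, R)" "rotation_matrix R"
      using kK by auto
    have "phase t (cmat R ** diag_phase \<phi> ** transpose (cmat R)) =
        cmat R ** diag_exp (\<chi> i. phase4 \<phi> $ i + t) ** transpose (cmat R)"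
      unfolding diag_phase_eq phase_diag_exp[symmetric] phase_mult ..
    then show "?G (k, \<phi>) \<in> sym_unitary"
      using conj_diag_exp_in_sym_unitary[OF k(2)] by (simp add: k)
    show "moduli_class (?G (k, \<phi>)) = moduli_class (diag_phase \<phi>)"
      unfolding moduli_class_eq_iff moduli_class_iff using k by auto
  qed
  show "sym_unitary \<subseteq> ?G ` (?K \<times> ?B)"
  proof
    fix \<Lambda> assume "\<Lambda> \<in> sym_unitary"
    then obtain R x where R: "rotation_matrix R" and \<Lambda>: "\<Lambda> = cmat R ** diag_exp x ** transpose (cmat R)"
      by (rule sym_unitary_diagonalization)
    \<comment> \<open>The first phase is absorbed into the scalar \<open>t\<close>; the remaining
      three are reduced relative to it.\<close>
    obtain t n where t: "0 \<le> t" "t \<le> pi" "x $ 1 = t + pi * of_int n"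
      using exists_mod_interval[of pi "x $ 1"] by auto
    obtain a na where a: "0 \<le> a" "a \<le> pi" "x $ 2 - t = a + pi * of_int na"
      using exists_mod_interval[of pi "x $ 2 - t"] by auto
    obtain b nb where b: "0 \<le> b" "b \<le> pi" "x $ 3 - t = b + pi * of_int nb"
      using exists_mod_interval[of pi "x $ 3 - t"] by auto
    obtain c nc where c: "0 \<le> c" "c \<le> pi" "x $ 4 - t = c + pi * of_int nc"
      using exists_mod_interval[of pi "x $ 4 - t"] by auto
    define \<phi> :: "real^3" where "\<phi> = vector [a, b, c]"
    have "\<phi> \<in> ?B"
      using a b c by (simp add: mem_box_cart forall_3 \<phi>_def)
    moreover have "diag_exp x = diag_exp (\<chi> i. phase4 \<phi> $ i + t)"
    proof (rule diag_exp_cong)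
      show "\<exists>m :: int. x $ i = (\<chi> i. phase4 \<phi> $ i + t) $ i + pi * m" for i
        using exhaust_4[of i] t a b c
        by (elim disjE; intro exI[of _
            "if i = 1 then n else if i = 2 then na else if i = 3 then nb else nc"])
          (simp_all add: phase4_def \<phi>_def algebra_simps)
    qed
    then have "\<Lambda> = ?G ((t, R), \<phi>)"
      unfolding \<Lambda> by (simp add: diag_phase_eq phase_diag_exp[symmetric] phase_mult)
    moreover have "((t, R), \<phi>) \<in> ?K \<times> ?B" if "\<phi> \<in> ?B"
      using that R t by simp
    ultimately show "\<Lambda> \<in> ?G ` (?K \<times> ?B)"
      by (intro image_eqI[of _ ?G "((t, R), \<phi>)"])
  qed
qed

lemma quotient_map_torus: "quotient_map euclidean conj_topology torus_conj_class"
  unfolding torus_conj_class_def[abs_def] matrix_exp_block_so6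
proof (rule quotient_map_of_compact_cover)
  let ?K = "{R :: real^6^6. rotation_matrix R}"
  let ?B = "cbox (0 :: real^3) (\<chi> k. 2 * pi)"
  let ?G = "\<lambda>x. fst x ** rot6 (snd x) ** transpose (fst x)"
  show "quotient_map (top_of_set (carrier SO6)) conj_topology (\<lambda>A. PSO6_conj_class (PSO6_class A))"
    using quotient_map_compose[OF quotient_map_quotient_topology quotient_map_quotient_topology,
      of "top_of_set (carrier SO6)" PSO6_class PSO6_conj_class]
    unfolding conj_topology_def o_def .
  have entry: "continuous_on S (\<lambda>x. rot6 (f x) $ i $ j)" if f: "continuous_on S f" for S
      and f :: "'a::metric_space \<Rightarrow> real^3" and i j
  proof -
    have cs: "continuous_on S (\<lambda>x. cos (f x $ k))" "continuous_on S (\<lambda>x. sin (f x $ k))"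
      "continuous_on S (\<lambda>x. - sin (f x $ k))" for k
      using bounded_linear.continuous_on[OF bounded_linear_vec_nth f]
      by (simp_all add: continuous_on_cos continuous_on_sin continuous_on_minus)
    show ?thesis
      using exhaust_6[of i] exhaust_6[of j] by (elim disjE) (simp_all add: rot6_def block6_def cs)
  qed
  have rot: "continuous_on S (\<lambda>x. rot6 (f x))" if f: "continuous_on S f" for S
      and f :: "'a::metric_space \<Rightarrow> real^3"
  proof -
    have "continuous_on S (\<lambda>x. \<chi> i j. rot6 (f x) $ i $ j)"
      by (intro continuous_on_vec_lambda entry f)
    then show ?thesis
      by simp
  qed
  show "continuous_on UNIV rot6"
    using rot[of UNIV "\<lambda>x. x"] by (simp add: continuous_on_id)
  show "range rot6 \<subseteq> carrier SO6"
    using rotation_matrix_rot6 by (auto simp: SO6_simps)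
  show "compact ?K" "compact ?B"
    by (auto intro!: compact_rotation_matrices)
  show "continuous_on (?K \<times> ?B) ?G"
    by (intro continuous_intros continuous_on_matrix_mult continuous_on_transpose rot)
  show "?G (R, \<theta>) \<in> carrier SO6 \<and>
      PSO6_conj_class (PSO6_class (?G (R, \<theta>))) = PSO6_conj_class (PSO6_class (rot6 \<theta>))" if "R \<in> ?K"
          for R \<theta>
  proof
    show "?G (R, \<theta>) \<in> carrier SO6"
      using that by (simp add: SO6_simps rotation_matrix_mult rotation_matrix_transpose rotation_matrix_rot6)
    have "PSO6_conj_class (PSO6_class (rot6 \<theta>)) = PSO6_conj_class (PSO6_class (?G (R, \<theta>)))"
      unfolding PSO6_conj_class_eq_iff using that by auto
    then show "PSO6_conj_class (PSO6_class (?G (R, \<theta>))) = PSO6_conj_class (PSO6_class (rot6 \<theta>))"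
      by (rule HOL.sym)
  qed
  show "carrier SO6 \<subseteq> ?G ` (?K \<times> ?B)"
  proof
    fix A assume "A \<in> carrier SO6"
    then have "rotation_matrix A"
      by (simp add: SO6_simps)
    then obtain R \<theta> where R: "rotation_matrix R" and A: "A = R ** rot6 \<theta> ** transpose R"
      by (rule rotation_matrix_torus)
    have "\<forall>k. \<exists>y. 0 \<le> y \<and> y \<le> 2 * pi \<and> (\<exists>n :: int. \<theta> $ k = y + 2 * pi * n)"
      using exists_mod_interval[of "2 * pi"] by auto
    then obtain y where y: "\<And>k. 0 \<le> y k" "\<And>k. y k \<le> 2 * pi" "\<And>k. \<exists>n :: int. \<theta> $ k = y k + 2 * pi * n"
      unfolding choice_iff by blast
    define \<eta> :: "real^3" where "\<eta> = (\<chi> k. y k)"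
    have "sin (\<theta> $ k) = sin (\<eta> $ k) \<and> cos (\<theta> $ k) = cos (\<eta> $ k)" for k
      unfolding sin_cos_eq_iff \<eta>_def using y(3) by simp
    then have "rot6 \<theta> = rot6 \<eta>"
      by (simp add: rot6_def)
    moreover have "\<eta> \<in> ?B"
      using y by (simp add: mem_box_cart \<eta>_def)
    ultimately show "A \<in> ?G ` (?K \<times> ?B)"
      unfolding A using R by force
  qed
qed

theorem theorem2:
  shows "\<exists>D. (\<forall>\<phi>. D (moduli_class (diag_phase \<phi>)) = torus_conj_class (2 *\<^sub>R psi_coord \<phi>)) \<and>
             homeomorphic_map moduli_topology conj_topology D \<and>
             (\<lambda>L. D ` L) ` scaling_foliation = gradient_foliation"
proof -
  let ?L = "\<lambda>\<phi>. 2 *\<^sub>R psi_coord \<phi>"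
  let ?q = "\<lambda>\<phi>. moduli_class (diag_phase \<phi>)"
  have "continuous_on UNIV ?L" "continuous_on UNIV phi_of"
    by (intro linear_continuous_on linear_psi_coord linear_phi_of iffD1[OF linear_conv_bounded_linear])+
  then have "homeomorphic_maps euclidean euclidean ?L phi_of"
    by (simp add: homeomorphic_maps_def psi_coord_inverse)
  then have "quotient_map euclidean euclidean ?L"
    using homeomorphic_maps_imp_map homeomorphic_map_def by blast
  then have r: "quotient_map euclidean conj_topology (\<lambda>\<phi>. torus_conj_class (?L \<phi>))"
    using quotient_map_compose[OF _ quotient_map_torus] by (simp add: o_def)
  \<comment> \<open>Both directions pass through \<open>torus_equiv\<close>, applied to the doubled
    coordinates.\<close>
  have "?q \<phi> = ?q \<phi>' \<longleftrightarrow> torus_conj_class (?L \<phi>) = torus_conj_class (?L \<phi>')" for \<phi> \<phi>'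
  proof
    assume "?q \<phi> = ?q \<phi>'"
    then have "torus_equiv (?L \<phi>) (?L \<phi>')"
      unfolding diag_phase_eq theta4_phase4[symmetric] by (rule torus_equiv_of_moduli_class_eq)
    then show "torus_conj_class (?L \<phi>) = torus_conj_class (?L \<phi>')"
      by (rule torus_conj_class_cong)
  next
    assume "torus_conj_class (?L \<phi>) = torus_conj_class (?L \<phi>')"
    then show "?q \<phi> = ?q \<phi>'"
      using moduli_class_phi_of_cong[of "?L \<phi>" "?L \<phi>'"]
      by (simp add: torus_equiv_iff_torus_conj_class_eq psi_coord_inverse)
  qed
  then obtain D where D: "homeomorphic_map moduli_topology conj_topology D"
    "\<And>\<phi>. D (?q \<phi>) = torus_conj_class (?L \<phi>)"
    by (rule homeomorphic_map_quotients[OF quotient_map_moduli r]) simp_all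
  have a: "D ` (?q ` vf_orbit scaling_field \<phi>)
      = torus_conj_class ` vf_orbit character_gradient (?L \<phi>)" for \<phi>
    unfolding vf_orbit_scaling_field[symmetric] by (simp add: image_image D(2))
  have b: "scaling_foliation = range (\<lambda>\<phi>. ?q ` vf_orbit scaling_field \<phi>)"
    unfolding scaling_foliation_def by blast
  have "(\<lambda>L. D ` L) ` scaling_foliation
      = range (\<lambda>\<phi>. torus_conj_class ` vf_orbit character_gradient (?L \<phi>))"
    unfolding b image_image[of "\<lambda>L. D ` L"] a ..
  also have "\<dots> = (\<lambda>\<theta>. torus_conj_class ` vf_orbit character_gradient \<theta>) ` range ?L"
    by (simp add: image_image)
  \<comment> \<open>Surjectivity ensures that every gradient orbit, not only some, is the image of a
    leaf.\<close>
  also have "range ?L = UNIV"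
    using psi_coord_inverse(2) by (metis surjI)
  also have "(\<lambda>\<theta>. torus_conj_class ` vf_orbit character_gradient \<theta>) ` UNIV = gradient_foliation"
    unfolding gradient_foliation_def by blast
  finally show ?thesis
    using D by blast
qed

end
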